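(* Let $y$ be an algebraic function with elliptic signature $(A,R)$. If the set of orders $R$ is not equal to $(2,3,5)$ (up to order), then $y$ can be represented in radicals. If $R=(2,3,5)$, then $y$ can be represented by radicals and solutions of algebraic equations of degree at most $5$.
   Context: $S=\mathbb{C}\cup\{\infty\}$ is the Riemann sphere. An algebraic function is a multivalued analytic function $y(x)$ on $S$ satisfying an irreducible polynomial equation over $\mathbb{C}(x)$; its Riemann surface is a (compact connected) branched covering of $S$. Let $A=\{a_1,\dots,a_n\}$ be its branching locus and let $r_i>1$ be the order of the local monodromy operator at $a_i$ (the element of the monodromy group, defined up to conjugation, corresponding to a small loop around $a_i$). The signature of the function is $(A,R)$ with set of orders $R=(r_1,\dots,r_n)$ (order of entries irrelevant). Standing assumptions: $n\ge 2$, and if $n=2$ then the two orders are equal. The universal covering with signature $(A,R)$ is a branched covering $\pi:Z\to S$ with $Z$ a simply connected Riemann surface, branched over $A$ only, such that $\pi$ has multiplicity $r_k$ at every point of $\pi^{-1}(a_k)$. The signature is elliptic if $Z$ is isomorphic to the Riemann sphere. "Represented in radicals" means that the function is obtained from complex rational functions of $x$ by arithmetic operations and extraction of roots of arbitrary degree; "by radicals and solutions of equations of degree at most $5$" means that additionally one may solve algebraic equations of degree at most $5$ whose coefficients have already been obtained. *)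

theory Defs
  imports
    "HOL-Complex_Analysis.Complex_Analysis"
    "HOL-Computational_Algebra.Computational_Algebra"
begin

section \<open>Riemann surfaces\<close>

record 'a surface =
  topo :: "'a topology"
  atlas :: "('a set \<times> ('a \<Rightarrow> complex)) set"

text \<open>
  A holomorphic chart \<open>\<phi>\<close> on \<open>U\<close>, i.e. a member of the maximal atlas.
  The values of \<open>\<phi>\<close> outside \<open>U\<close> are irrelevant.
\<close>

definition holo_chart :: "'a surface \<Rightarrow> 'a set \<Rightarrow> ('a \<Rightarrow> complex) \<Rightarrow> bool" where
  "holo_chart X U \<phi> \<longleftrightarrow>
     openin (topo X) U \<and> open (\<phi> ` U) \<and>
     homeomorphic_map (subtopology (topo X) U) (top_of_set (\<phi> ` U)) \<phi> \<and>
     (\<forall>(V, \<psi>) \<in> atlas X.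
        (\<psi> \<circ> inv_into U \<phi>) holomorphic_on \<phi> ` (U \<inter> V) \<and>
        (\<phi> \<circ> inv_into V \<psi>) holomorphic_on \<psi> ` (U \<inter> V))"

definition riemann_surface :: "'a surface \<Rightarrow> bool" where
  "riemann_surface X \<longleftrightarrow>
     topspace (topo X) \<noteq> {} \<and> connected_space (topo X) \<and> Hausdorff_space (topo X) \<and>
     (\<forall>(U, \<phi>) \<in> atlas X. holo_chart X U \<phi>) \<and>
     (\<Union>(U, \<phi>) \<in> atlas X. U) = topspace (topo X)"

definition holomorphic_map :: "'a surface \<Rightarrow> 'b surface \<Rightarrow> ('a \<Rightarrow> 'b) \<Rightarrow> bool" where
  "holomorphic_map X Y f \<longleftrightarrow>
     continuous_map (topo X) (topo Y) f \<and>
     (\<forall>(U, \<phi>) \<in> atlas X. \<forall>(V, \<psi>) \<in> atlas Y.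
        (\<psi> \<circ> f \<circ> inv_into U \<phi>) holomorphic_on \<phi> ` (U \<inter> f -` V))"

definition isomorphic_surfaces :: "'a surface \<Rightarrow> 'b surface \<Rightarrow> bool" where
  "isomorphic_surfaces X Y \<longleftrightarrow>
     (\<exists>f g. holomorphic_map X Y f \<and> holomorphic_map Y X g \<and>
            (\<forall>x \<in> topspace (topo X). g (f x) = x) \<and>
            (\<forall>y \<in> topspace (topo Y). f (g y) = y))"

text \<open>
  The counterpart of \<^const>\<open>simply_connected\<close> for abstract topological spaces; as there,
  path-connectedness is included because constant loops must be homotopic to each other.
\<close>

definition simply_connected_surface :: "'a surface \<Rightarrow> bool" where
  "simply_connected_surface X \<longleftrightarrow>
     (\<forall>p q. pathin (topo X) p \<and> p 1 = p 0 \<and> pathin (topo X) q \<and> q 1 = q 0 \<longrightarrow>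
        homotopic_with (\<lambda>h. h 1 = h 0) (top_of_set {0..1}) (topo X) p q)"

definition riemann_sphere :: "complex option surface" where
  "riemann_sphere =
     \<lparr>topo = Alexandroff_compactification euclidean,
      atlas = {(range Some, the),
               (- {Some 0}, \<lambda>p. case p of None \<Rightarrow> 0 | Some z \<Rightarrow> inverse z)}\<rparr>"


section \<open>Branched coverings\<close>

text \<open>
  Every point of the base has a disc neighbourhood \<open>U\<close> such that each component of
  its preimage is a disc on which the map is \<open>z \<mapsto> z ^ k\<close>. The number of sheets may be infinite.
\<close>

definition branched_covering :: "'a surface \<Rightarrow> 'b surface \<Rightarrow> ('a \<Rightarrow> 'b) \<Rightarrow> bool" where
  "branched_covering Z S \<pi> \<longleftrightarrow>
     holomorphic_map Z S \<pi> \<and>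
     (\<forall>s \<in> topspace (topo S). \<exists>U \<psi>.
        s \<in> U \<and> holo_chart S U \<psi> \<and> \<psi> ` U = ball 0 1 \<and> \<psi> s = 0 \<and>
        (\<forall>V \<in> connected_components_of (subtopology (topo Z) (\<pi> -` U)).
           \<exists>\<phi> k. k > 0 \<and> holo_chart Z V \<phi> \<and> \<phi> ` V = ball 0 1 \<and>
                 (\<forall>v \<in> V. \<psi> (\<pi> v) = \<phi> v ^ k)))"

definition has_multiplicity ::
    "'a surface \<Rightarrow> 'b surface \<Rightarrow> ('a \<Rightarrow> 'b) \<Rightarrow> 'a \<Rightarrow> nat \<Rightarrow> bool" where
  "has_multiplicity Z S \<pi> p k \<longleftrightarrow>
     k > 0 \<and>
     (\<exists>V \<phi> U \<psi>. holo_chart Z V \<phi> \<and> p \<in> V \<and> \<phi> p = 0 \<and>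
               holo_chart S U \<psi> \<and> \<pi> ` V \<subseteq> U \<and> \<psi> (\<pi> p) = 0 \<and>
               (\<forall>v \<in> V. \<psi> (\<pi> v) = \<phi> v ^ k))"

definition universal_covering_with_signature ::
    "'z surface \<Rightarrow> ('z \<Rightarrow> complex option) \<Rightarrow> complex option set \<Rightarrow> (complex option \<Rightarrow> nat) \<Rightarrow> bool"
  where
  "universal_covering_with_signature Z \<pi> A r \<longleftrightarrow>
     riemann_surface Z \<and> simply_connected_surface Z \<and>
     branched_covering Z riemann_sphere \<pi> \<and>
     (\<forall>p \<in> topspace (topo Z).
        has_multiplicity Z riemann_sphere \<pi> p (if \<pi> p \<in> A then r (\<pi> p) else 1))"


section \<open>Algebraic functions\<close>

text \<open>
  An algebraic function is given by its irreducible polynomial \<open>P\<close> over the field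
  \<^typ>\<open>complex poly fract\<close> of rational functions. As a multivalued analytic function it is
  the collection of all holomorphic branches of solutions of \<open>P(x, y) = 0\<close>; these are
  analytic continuations of each other because \<open>P\<close> is irreducible.
\<close>

definition algebraic_function :: "complex poly fract poly \<Rightarrow> bool" where
  "algebraic_function P \<longleftrightarrow> irreducible P"

definition ratfun_value :: "complex poly fract \<Rightarrow> complex \<Rightarrow> complex \<Rightarrow> bool" where
  "ratfun_value c x v \<longleftrightarrow> (\<exists>p q. c = Fract p q \<and> poly q x \<noteq> 0 \<and> v = poly p x / poly q x)"

definition ratfun_pole :: "complex poly fract \<Rightarrow> complex \<Rightarrow> bool" where
  "ratfun_pole c x \<longleftrightarrow> (\<nexists>v. ratfun_value c x v)"

definition ratfun_eval :: "complex poly fract \<Rightarrow> complex \<Rightarrow> complex" where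
  "ratfun_eval c x = (THE v. ratfun_value c x v)"

definition coeffs_finite_at :: "complex poly fract poly \<Rightarrow> complex \<Rightarrow> bool" where
  "coeffs_finite_at P x \<longleftrightarrow> (\<forall>i. \<not> ratfun_pole (coeff P i) x)"

definition fiber :: "complex poly fract poly \<Rightarrow> complex \<Rightarrow> complex set" where
  "fiber P x = {w. poly (map_poly (\<lambda>c. ratfun_eval c x) P) w = 0}"

definition is_branch ::
    "complex poly fract poly \<Rightarrow> complex set \<Rightarrow> (complex \<Rightarrow> complex) \<Rightarrow> bool" where
  "is_branch P D f \<longleftrightarrow>
     open D \<and> connected D \<and> D \<noteq> {} \<and> f holomorphic_on D \<and>
     (\<forall>x \<in> D. coeffs_finite_at P x \<longrightarrow> f x \<in> fiber P x)"


section \<open>Local monodromy and signature\<close>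

text \<open>
  Over all but finitely many points of the plane the coefficients of \<open>P\<close> are finite and \<open>fiber P x\<close>
  consists of \<open>degree P\<close> simple roots, one for each germ of the algebraic function at \<open>x\<close>.
  Along a path \<open>\<gamma>\<close> of such points, analytic continuation of the germs is the unique
  continuous choice of a root over the path.
\<close>

definition monodromy ::
    "complex poly fract poly \<Rightarrow> (real \<Rightarrow> complex) \<Rightarrow> complex \<Rightarrow> complex" where
  "monodromy P \<gamma> w =
     (THE w'. \<exists>\<eta>. path \<eta> \<and> pathstart \<eta> = w \<and> pathfinish \<eta> = w' \<and>
                  (\<forall>t \<in> {0..1}. \<eta> t \<in> fiber P (\<gamma> t)))"

text \<open>A circle of radius \<open>e\<close> around \<open>a\<close>, in the coordinate \<open>1 / x\<close> when \<open>a\<close> is infinity.\<close>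

fun loop_around :: "complex option \<Rightarrow> real \<Rightarrow> real \<Rightarrow> complex" where
  "loop_around (Some a) e = circlepath a e"
| "loop_around None e = (\<lambda>t. inverse (circlepath 0 e t))"

definition permutation_order :: "'a set \<Rightarrow> ('a \<Rightarrow> 'a) \<Rightarrow> nat" where
  "permutation_order F m = (LEAST k. k > 0 \<and> (\<forall>w \<in> F. (m ^^ k) w = w))"

text \<open>
  The order for all sufficiently small loops; it does not depend on the loop,
  since the monodromy operator is defined up to conjugation.
\<close>

definition local_monodromy_order ::
    "complex poly fract poly \<Rightarrow> complex option \<Rightarrow> nat \<Rightarrow> bool" where
  "local_monodromy_order P a k \<longleftrightarrow>
     (\<forall>\<^sub>F e in at_right 0.
        permutation_order (fiber P (pathstart (loop_around a e)))
          (monodromy P (loop_around a e)) = k)"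

definition branching_locus :: "complex poly fract poly \<Rightarrow> complex option set" where
  "branching_locus P = {a. \<exists>k > 1. local_monodromy_order P a k}"

text \<open>The orders are recorded as a function \<open>r\<close>, of which only the values on \<open>A\<close> matter.\<close>

definition has_signature ::
    "complex poly fract poly \<Rightarrow> complex option set \<Rightarrow> (complex option \<Rightarrow> nat) \<Rightarrow> bool" where
  "has_signature P A r \<longleftrightarrow>
     A = branching_locus P \<and> (\<forall>a \<in> A. local_monodromy_order P a (r a))"

definition orders :: "complex option set \<Rightarrow> (complex option \<Rightarrow> nat) \<Rightarrow> nat multiset" where
  "orders A r = image_mset r (mset_set A)"


section \<open>Representability\<close>

text \<open>
  The functions on \<open>U\<close> obtained from rational functions by arithmetic operations, roots,
  and solutions of equations of degree at most \<open>m\<close>. For \<open>m = 0\<close> the last rule never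
  applies, so only radicals remain. An operation on multivalued functions is performed on
  holomorphic branches over \<open>U\<close>; the rule for roots allows any branch.
\<close>

inductive obtainable :: "nat \<Rightarrow> complex set \<Rightarrow> (complex \<Rightarrow> complex) \<Rightarrow> bool"
  for m :: nat and U :: "complex set" where
  rational: "(\<forall>x \<in> U. poly q x \<noteq> 0) \<Longrightarrow> obtainable m U (\<lambda>x. poly p x / poly q x)"
| add: "obtainable m U f \<Longrightarrow> obtainable m U g \<Longrightarrow> obtainable m U (\<lambda>x. f x + g x)"
| diff: "obtainable m U f \<Longrightarrow> obtainable m U g \<Longrightarrow> obtainable m U (\<lambda>x. f x - g x)"
| mult: "obtainable m U f \<Longrightarrow> obtainable m U g \<Longrightarrow> obtainable m U (\<lambda>x. f x * g x)"
| divide: "obtainable m U f \<Longrightarrow> obtainable m U g \<Longrightarrow> (\<forall>x \<in> U. g x \<noteq> 0) \<Longrightarrow>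
    obtainable m U (\<lambda>x. f x / g x)"
| root: "obtainable m U g \<Longrightarrow> n > 0 \<Longrightarrow> f holomorphic_on U \<Longrightarrow> (\<forall>x \<in> U. f x ^ n = g x) \<Longrightarrow>
    obtainable m U f"
| equation: "1 \<le> d \<Longrightarrow> d \<le> m \<Longrightarrow> (\<And>i. i \<le> d \<Longrightarrow> obtainable m U (c i)) \<Longrightarrow>
    (\<forall>x \<in> U. c d x \<noteq> 0) \<Longrightarrow> f holomorphic_on U \<Longrightarrow>
    (\<forall>x \<in> U. (\<Sum>i\<le>d. c i x * f x ^ i) = 0) \<Longrightarrow> obtainable m U f"

text \<open>
  A representation may involve auxiliary functions with further singular points, so a
  branch on \<open>D\<close> is required to be obtainable on some domain inside \<open>D\<close>; by analytic
  continuation this determines the branch and the whole multivalued function.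
\<close>

definition representable :: "nat \<Rightarrow> complex poly fract poly \<Rightarrow> bool" where
  "representable m P \<longleftrightarrow>
     (\<forall>D f. is_branch P D f \<longrightarrow>
        (\<exists>U \<subseteq> D. open U \<and> connected U \<and> U \<noteq> {} \<and> obtainable m U f))"

definition representable_in_radicals :: "complex poly fract poly \<Rightarrow> bool" where
  "representable_in_radicals P \<longleftrightarrow> representable 0 P"

definition representable_by_radicals_and_equations_of_degree_at_most ::
    "nat \<Rightarrow> complex poly fract poly \<Rightarrow> bool" where
  "representable_by_radicals_and_equations_of_degree_at_most m P \<longleftrightarrow> representable m P"

end

theory Submission
  imports Defs
begin

text \<open>
  The idea is to make \<open>y\<close> single-valued by a rational change of variable \<open>x =
  \<Phi>(z)\<close>, \<open>\<Phi> = p / q\<close>, that can be inverted by the admissible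
  operations. Suppose that every finite point of the fiber of \<open>\<Phi>\<close> over
  \<open>a\<close> has multiplicity divisible by the order of the local monodromy at
  \<open>a\<close>. Then the branches of \<open>y(\<Phi>(z))\<close> are single-valued near every
  point \<open>z\<close> of the plane, hence, the plane being simply connected, on the whole plane
  minus finitely many points (\<open>split_globally\<close>, \<open>pullback_splits\<close>). Each
  of them satisfies a polynomial equation over \<open>\<complex>[z]\<close>; therefore it grows at
  most polynomially at infinity and at the exceptional points, and is a rational function of
  \<open>z\<close> (\<open>pulled_back_section_rational\<close>). So a branch of \<open>y\<close> is
  a rational function of any branch of \<open>z = \<Phi>\<^sup>-\<^sup>1(x)\<close>, and
  \<open>y\<close> is representable as soon as \<open>\<Phi>\<^sup>-\<^sup>1\<close> is
  (\<open>uniformized_imp_representable\<close>).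

  The map \<open>\<Phi>\<close> depends only on the branch points and the orders. For two branch
  points of order \<open>n\<close> it is \<open>z ^ n\<close> up to a Moebius map. For three branch
  points it comes from the identities between the invariant forms of the dihedral, tetrahedral,
  octahedral and icosahedral groups, which exhibit \<open>u\<close>, \<open>v\<close> and \<open>u -
  v\<close> as powers. The equation \<open>u(z) = \<xi> v(z)\<close> is solved by explicit square,
  cube and \<open>n\<close>-th roots, and in the icosahedral case by one equation of degree five in
  addition (\<open>spherical_signature_uniformizable\<close>).

  That the signature is elliptic enters only as a bound on the orders. The universal covering,
  composed with an isomorphism of its total space with the sphere, is a rational function
  (\<open>spherical_covering_rational\<close>), and counting the zeros of a Wronskian gives
  \<open>(\<Sum>a\<in>A. 1 - 1 / r a) < 2\<close> (\<open>ramification_inequality\<close>), an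
  algebraic form of the Riemann-Hurwitz count. This leaves the orders \<open>(n, n)\<close>,
  \<open>(2, 2, n)\<close>, \<open>(2, 3, 3)\<close>, \<open>(2, 3, 4)\<close> and \<open>(2, 3,
  5)\<close>.

  Monodromy is defined by lifting loops. It is connected with holomorphic branches by pulling the
  fibers back along the exponential function: over a half-plane, which covers a punctured disc
  around \<open>a\<close>, all branches exist globally, and the monodromy operator becomes the
  translation by \<open>2 \<pi> \<i>\<close>. Its order is the least \<open>k\<close> for which the
  branches are single-valued functions of a \<open>k\<close>-th root of the local coordinate
  (\<open>fiber_uniformization\<close>).
\<close>

section \<open>Generic fibers of an algebraic function\<close>

text \<open>
  An element of least degree in the ideal generated by \<open>P\<close> and \<open>Q\<close> divides
  both, since a remainder of the division by it would be an element of smaller degree.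
\<close>

lemma degree_minimal_Bezout:
  fixes P Q :: "'a::field poly"
  assumes "P \<noteq> 0"
  obtains a b g where "g = a * P + b * Q" "g \<noteq> 0" "g dvd P" "g dvd Q"
proof -
  define I where "I = {(a, b). a * P + b * Q \<noteq> 0}"
  have "(1, 0) \<in> I" using assms by (simp add: I_def)
  then obtain ab where ab: "ab \<in> I"
      and least: "\<And>cd. cd \<in> I \<Longrightarrow> degree (fst ab * P + snd ab * Q) \<le> degree (fst cd * P + snd cd * Q)"
    using ex_has_least_nat[of "\<lambda>x. x \<in> I" "(1, 0)" "\<lambda>ab. degree (fst ab * P + snd ab * Q)"] by blast
  define a b where "a = fst ab" and "b = snd ab"
  have min: "degree (a * P + b * Q) \<le> degree (a' * P + b' * Q)" if "(a', b') \<in> I" for a' b'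
    using least[OF that] by (simp add: a_def b_def)
  define g where "g = a * P + b * Q"
  have "g \<noteq> 0" using ab by (auto simp: I_def g_def a_def b_def)
  have rem0: "x mod g = 0" if "x = c * P + d * Q" for x c d
  proof (rule ccontr)
    assume nz: "x mod g \<noteq> 0"
    have eq: "x mod g = (c - x div g * a) * P + (d - x div g * b) * Q"
      using div_mult_mod_eq[of x g] that unfolding g_def by (simp add: algebra_simps)
    with nz have "degree g \<le> degree (x mod g)"
      using min[of "c - x div g * a" "d - x div g * b"] by (simp add: I_def g_def)
    moreover have "degree (x mod g) < degree g"
      using degree_mod_less'[OF \<open>g \<noteq> 0\<close> nz] .
    ultimately show False by simp
  qed
  show thesis
  proof (rule that)
    show "g dvd P" using rem0[of P 1 0] by (simp add: mod_eq_0_iff_dvd)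
    show "g dvd Q" using rem0[of Q 0 1] by (simp add: mod_eq_0_iff_dvd)
  qed (fact g_def, fact)
qed

text \<open>
  A common divisor of \<open>P\<close> and its derivative has smaller degree than \<open>P\<close>,
  so irreducibility makes it a unit.
\<close>

lemma irreducible_coprime_pderiv:
  fixes P :: "'a::field poly"
  assumes "irreducible P" "pderiv P \<noteq> 0"
  obtains a b where "a * P + b * pderiv P = 1"
proof -
  have "P \<noteq> 0" using assms by auto
  obtain a b g where g: "g = a * P + b * pderiv P" "g \<noteq> 0" "g dvd P" "g dvd pderiv P"
    by (rule degree_minimal_Bezout[OF \<open>P \<noteq> 0\<close>])
  obtain h where h: "P = g * h" using g(3) by (elim dvdE)
  have "\<not> h dvd 1"
  proof
    assume "h dvd 1"
    then obtain c where "h = [:c:]" by (rule is_unit_polyE)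
    hence "degree h = 0" by simp
    hence "degree P = degree g" using h \<open>P \<noteq> 0\<close> by (simp add: degree_mult_eq)
    moreover have "degree g \<le> degree (pderiv P)"
      using g(4) assms(2) by (rule dvd_imp_degree_le)
    moreover have "degree (pderiv P) < degree P"
    proof (rule degree_lessI)
      show "pderiv P \<noteq> 0 \<or> 0 < degree P" using assms(2) by simp
      show "\<forall>k\<ge>degree P. coeff (pderiv P) k = 0"
        by (simp add: coeff_pderiv coeff_eq_0)
    qed
    ultimately show False by simp
  qed
  hence "g dvd 1" using irreducibleD[OF assms(1) h] by simp
  then obtain c where c: "1 = g * c" by (elim dvdE)
  have "(c * a) * P + (c * b) * pderiv P = g * c"
    unfolding g(1) by (simp add: algebra_simps)
  hence "(c * a) * P + (c * b) * pderiv P = 1"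
    by (rule trans) (rule c[symmetric])
  thus thesis by (rule that)
qed

lemma clear_denominators:
  fixes R :: "'a::idom fract poly"
  obtains e Q where "e \<noteq> 0" "smult (to_fract e) R = map_poly to_fract Q"
proof -
  have "\<exists>e Q. e \<noteq> 0 \<and> smult (to_fract e) R = map_poly to_fract Q"
  proof (induction R)
    case 0
    show ?case by (rule exI[of _ 1], rule exI[of _ 0]) auto
  next
    case (pCons c R)
    then obtain e Q where e: "e \<noteq> 0" "smult (to_fract e) R = map_poly to_fract Q" by auto
    obtain p q where pq: "c = Fract p q" "q \<noteq> 0" by (cases c) auto
    have "to_fract (e * q) * c = to_fract (e * p)"
      using pq by (simp add: to_fract_def eq_fract)
    moreover have "smult (to_fract (e * q)) R = smult (to_fract q) (map_poly to_fract Q)"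
      by (simp add: e(2)[symmetric] mult.commute)
    ultimately have "smult (to_fract (e * q)) (pCons c R) = map_poly to_fract (pCons (e * p) (smult q Q))"
      by (simp add: map_poly_pCons)
    thus ?case using e pq by (intro exI[of _ "e * q"] exI conjI) auto
  qed
  thus thesis using that by blast
qed

lemma pderiv_map_to_fract: "pderiv (map_poly to_fract Q) = map_poly to_fract (pderiv Q)"
  for Q :: "'a::idom poly"
proof (rule poly_eqI)
  fix n
  have "of_nat k = to_fract (of_nat k :: 'a)" for k
    by (induction k) auto
  thus "coeff (pderiv (map_poly to_fract Q)) n = coeff (map_poly to_fract (pderiv Q)) n"
    by (simp add: coeff_pderiv coeff_map_poly del: of_nat_Suc)
qed

text \<open>
  The value \<open>Q(x, w)\<close>. As the evaluation of \<open>Q\<close> at the constant polynomial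
  \<open>w\<close>, followed by evaluation at \<open>x\<close>, it inherits the homomorphism rules
  of \<^const>\<open>poly\<close>.
\<close>

definition bipoly :: "complex poly poly \<Rightarrow> complex \<Rightarrow> complex \<Rightarrow> complex" where
  "bipoly Q x w = poly (poly Q [:w:]) x"

lemma bipoly_altdef: "bipoly Q x w = (\<Sum>i\<le>degree Q. poly (coeff Q i) x * w ^ i)"
  by (simp add: bipoly_def poly_altdef[of Q] poly_sum poly_power)

lemma poly_specialize: "poly (map_poly (\<lambda>c. poly c x) Q) w = bipoly Q x w"
  by (induction Q) (auto simp: bipoly_def map_poly_pCons)

lemma ratfun_eval_Fract:
  assumes "poly e x \<noteq> 0"
  shows "ratfun_eval (Fract c e) x = poly c x / poly e x"
proof -
  have "e \<noteq> 0" using assms by auto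
  show ?thesis unfolding ratfun_eval_def
  proof (rule the_equality)
    show "ratfun_value (Fract c e) x (poly c x / poly e x)"
      using assms unfolding ratfun_value_def by blast
  next
    fix v assume "ratfun_value (Fract c e) x v"
    then obtain p q where pq: "Fract c e = Fract p q" "poly q x \<noteq> 0" "v = poly p x / poly q x"
      unfolding ratfun_value_def by blast
    hence "q \<noteq> 0" by auto
    hence "c * q = p * e" using pq(1) \<open>e \<noteq> 0\<close> by (simp add: eq_fract)
    hence "poly c x * poly q x = poly p x * poly e x" by (metis poly_mult)
    thus "v = poly c x / poly e x" using pq(2,3) assms by (simp add: frac_eq_eq mult.commute)
  qed
qed

lemma fiber_clear_denominators:
  assumes "e \<noteq> 0" "smult (to_fract e) P = map_poly to_fract Q" "poly e x \<noteq> 0"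
  shows "coeffs_finite_at P x" "fiber P x = {w. bipoly Q x w = 0}"
proof -
  have cf: "coeff P i = Fract (coeff Q i) e" for i
  proof -
    have "to_fract e * coeff P i = to_fract (coeff Q i)"
      using arg_cong[OF assms(2), of "\<lambda>p. coeff p i"] by (simp add: coeff_map_poly)
    thus ?thesis using assms(1) by (simp add: Fract_conv_to_fract field_simps)
  qed
  show "coeffs_finite_at P x"
    unfolding coeffs_finite_at_def ratfun_pole_def ratfun_value_def using cf assms(3) by blast
  have "map_poly (\<lambda>c. poly c x) Q = smult (poly e x) (map_poly (\<lambda>c. ratfun_eval c x) P)"
  proof (rule poly_eqI)
    fix i
    have z: "ratfun_eval 0 x = 0"
      using ratfun_eval_Fract[of e x 0] assms(3) by (simp add: Fract_conv_to_fract)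
    show "coeff (map_poly (\<lambda>c. poly c x) Q) i = coeff (smult (poly e x) (map_poly (\<lambda>c. ratfun_eval c x) P)) i"
      using assms(3) by (simp add: coeff_map_poly z cf ratfun_eval_Fract)
  qed
  hence "bipoly Q x w = poly e x * poly (map_poly (\<lambda>c. ratfun_eval c x) P) w" for w
    by (metis poly_specialize poly_smult)
  thus "fiber P x = {w. bipoly Q x w = 0}"
    using assms(3) by (auto simp: fiber_def)
qed

text \<open>
  Clearing denominators in a Bezout identity for \<open>P\<close> and its derivative gives an
  identity over \<open>\<complex>[x]\<close> with a nonzero right-hand side. Wherever that
  right-hand side does not vanish, \<open>Q\<close> and its derivative have no common root. The
  finite set \<open>B\<close> collects its zeros and those of the leading coefficient and of the
  denominators.
\<close>

theorem generic_fiber: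
  assumes "algebraic_function P"
  obtains Q B where "finite B" "degree Q > 0"
    "\<And>x. x \<notin> B \<Longrightarrow> coeffs_finite_at P x"
    "\<And>x. x \<notin> B \<Longrightarrow> fiber P x = {w. bipoly Q x w = 0}"
    "\<And>x. x \<notin> B \<Longrightarrow> poly (lead_coeff Q) x \<noteq> 0"
    "\<And>x w. x \<notin> B \<Longrightarrow> bipoly Q x w = 0 \<Longrightarrow> bipoly (pderiv Q) x w \<noteq> 0"
proof -
  have irr: "irreducible P" using assms by (simp add: algebraic_function_def)
  obtain e Q where Q: "e \<noteq> 0" "smult (to_fract e) P = map_poly to_fract Q"
    by (rule clear_denominators)
  have "P \<noteq> 0" using irr by auto
  have "degree (map_poly to_fract Q) = degree Q"
    by (rule degree_map_poly) auto
  hence degQ: "degree Q = degree P" using Q by (metis degree_smult_eq to_fract_eq_0_iff)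
  have "degree P > 0"
  proof (rule ccontr)
    assume "\<not> degree P > 0"
    then obtain c where c: "P = [:c:]" using degree_eq_zeroE by blast
    with \<open>P \<noteq> 0\<close> have "c \<noteq> 0" by auto
    hence "P dvd 1" using c by (simp add: is_unit_const_poly_iff dvd_field_iff)
    with irr show False by (simp add: irreducible_def)
  qed
  have dQ: "pderiv Q \<noteq> 0" using degQ \<open>degree P > 0\<close> by (simp add: pderiv_eq_0_iff)
  have "smult (to_fract e) (pderiv P) = map_poly to_fract (pderiv Q)"
    using Q(2) by (metis pderiv_smult pderiv_map_to_fract)
  hence "pderiv P \<noteq> 0" using dQ by (metis fract_poly_eq_0_iff smult_0_right)
  then obtain a b where ab: "a * P + b * pderiv P = 1"
    using irreducible_coprime_pderiv[OF irr] by blast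
  obtain ea Qa where Qa: "ea \<noteq> 0" "smult (to_fract ea) a = map_poly to_fract Qa"
    by (rule clear_denominators)
  obtain eb Qb where Qb: "eb \<noteq> 0" "smult (to_fract eb) b = map_poly to_fract Qb"
    by (rule clear_denominators)
  have "map_poly to_fract (smult eb (Qa * Q) + smult ea (Qb * pderiv Q)) =
        map_poly to_fract [:ea * eb * e:]"
  proof -
    have "map_poly to_fract (smult eb (Qa * Q) + smult ea (Qb * pderiv Q)) =
      smult (to_fract (ea * eb * e)) (a * P + b * pderiv P)"
      by (simp add: Qa(2)[symmetric] Qb(2)[symmetric] Q(2)[symmetric] pderiv_map_to_fract[symmetric]
           pderiv_smult smult_add_right mult_ac)
    also have "\<dots> = map_poly to_fract [:ea * eb * e:]" by (simp add: ab map_poly_pCons)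
    finally show ?thesis .
  qed
  hence bez: "smult eb (Qa * Q) + smult ea (Qb * pderiv Q) = [:ea * eb * e:]"
    by (simp only: fract_poly_eq_iff)
  \<comment> \<open>the exceptional points are the zeros of this polynomial\<close>
  define E where "E = ea * eb * e * lead_coeff Q"
  have "E \<noteq> 0" using Q(1) Qa(1) Qb(1) dQ unfolding E_def by auto
  show thesis
  proof (rule that[of "{x. poly E x = 0}" Q])
    show "finite {x. poly E x = 0}" using \<open>E \<noteq> 0\<close> by (rule poly_roots_finite)
    show "degree Q > 0" using degQ \<open>degree P > 0\<close> by simp
    fix x assume "x \<notin> {x. poly E x = 0}"
    hence x: "poly e x \<noteq> 0" "poly ea x \<noteq> 0" "poly eb x \<noteq> 0" "poly (lead_coeff Q) x \<noteq> 0"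
      by (auto simp: E_def)
    show "coeffs_finite_at P x" "fiber P x = {w. bipoly Q x w = 0}"
      using fiber_clear_denominators[OF Q x(1)] by auto
    show "poly (lead_coeff Q) x \<noteq> 0" by fact
    fix w assume w: "bipoly Q x w = 0"
    show "bipoly (pderiv Q) x w \<noteq> 0"
    proof
      assume w': "bipoly (pderiv Q) x w = 0"
      have "poly (poly (smult eb (Qa * Q) + smult ea (Qb * pderiv Q)) [:w:]) x = 0"
        using w w' by (simp add: bipoly_def)
      thus False using x by (simp add: bez)
    qed
  qed
qed

section \<open>Local branches\<close>

text \<open>
  The divided difference of \<open>Q(x, w)\<close> in the variable \<open>w\<close>; on the diagonal
  it is the partial derivative.
\<close>

definition bipoly_quotient :: "complex poly poly \<Rightarrow> complex \<Rightarrow> complex \<Rightarrow> complex \<Rightarrow> complex" where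
  "bipoly_quotient Q x w w' =
     (\<Sum>i\<le>degree Q. poly (coeff Q i) x * (\<Sum>j<i. w' ^ (i - Suc j) * w ^ j))"

lemma bipoly_diff: "bipoly Q x w - bipoly Q x w' = (w - w') * bipoly_quotient Q x w w'"
proof -
  have "bipoly Q x w - bipoly Q x w' = (\<Sum>i\<le>degree Q. poly (coeff Q i) x * (w ^ i - w' ^ i))"
    by (simp add: bipoly_altdef sum_subtractf algebra_simps)
  also have "\<dots> = (w - w') * bipoly_quotient Q x w w'"
    unfolding bipoly_quotient_def sum_distrib_left
    by (intro sum.cong refl) (simp add: power_diff_sumr2 mult_ac sum_distrib_left)
  finally show ?thesis .
qed

lemma continuous_bipoly [continuous_intros]:
  assumes "continuous F f" "continuous F g"
  shows "continuous F (\<lambda>t. bipoly Q (f t) (g t))"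
  unfolding bipoly_altdef by (intro continuous_intros assms)

lemma isCont_imp_tendsto_nhds: "isCont f x \<Longrightarrow> (f \<longlongrightarrow> f x) (nhds x)"
  by (simp add: isCont_def tendsto_at_iff_tendsto_nhds)

lemma continuous_bipoly_quotient:
  assumes "continuous F f" "continuous F g" "continuous F h"
  shows "continuous F (\<lambda>t. bipoly_quotient Q (f t) (g t) (h t))"
  unfolding bipoly_quotient_def by (intro continuous_intros assms)

lemma bipoly_quotient_diagonal: "bipoly_quotient Q x w w = bipoly (pderiv Q) x w"
proof -
  have "((\<lambda>v. bipoly_quotient Q x v w) \<longlongrightarrow> bipoly_quotient Q x w w) (at w)"
    using continuous_bipoly_quotient[of "at w" "\<lambda>_. x" "\<lambda>v. v" "\<lambda>_. w" Q]
    by (simp add: continuous_at isCont_def)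
  moreover have "((\<lambda>v. bipoly_quotient Q x v w) \<longlongrightarrow> bipoly (pderiv Q) x w) (at w)"
  proof -
    have "pderiv (map_poly (\<lambda>c. poly c x) Q) = map_poly (\<lambda>c. poly c x) (pderiv Q)"
      by (rule poly_eqI) (simp add: coeff_pderiv coeff_map_poly of_nat_poly del: of_nat_Suc)
    hence "((\<lambda>v. bipoly Q x v) has_field_derivative bipoly (pderiv Q) x w) (at w)"
      using poly_DERIV[of "map_poly (\<lambda>c. poly c x) Q" w] by (simp add: poly_specialize)
    hence "((\<lambda>v. (bipoly Q x v - bipoly Q x w) / (v - w)) \<longlongrightarrow> bipoly (pderiv Q) x w) (at w)"
      by (simp add: has_field_derivative_iff)
    thus ?thesis
      by (rule Lim_transform_eventually) (auto simp: bipoly_diff eventually_at_filter)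
  qed
  ultimately show ?thesis by (rule tendsto_unique[OF at_neq_bot])
qed

text \<open>
  The situation of \<open>generic_fiber\<close>: outside \<open>B\<close> the roots are locally
  holomorphic functions of \<open>x\<close>.
\<close>

locale squarefree_family =
  fixes Q :: "complex poly poly" and B :: "complex set"
  assumes finite_B: "finite B"
    and degree_pos: "degree Q > 0"
    and lead_nonzero: "\<And>x. x \<notin> B \<Longrightarrow> poly (lead_coeff Q) x \<noteq> 0"
    and simple_roots: "\<And>x w. x \<notin> B \<Longrightarrow> bipoly Q x w = 0 \<Longrightarrow> bipoly (pderiv Q) x w \<noteq> 0"
begin

definition roots :: "complex \<Rightarrow> complex set" where "roots x = {w. bipoly Q x w = 0}"

lemma
  assumes "x \<notin> B"
  shows card_roots: "card (roots x) = degree Q"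
    and bipoly_factorization: "bipoly Q x w = poly (lead_coeff Q) x * (\<Prod>v\<in>roots x. w - v)"
proof -
  define q where "q = map_poly (\<lambda>c. poly c x) Q"
  have deg: "degree q = degree Q"
    unfolding q_def using lead_nonzero[OF assms] by (intro map_poly_degree_eq) auto
  have lc: "lead_coeff q = poly (lead_coeff Q) x"
    unfolding deg by (simp add: q_def coeff_map_poly)
  have "pderiv q = map_poly (\<lambda>c. poly c x) (pderiv Q)"
    unfolding q_def by (rule poly_eqI) (simp add: coeff_pderiv coeff_map_poly of_nat_poly del: of_nat_Suc)
  hence "rsquarefree q"
    using simple_roots[OF assms] unfolding rsquarefree_roots by (simp add: q_def poly_specialize)
  hence fac: "q = smult (lead_coeff q) (\<Prod>z\<in>roots x. [:-z, 1:])"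
    using complex_poly_decompose_rsquarefree[of q] by (simp add: roots_def q_def poly_specialize)
  have "lead_coeff q \<noteq> 0" using lc lead_nonzero[OF assms] by simp
  have "degree (\<Prod>z\<in>roots x. [:-z, 1:]) = (\<Sum>z\<in>roots x. degree [:-z, 1:])"
    by (rule degree_prod_sum_eq) auto
  thus "card (roots x) = degree Q"
    using arg_cong[OF fac, of degree] \<open>lead_coeff q \<noteq> 0\<close> deg by simp
  show "bipoly Q x w = poly (lead_coeff Q) x * (\<Prod>v\<in>roots x. w - v)"
    using arg_cong[OF fac, of "\<lambda>p. poly p w"] lc
    by (simp add: q_def poly_specialize poly_prod)
qed

lemma finite_roots: "x \<notin> B \<Longrightarrow> finite (roots x)"
  using card_roots degree_pos by (metis card.infinite less_numeral_extra(3))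

lemma open_minus_B: "open U \<Longrightarrow> open (U - B)"
  using finite_B by (simp add: finite_imp_closed open_Diff)

text \<open>
  The product of the distances from \<open>w0\<close> to the roots over \<open>x\<close> is
  \<open>\<bar>Q(x, w0)\<bar>\<close> divided by the absolute value of the leading coefficient. It
  tends to zero, so some factor becomes small.
\<close>

lemma nearby_root_exists:
  assumes "x0 \<notin> B" "w0 \<in> roots x0" "\<delta> > 0"
  shows "\<forall>\<^sub>F x in nhds x0. \<exists>w\<in>roots x. dist w w0 < \<delta>"
proof -
  have good: "\<forall>\<^sub>F x in nhds x0. x \<notin> B"
    using open_minus_B[OF open_UNIV] assms(1) by (auto simp: eventually_nhds)
  have "isCont (\<lambda>x. bipoly Q x w0 / poly (lead_coeff Q) x) x0"
    using lead_nonzero[OF assms(1)] by (intro continuous_intros) auto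
  hence "((\<lambda>x. bipoly Q x w0 / poly (lead_coeff Q) x) \<longlongrightarrow> 0) (nhds x0)"
    using assms(2) by (auto dest!: isCont_imp_tendsto_nhds simp: roots_def)
  hence "\<forall>\<^sub>F x in nhds x0. dist (bipoly Q x w0 / poly (lead_coeff Q) x) 0 < \<delta> ^ degree Q"
    using assms(3) by (intro tendstoD) auto
  with good show ?thesis
  proof eventually_elim
    case (elim x)
    have fac: "bipoly Q x w0 / poly (lead_coeff Q) x = (\<Prod>v\<in>roots x. w0 - v)"
      using bipoly_factorization[OF elim(1), of w0] lead_nonzero[OF elim(1)] by simp
    show ?case
    proof (rule ccontr)
      assume "\<not> ?thesis"
      hence "\<delta> \<le> norm (w0 - v)" if "v \<in> roots x" for v
        using that by (auto simp: dist_norm norm_minus_commute not_less)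
      hence "(\<Prod>v\<in>roots x. \<delta>) \<le> (\<Prod>v\<in>roots x. norm (w0 - v))"
        using assms(3) by (intro prod_mono) auto
      thus False using elim(2) by (simp add: fac card_roots[OF elim(1)] prod_norm[symmetric])
    qed
  qed
qed

text \<open>
  The divided difference of two roots over the same point is zero, but it does not vanish near a
  simple root.
\<close>

lemma nearby_root_unique:
  assumes "x0 \<notin> B" "w0 \<in> roots x0"
  shows "\<exists>\<delta>>0. \<forall>x w w'. dist x x0 < \<delta> \<and> dist w w0 < \<delta> \<and> dist w' w0 < \<delta> \<and>
           w \<in> roots x \<and> w' \<in> roots x \<longrightarrow> w = w'"
proof -
  let ?f = "\<lambda>t. bipoly_quotient Q (fst t) (fst (snd t)) (snd (snd t))"
  have "isCont ?f (x0, w0, w0)"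
    by (intro continuous_bipoly_quotient continuous_intros)
  moreover have "?f (x0, w0, w0) \<noteq> 0"
    using simple_roots[OF assms(1)] assms(2) by (simp add: bipoly_quotient_diagonal roots_def)
  ultimately obtain e where e: "e > 0" "\<And>t. dist t (x0, w0, w0) < e \<Longrightarrow> ?f t \<noteq> 0"
    using continuous_at_avoid[of "(x0, w0, w0)" ?f 0] by (auto simp: dist_commute)
  show ?thesis
  proof (intro exI[of _ "e / 3"] conjI allI impI; (elim conjE)?)
    show "e / 3 > 0" using e by simp
    fix x w w' assume *: "dist x x0 < e / 3" "dist w w0 < e / 3" "dist w' w0 < e / 3"
      "w \<in> roots x" "w' \<in> roots x"
    have "dist (x, w, w') (x0, w0, w0) \<le> dist x x0 + dist (w, w') (w0, w0)"
      unfolding dist_Pair_Pair[of x "(w, w')"] by (rule sqrt_sum_squares_le_sum) auto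
    also have "dist (w, w') (w0, w0) \<le> dist w w0 + dist w' w0"
      unfolding dist_Pair_Pair by (rule sqrt_sum_squares_le_sum) auto
    finally have "bipoly_quotient Q x w w' \<noteq> 0"
      using e(2)[of "(x, w, w')"] * by simp
    thus "w = w'" using bipoly_diff[of Q x w w'] *(4,5) by (simp add: roots_def)
  qed
qed

text \<open>
  The implicit function theorem: with \<open>w1 = g x1\<close>, the difference quotient of
  \<open>g\<close> is that of \<open>Q(x, w1)\<close> in \<open>x\<close>, up to sign, over the
  divided difference at \<open>(x, g x, w1)\<close>.
\<close>

lemma continuous_root_differentiable:
  assumes "x1 \<notin> B" "isCont g x1" "\<forall>\<^sub>F x in nhds x1. g x \<in> roots x"
  shows "g field_differentiable (at x1)"
proof -
  define w1 where "w1 = g x1"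
  have w1: "bipoly Q x1 w1 = 0"
    using assms(3) unfolding w1_def roots_def eventually_nhds by auto
  have dQ: "(\<lambda>x. bipoly Q x w1) field_differentiable (at x1)"
    unfolding bipoly_altdef by (intro derivative_intros) (auto simp: field_differentiable_def intro: poly_DERIV)
  then obtain D where D: "((\<lambda>x. (bipoly Q x w1 - bipoly Q x1 w1) / (x - x1)) \<longlongrightarrow> D) (at x1)"
    by (auto simp: field_differentiable_def has_field_derivative_iff)
  have cont: "isCont (\<lambda>x. bipoly_quotient Q x (g x) w1) x1"
    by (intro continuous_bipoly_quotient continuous_intros assms)
  have nz: "bipoly_quotient Q x1 (g x1) w1 \<noteq> 0"
    using w1 simple_roots[OF assms(1)] by (simp add: w1_def bipoly_quotient_diagonal)
  have "((\<lambda>x. - ((bipoly Q x w1 - bipoly Q x1 w1) / (x - x1)) / bipoly_quotient Q x (g x) w1)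
          \<longlongrightarrow> - D / bipoly_quotient Q x1 (g x1) w1) (at x1)"
    using D cont nz by (intro tendsto_intros) (auto simp: isCont_def)
  moreover have "\<forall>\<^sub>F x in at x1.
      - ((bipoly Q x w1 - bipoly Q x1 w1) / (x - x1)) / bipoly_quotient Q x (g x) w1 = (g x - g x1) / (x - x1)"
  proof -
    have "\<forall>\<^sub>F x in nhds x1. bipoly_quotient Q x (g x) w1 \<noteq> 0"
    proof -
      have "((\<lambda>x. bipoly_quotient Q x (g x) w1) \<longlongrightarrow> bipoly_quotient Q x1 (g x1) w1) (nhds x1)"
        using isCont_imp_tendsto_nhds[OF cont] .
      thus ?thesis using nz by (rule tendsto_imp_eventually_ne)
    qed
    hence "\<forall>\<^sub>F x in at x1. bipoly_quotient Q x (g x) w1 \<noteq> 0"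
      by (simp add: eventually_nhds_conv_at)
    moreover have "\<forall>\<^sub>F x in at x1. g x \<in> roots x" using assms(3) by (simp add: eventually_nhds_conv_at)
    moreover have "\<forall>\<^sub>F x in at x1. x \<noteq> x1" by (simp add: eventually_at_filter)
    ultimately show ?thesis
    proof eventually_elim
      case (elim x)
      have "bipoly Q x (g x) = 0" using elim by (simp add: roots_def)
      hence "bipoly Q x w1 = - (g x - w1) * bipoly_quotient Q x (g x) w1"
        using bipoly_diff[of Q x "g x" w1] by (simp add: algebra_simps)
      thus ?case using elim w1 by (simp add: w1_def[symmetric]) (metis minus_diff_eq minus_divide_left)
    qed
  qed
  ultimately have "((\<lambda>x. (g x - g x1) / (x - x1)) \<longlongrightarrow> - D / bipoly_quotient Q x1 (g x1) w1) (at x1)"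
    by (rule Lim_transform_eventually)
  thus ?thesis by (auto simp: field_differentiable_def has_field_derivative_iff)
qed

text \<open>
  Around the roots over \<open>x0\<close> there are disjoint discs, each of which contains exactly
  one root over every nearby point. These are all roots, since the number of roots is constant.
\<close>

lemma local_sections:
  assumes "x0 \<notin> B"
  obtains \<epsilon> G where "\<epsilon> > 0" "finite G" "ball x0 \<epsilon> \<inter> B = {}"
    "\<And>g. g \<in> G \<Longrightarrow> g holomorphic_on ball x0 \<epsilon>"
    "\<And>x. x \<in> ball x0 \<epsilon> \<Longrightarrow> roots x = (\<lambda>g. g x) ` G"
proof -
  have "\<forall>w\<in>roots x0. \<exists>\<delta>>0. \<forall>x v v'. dist x x0 < \<delta> \<and> dist v w < \<delta> \<and> dist v' w < \<delta> \<and>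
       v \<in> roots x \<and> v' \<in> roots x \<longrightarrow> v = v'"
    using nearby_root_unique[OF assms] by blast
  from bchoice[OF this] obtain d where d0: "\<forall>w\<in>roots x0. d w > 0 \<and> (\<forall>x v v'. dist x x0 < d w \<and>
       dist v w < d w \<and> dist v' w < d w \<and> v \<in> roots x \<and> v' \<in> roots x \<longrightarrow> v = v')" ..
  have d: "d w > 0" if "w \<in> roots x0" for w using d0 that by simp
  have unique: "v = v'" if "w \<in> roots x0" "dist x x0 < d w" "dist v w < d w" "dist v' w < d w"
       "v \<in> roots x" "v' \<in> roots x" for w x v v'
    using bspec[OF d0 that(1)] that by simp
  have fin: "finite (roots x0)" using finite_roots[OF assms] .
  obtain s where s: "s > 0" "\<And>w w'. w \<in> roots x0 \<Longrightarrow> w' \<in> roots x0 \<Longrightarrow> w \<noteq> w' \<Longrightarrow> s \<le> dist w w'"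
  proof -
    have "\<exists>s>0. \<forall>w\<in>roots x0. \<forall>w'\<in>roots x0. w \<noteq> w' \<longrightarrow> s \<le> dist w w'"
    proof -
      let ?S = "insert 1 ((\<lambda>(w, w'). dist w w') ` {(w, w') \<in> roots x0 \<times> roots x0. w \<noteq> w'})"
      have "finite ?S"
        using fin by (auto intro!: finite_imageI intro: finite_subset[of _ "roots x0 \<times> roots x0"])
      hence pos: "Min ?S > 0" by (subst Min_gr_iff) auto
      have le: "Min ?S \<le> y" if "y \<in> ?S" for y
        using \<open>finite ?S\<close> that by (rule Min_le)
      have "Min ?S \<le> dist w w'" if "w \<in> roots x0" "w' \<in> roots x0" "w \<noteq> w'" for w w'
        using that by (intro le) auto
      thus ?thesis using pos by blast
    qed
    thus thesis using that by blast
  qed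
  \<comment> \<open>discs of radius \<open>\<delta>\<close> around the roots are disjoint, and in each of them the root is unique\<close>
  define \<delta> where "\<delta> = Min (insert (s / 2) (d ` roots x0))"
  have \<delta>: "\<delta> > 0" "\<delta> \<le> s / 2" "\<And>w. w \<in> roots x0 \<Longrightarrow> \<delta> \<le> d w"
  proof -
    show "\<delta> > 0" unfolding \<delta>_def using fin s d by auto
    show "\<delta> \<le> s / 2" unfolding \<delta>_def using fin by (intro Min_le) auto
    show "\<delta> \<le> d w" if "w \<in> roots x0" for w unfolding \<delta>_def using fin that by (intro Min_le) auto
  qed
  have "\<forall>\<^sub>F x in nhds x0. \<forall>w\<in>roots x0. \<exists>v\<in>roots x. dist v w < \<delta>"
    using fin nearby_root_exists[OF assms _ \<delta>(1)] by (intro eventually_ball_finite) auto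
  moreover have "\<forall>\<^sub>F x in nhds x0. x \<in> - B"
    using open_minus_B[OF open_UNIV] assms
    by (intro eventually_nhds_in_open) (auto simp: Compl_eq_Diff_UNIV)
  moreover have "\<forall>\<^sub>F x in nhds x0. dist x x0 < \<delta>"
    using \<delta>(1) by (auto simp: eventually_nhds_metric)
  ultimately have "\<forall>\<^sub>F x in nhds x0. (\<forall>w\<in>roots x0. \<exists>v\<in>roots x. dist v w < \<delta>) \<and> x \<notin> B \<and> dist x x0 < \<delta>"
    by eventually_elim auto
  then obtain \<epsilon> where \<epsilon>: "\<epsilon> > 0"
    "\<And>x. dist x x0 < \<epsilon> \<Longrightarrow> (\<forall>w\<in>roots x0. \<exists>v\<in>roots x. dist v w < \<delta>) \<and> x \<notin> B \<and> dist x x0 < \<delta>"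
    unfolding eventually_nhds_metric by blast
  define g where "g w x = (THE v. v \<in> roots x \<and> dist v w < \<delta>)" for w x
  have g_eq: "g w x = v" if "w \<in> roots x0" "dist x x0 < \<epsilon>" "v \<in> roots x" "dist v w < \<delta>" for w x v
    unfolding g_def
  proof (rule the_equality)
    fix v' assume "v' \<in> roots x \<and> dist v' w < \<delta>"
    thus "v' = v"
      using that \<delta>(3)[OF that(1)] \<epsilon>(2)[OF that(2)] by (intro unique[OF that(1), of x]) auto
  qed (use that in simp)
  have g: "g w x \<in> roots x \<and> dist (g w x) w < \<delta>" if "w \<in> roots x0" "dist x x0 < \<epsilon>" for w x
    using g_eq[OF that] \<epsilon>(2)[OF that(2)] that(1) by metis
  show thesis
  proof (rule that[of \<epsilon> "g ` roots x0"])
    show "\<epsilon> > 0" "finite (g ` roots x0)" using \<epsilon> fin by auto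
    show "ball x0 \<epsilon> \<inter> B = {}" using \<epsilon>(2) by (auto simp: dist_commute)
  next
    fix x assume x: "x \<in> ball x0 \<epsilon>"
    hence x': "dist x x0 < \<epsilon>" "x \<notin> B" using \<epsilon>(2) by (auto simp: dist_commute)
    have "inj_on (\<lambda>w. g w x) (roots x0)"
    proof (rule inj_onI, rule ccontr)
      fix w w' assume ww: "w \<in> roots x0" "w' \<in> roots x0" "g w x = g w' x" "w \<noteq> w'"
      have "dist w w' \<le> dist (g w x) w + dist (g w x) w'" by (rule dist_triangle3)
      also have "\<dots> < \<delta> + \<delta>" using g[OF ww(1) x'(1)] g[OF ww(2) x'(1)] ww(3) by simp
      finally show False using s(2)[OF ww(1,2,4)] \<delta>(2) by simp
    qed
    \<comment> \<open>the roots that have been followed are as many as there are roots\<close>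
    hence "card ((\<lambda>w. g w x) ` roots x0) = card (roots x)"
      by (simp add: card_image card_roots assms x')
    moreover have "(\<lambda>w. g w x) ` roots x0 \<subseteq> roots x" using g x'(1) by blast
    ultimately have "(\<lambda>w. g w x) ` roots x0 = roots x"
      using finite_roots[OF x'(2)] by (intro card_subset_eq) auto
    thus "roots x = (\<lambda>g. g x) ` (g ` roots x0)" by (simp add: image_image)
  next
    fix h assume "h \<in> g ` roots x0"
    then obtain w where w: "w \<in> roots x0" "h = g w" by auto
    have "h field_differentiable (at x1)" if "x1 \<in> ball x0 \<epsilon>" for x1
    proof (rule continuous_root_differentiable)
      have x1: "dist x1 x0 < \<epsilon>" using that by (simp add: dist_commute)
      show "x1 \<notin> B" using \<epsilon>(2)[OF x1] by simp
      have ev: "\<forall>\<^sub>F x in nhds x1. dist x x0 < \<epsilon>"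
        using eventually_nhds_in_open[OF open_ball that] by eventually_elim (simp add: dist_commute)
      thus "\<forall>\<^sub>F x in nhds x1. h x \<in> roots x"
        by eventually_elim (use g w in auto)
      have "(h \<longlongrightarrow> h x1) (nhds x1)"
      proof (rule tendstoI)
        fix \<eta> :: real assume "\<eta> > 0"
        define \<eta>' where "\<eta>' = min \<eta> (\<delta> - dist (h x1) w)"
        have "\<eta>' > 0" using \<open>\<eta> > 0\<close> g[OF w(1) x1] w(2) by (simp add: \<eta>'_def)
        have "h x1 \<in> roots x1" using g[OF w(1) x1] w(2) by simp
        from nearby_root_exists[OF \<open>x1 \<notin> B\<close> this \<open>\<eta>' > 0\<close>] ev
        show "\<forall>\<^sub>F x in nhds x1. dist (h x) (h x1) < \<eta>"
        proof eventually_elim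
          case (elim x)
          then obtain v where v: "v \<in> roots x" "dist v (h x1) < \<eta>'" by auto
          have "dist v w \<le> dist v (h x1) + dist (h x1) w" by (rule dist_triangle)
          also have "\<dots> < \<delta>" using v by (simp add: \<eta>'_def)
          finally have "h x = v" using g_eq[OF w(1) elim(2) v(1)] w(2) by simp
          thus ?case using v by (simp add: \<eta>'_def)
        qed
      qed
      thus "isCont h x1" by (simp add: isCont_def tendsto_at_iff_tendsto_nhds)
    qed
    thus "h holomorphic_on ball x0 \<epsilon>"
      by (simp add: holomorphic_on_def field_differentiable_at_within)
  qed
qed

text \<open>
  The set on which two lifts coincide is closed, and open because nearby roots are unique.
\<close>

lemma unique_lift:
  fixes \<gamma> u v :: "'x::topological_space \<Rightarrow> complex"
  assumes "connected X" "continuous_on X \<gamma>" "\<And>t. t \<in> X \<Longrightarrow> \<gamma> t \<notin> B"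
    and "continuous_on X u" "continuous_on X v"
    and "\<And>t. t \<in> X \<Longrightarrow> u t \<in> roots (\<gamma> t)" "\<And>t. t \<in> X \<Longrightarrow> v t \<in> roots (\<gamma> t)"
    and "t0 \<in> X" "u t0 = v t0" "t \<in> X"
  shows "u t = v t"
proof -
  define E where "E = {t \<in> X. u t - v t = 0}"
  have "closedin (top_of_set X) E"
    unfolding E_def by (intro continuous_closedin_preimage_constant continuous_intros assms)
  moreover have "openin (top_of_set X) E"
  proof (subst openin_subopen, intro ballI)
    fix t1 assume t1: "t1 \<in> E"
    hence "t1 \<in> X" "u t1 = v t1" by (auto simp: E_def)
    obtain \<delta> where \<delta>: "\<delta> > 0"
      "\<forall>x w w'. dist x (\<gamma> t1) < \<delta> \<and> dist w (u t1) < \<delta> \<and> dist w' (u t1) < \<delta> \<and>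
         w \<in> roots x \<and> w' \<in> roots x \<longrightarrow> w = w'"
      using nearby_root_unique[OF assms(3)[OF \<open>t1 \<in> X\<close>] assms(6)[OF \<open>t1 \<in> X\<close>]] by blast
    define N where "N = (X \<inter> \<gamma> -` ball (\<gamma> t1) \<delta>) \<inter> (X \<inter> u -` ball (u t1) \<delta>) \<inter> (X \<inter> v -` ball (u t1) \<delta>)"
    have "openin (top_of_set X) N"
      unfolding N_def by (intro openin_Int continuous_openin_preimage_gen assms open_ball)
    moreover have "t1 \<in> N" using \<open>t1 \<in> X\<close> \<open>u t1 = v t1\<close> \<delta>(1) by (simp add: N_def)
    moreover have "N \<subseteq> E"
    proof
      fix t assume "t \<in> N"
      hence t: "t \<in> X" "dist (\<gamma> t) (\<gamma> t1) < \<delta>" "dist (u t) (u t1) < \<delta>" "dist (v t) (u t1) < \<delta>"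
        by (auto simp: N_def dist_commute)
      hence "u t = v t" using \<delta>(2) assms(6,7)[OF t(1)] by blast
      thus "t \<in> E" using t by (simp add: E_def)
    qed
    ultimately show "\<exists>T. openin (top_of_set X) T \<and> t1 \<in> T \<and> T \<subseteq> E" by blast
  qed
  moreover have "t0 \<in> E" using assms by (simp add: E_def)
  ultimately have "E = X" using \<open>connected X\<close> unfolding connected_clopen by blast
  thus ?thesis using assms(10) by (auto simp: E_def)
qed

end

section \<open>Continuation of branches over convex regions\<close>

text \<open>
  One of the finitely many functions agrees with \<open>h\<close> at infinitely many points of a
  compact disc, hence everywhere.
\<close>

lemma holomorphic_selection:
  assumes "open S" "connected S" "S \<noteq> {}" "finite H" "h holomorphic_on S"
    and "\<And>g. g \<in> H \<Longrightarrow> g holomorphic_on S" "\<And>z. z \<in> S \<Longrightarrow> h z \<in> (\<lambda>g. g z) ` H"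
  shows "\<exists>g\<in>H. \<forall>z\<in>S. h z = g z"
proof -
  obtain z0 where "z0 \<in> S" using assms(3) by auto
  then obtain e where e: "e > 0" "cball z0 e \<subseteq> S"
    using assms(1) open_contains_cball by blast
  have cover: "cball z0 e = (\<Union>g\<in>H. {z \<in> cball z0 e. h z = g z})"
  proof
    show "cball z0 e \<subseteq> (\<Union>g\<in>H. {z \<in> cball z0 e. h z = g z})"
    proof
      fix z assume z: "z \<in> cball z0 e"
      hence "h z \<in> (\<lambda>g. g z) ` H" using assms(7) e(2) by blast
      thus "z \<in> (\<Union>g\<in>H. {z \<in> cball z0 e. h z = g z})" using z by auto
    qed
  qed auto
  have inf: "infinite (cball z0 e)"
  proof
    assume "finite (cball z0 e)"
    hence "finite (ball z0 e)" using ball_subset_cball finite_subset by blast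
    thus False using uncountable_ball[OF e(1), of z0] countable_finite by blast
  qed
  have "\<exists>g\<in>H. infinite {z \<in> cball z0 e. h z = g z}"
  proof (rule ccontr)
    assume "\<not> ?thesis"
    hence "finite (\<Union>g\<in>H. {z \<in> cball z0 e. h z = g z})" using assms(4) by (intro finite_UN_I) auto
    thus False using inf cover by simp
  qed
  then obtain g where g: "g \<in> H" "infinite {z \<in> cball z0 e. h z = g z}" by blast
  have "\<exists>\<xi>\<in>cball z0 e. \<xi> islimpt {z \<in> cball z0 e. h z = g z}"
    using compact_cball[of z0 e] g(2) unfolding compact_eq_Bolzano_Weierstrass by blast
  then obtain \<xi> where \<xi>: "\<xi> \<in> cball z0 e" "\<xi> islimpt {z \<in> cball z0 e. h z = g z}" by blast
  have "h z - g z = 0" if "z \<in> S" for z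
  proof (rule analytic_continuation[OF _ assms(1,2) _ _ \<xi>(2) _ that])
    show "(\<lambda>z. h z - g z) holomorphic_on S"
      using assms(5,6) g(1) by (intro holomorphic_intros) auto
    show "\<xi> \<in> S" using \<xi>(1) e(2) by blast
  qed (use e(2) in auto)
  with g(1) show ?thesis by auto
qed

text \<open>
  A tube around the segment is the Minkowski sum of two convex sets.
\<close>

lemma convex_neighbourhood_of_segment:
  fixes a b :: "'a::euclidean_space"
  assumes "open U" "closed_segment a b \<subseteq> U"
  shows "\<exists>N. open N \<and> convex N \<and> closed_segment a b \<subseteq> N \<and> N \<subseteq> U"
proof -
  obtain \<delta> where \<delta>: "\<delta> > 0" "(\<Union>x\<in>closed_segment a b. ball x \<delta>) \<subseteq> U"
    using compact_subset_open_imp_ball_epsilon_subset[OF compact_segment assms(1,2)] by blast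
  have ball: "ball x \<delta> = (\<Union>y\<in>ball 0 \<delta>. {x + y})" for x :: 'a
  proof -
    have "(+) x ` ball 0 \<delta> = ball x \<delta>" using image_add_ball[of x 0 \<delta>] by simp
    thus ?thesis by (simp only: UNION_singleton_eq_range)
  qed
  have eq: "(\<Union>x\<in>closed_segment a b. ball x \<delta>) = (\<Union>x\<in>closed_segment a b. \<Union>y\<in>ball 0 \<delta>. {x + y})"
    by (intro SUP_cong refl ball)
  show ?thesis
  proof (intro exI conjI)
    show "convex (\<Union>x\<in>closed_segment a b. ball x \<delta>)"
      unfolding eq by (intro convex_sums convex_closed_segment convex_ball)
    show "closed_segment a b \<subseteq> (\<Union>x\<in>closed_segment a b. ball x \<delta>)" using \<delta>(1) by auto
    show "open (\<Union>x\<in>closed_segment a b. ball x \<delta>)" by blast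
  qed (fact \<delta>(2))
qed

text \<open>
  A multivalued function is encoded as the family \<open>R\<close> of its sets of values, and
  \<open>H\<close> is a set of single-valued branches. These may meet at some points, so that the
  notion is stable under pulling back along a map with branch points.
\<close>

definition splits_over :: "(complex \<Rightarrow> complex set) \<Rightarrow> complex set \<Rightarrow> (complex \<Rightarrow> complex) set \<Rightarrow> bool" where
  "splits_over R S H \<longleftrightarrow>
     finite H \<and> (\<forall>h\<in>H. h holomorphic_on S) \<and> (\<forall>z\<in>S. R z = (\<lambda>h. h z) ` H)"

definition section_over :: "(complex \<Rightarrow> complex set) \<Rightarrow> complex set \<Rightarrow> (complex \<Rightarrow> complex) \<Rightarrow> bool" where
  "section_over R S h \<longleftrightarrow> h holomorphic_on S \<and> (\<forall>z\<in>S. h z \<in> R z)"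

lemma section_of_splitting:
  assumes "splits_over R S H" "open S" "connected S" "S \<noteq> {}" "section_over R S h"
  shows "\<exists>g\<in>H. \<forall>z\<in>S. h z = g z"
proof (rule holomorphic_selection[OF assms(2-4)])
  show "finite H" "h holomorphic_on S" "\<And>g. g \<in> H \<Longrightarrow> g holomorphic_on S"
    "\<And>z. z \<in> S \<Longrightarrow> h z \<in> (\<lambda>g. g z) ` H"
    using assms(1,5) by (auto simp: splits_over_def section_over_def)
qed

lemma splits_over_subset: "splits_over R S H \<Longrightarrow> T \<subseteq> S \<Longrightarrow> splits_over R T H"
  unfolding splits_over_def by (auto intro: holomorphic_on_subset)

lemma section_over_subset: "section_over R S h \<Longrightarrow> T \<subseteq> S \<Longrightarrow> section_over R T h"
  unfolding section_over_def by (auto intro: holomorphic_on_subset)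

lemma splits_over_section: "splits_over R S H \<Longrightarrow> h \<in> H \<Longrightarrow> section_over R S h"
  unfolding section_over_def splits_over_def by auto

text \<open>
  Near a point of \<open>B\<close> the branches may be singular, but they are single-valued on a
  whole punctured disc: there is no local monodromy, and continuation can ignore the points of
  \<open>B\<close>.
\<close>

locale locally_split =
  fixes R :: "complex \<Rightarrow> complex set" and S B :: "complex set"
  assumes open_S: "open S" and convex_S: "convex S" and finite_bad: "finite B"
    and locally: "\<And>z. z \<in> S \<Longrightarrow> \<exists>\<epsilon>>0. \<exists>G. ball z \<epsilon> \<subseteq> S \<and> splits_over R (ball z \<epsilon> - B) G"
begin

lemma punctured:
  assumes "open N" "convex N"
  shows "open (N - B)" "connected (N - B)" "N \<noteq> {} \<Longrightarrow> N - B \<noteq> {}"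
proof -
  show "open (N - B)" using assms finite_bad by (simp add: finite_imp_closed open_Diff)
  show "connected (N - B)"
    using connected_open_delete_finite[OF assms(1) convex_connected[OF assms(2)] _ finite_bad] by simp
  show "N - B \<noteq> {}" if "N \<noteq> {}"
  proof
    assume "N - B = {}"
    hence "N \<subseteq> B" by simp
    hence "finite N" using finite_bad by (rule finite_subset)
    from finite_imp_not_open[OF this assms(1)] that show False by simp
  qed
qed

lemma sections_agree:
  assumes "open N" "convex N" "section_over R (N - B) h" "section_over R (N - B) h'"
    and "open M" "convex M" "M \<noteq> {}" "M \<subseteq> N" "\<And>z. z \<in> M - B \<Longrightarrow> h z = h' z"
    and "z \<in> N - B"
  shows "h z = h' z"
proof (rule analytic_continuation_open[of "M - B" "N - B" h h'])
  show "open (M - B)" using assms(5,6) by (rule punctured)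
  show "M - B \<noteq> {}" using assms(5-7) by (rule punctured)
  show "open (N - B)" "connected (N - B)" using assms(1,2) by (rule punctured)+
  show "M - B \<subseteq> N - B" using assms(8) by blast
  show "h holomorphic_on N - B" "h' holomorphic_on N - B"
    using assms(3,4) by (simp_all add: section_over_def)
qed (use assms(9,10) in auto)

text \<open>
  The intersection of a disc with the convex set \<open>N\<close> is connected after deletion of
  finitely many points, so the given section agrees there with a single branch over the disc.
\<close>

lemma extend_across_ball:
  assumes N: "open N" "convex N" "section_over R (N - B) h"
    and ball: "splits_over R (ball c \<epsilon> - B) G" "a \<in> N" "a \<in> ball c \<epsilon>"
  shows "\<exists>h'. section_over R ((N \<union> ball c \<epsilon>) - B) h' \<and> (\<forall>z\<in>N. h' z = h z)"
proof -
  have conv: "convex (N \<inter> ball c \<epsilon>)" "open (N \<inter> ball c \<epsilon>)" "N \<inter> ball c \<epsilon> \<noteq> {}"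
    using convex_Int[OF N(2) convex_ball] open_Int[OF N(1) open_ball] ball(2,3) by blast+
  have "splits_over R (N \<inter> ball c \<epsilon> - B) G" by (rule splits_over_subset[OF ball(1)]) auto
  moreover have "section_over R (N \<inter> ball c \<epsilon> - B) h" by (rule section_over_subset[OF N(3)]) auto
  ultimately obtain g where g: "g \<in> G" "\<forall>z\<in>N \<inter> ball c \<epsilon> - B. h z = g z"
    using section_of_splitting[OF _ punctured[OF conv(2,1)]] conv(3) by blast
  have sg: "section_over R (ball c \<epsilon> - B) g" using splits_over_section[OF ball(1) g(1)] .
  define h' where "h' z = (if z \<in> N then h z else g z)" for z
  have h'g: "h' z = g z" if "z \<in> ball c \<epsilon> - B" for z using g(2) that by (auto simp: h'_def)
  have "h' holomorphic_on (N - B) \<union> (ball c \<epsilon> - B)"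
  proof (rule holomorphic_on_Un)
    show "h' holomorphic_on N - B"
    proof (rule holomorphic_transform)
      show "h holomorphic_on N - B" using N(3) by (simp add: section_over_def)
    qed (simp add: h'_def)
    show "h' holomorphic_on ball c \<epsilon> - B"
    proof (rule holomorphic_transform)
      show "g holomorphic_on ball c \<epsilon> - B" using sg by (simp add: section_over_def)
    qed (simp add: h'g)
    show "open (N - B)" using N(1,2) by (rule punctured)
    show "open (ball c \<epsilon> - B)" by (rule punctured[OF open_ball convex_ball])
  qed
  moreover have "h' z \<in> R z" if "z \<in> (N \<union> ball c \<epsilon>) - B" for z
  proof (cases "z \<in> N")
    case True
    thus ?thesis using that N(3) by (simp add: h'_def section_over_def)
  next
    case False
    thus ?thesis using that sg by (simp add: h'_def section_over_def)
  qed
  ultimately have "section_over R ((N \<union> ball c \<epsilon>) - B) h'"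
    by (simp add: section_over_def Un_Diff)
  thus ?thesis by (intro exI[of _ h']) (simp add: h'_def)
qed

text \<open>
  Analytic continuation along a segment. It is recorded by a convex neighbourhood of the segment
  rather than by a chain of discs, because intersections of convex sets are connected, and
  continuations to them are unique.
\<close>

definition extends_along :: "complex \<Rightarrow> complex set \<Rightarrow> (complex \<Rightarrow> complex) \<Rightarrow> complex \<Rightarrow> complex set \<Rightarrow> (complex \<Rightarrow> complex) \<Rightarrow> bool" where
  "extends_along z0 N0 h0 z N h \<longleftrightarrow> open N \<and> convex N \<and> closed_segment z0 z \<subseteq> N \<and> N \<subseteq> S \<and>
     section_over R (N - B) h \<and> (\<forall>x\<in>N \<inter> N0 - B. h x = h0 x)"

text \<open>
  The union of \<open>N\<close> and the disc need not be convex, so the continuation is restricted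
  to a tube around the new segment.
\<close>

lemma extend_step:
  assumes N0: "open N0" "convex N0" "z0 \<in> N0" "section_over R (N0 - B) h0"
    and N: "extends_along z0 N0 h0 a N h"
    and c: "ball c \<epsilon> \<subseteq> S" "splits_over R (ball c \<epsilon> - B) G" "a \<in> ball c \<epsilon>" "b \<in> ball c \<epsilon>"
    and seg: "closed_segment z0 b \<subseteq> closed_segment z0 a \<union> closed_segment a b"
  shows "\<exists>N h. extends_along z0 N0 h0 b N h"
proof -
  have N: "open N" "convex N" "closed_segment z0 a \<subseteq> N" "N \<subseteq> S"
    "section_over R (N - B) h" "\<And>x. x \<in> N \<inter> N0 - B \<Longrightarrow> h x = h0 x"
    using N unfolding extends_along_def by auto
  have "a \<in> N" using N(3) by auto
  obtain h' where h': "section_over R ((N \<union> ball c \<epsilon>) - B) h'" "\<forall>z\<in>N. h' z = h z"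
    using extend_across_ball[OF N(1,2,5) c(2) \<open>a \<in> N\<close> c(3)] by blast
  have "closed_segment a b \<subseteq> ball c \<epsilon>" by (rule closed_segment_subset[OF c(3,4) convex_ball])
  hence "closed_segment z0 b \<subseteq> N \<union> ball c \<epsilon>" using subset_trans[OF seg Un_mono[OF N(3)]] by simp
  from convex_neighbourhood_of_segment[OF open_Un[OF N(1) open_ball] this]
  obtain N' where N': "open N'" "convex N'" "closed_segment z0 b \<subseteq> N'" "N' \<subseteq> N \<union> ball c \<epsilon>"
    by (elim exE conjE)
  have sec: "section_over R (N' - B) h'" by (rule section_over_subset[OF h'(1)]) (use N'(4) in blast)
  have agree: "h' x = h0 x" if x: "x \<in> N' \<inter> N0 - B" for x
  proof (rule sections_agree[of "N' \<inter> N0" h' h0 "N' \<inter> N \<inter> N0" x])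
    show "section_over R (N' \<inter> N0 - B) h'" by (rule section_over_subset[OF sec]) auto
    show "section_over R (N' \<inter> N0 - B) h0" by (rule section_over_subset[OF N0(4)]) auto
    show "open (N' \<inter> N0)" "convex (N' \<inter> N0)"
      by (intro open_Int convex_Int N'(1,2) N0(1,2))+
    show "open (N' \<inter> N \<inter> N0)" "convex (N' \<inter> N \<inter> N0)"
      by (intro open_Int convex_Int N(1,2) N'(1,2) N0(1,2))+
    have "z0 \<in> N' \<inter> N \<inter> N0" using N0(3) N(3) N'(3) by auto
    thus "N' \<inter> N \<inter> N0 \<noteq> {}" by blast
    show "h' z = h0 z" if "z \<in> N' \<inter> N \<inter> N0 - B" for z using that h'(2) N(6) by auto
    show "N' \<inter> N \<inter> N0 \<subseteq> N' \<inter> N0" by blast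
  qed (fact x)
  moreover have "N' \<subseteq> S" using N'(4) N(4) c(1) by blast
  ultimately have "extends_along z0 N0 h0 b N' h'"
    unfolding extends_along_def using N'(1-3) sec agree by simp
  thus ?thesis by blast
qed

text \<open>
  The set of parameters up to which continuation is possible is open and closed in the unit
  interval, because inside a disc over which the fibers split continuation can be moved from any
  point to any other.
\<close>

lemma extend_along_segment:
  assumes N0: "open N0" "convex N0" "z0 \<in> N0" "section_over R (N0 - B) h0" "N0 \<subseteq> S" and "z \<in> S"
  shows "\<exists>N h. extends_along z0 N0 h0 z N h"
proof -
  define p where "p t = z0 + of_real t * (z - z0)" for t :: real
  define good where "good t \<longleftrightarrow> (\<exists>N h. extends_along z0 N0 h0 (p t) N h)" for t
  have "z0 \<in> S" using assms by auto
  have p0: "p 0 = z0" and p1: "p 1 = z" by (simp_all add: p_def)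
  have affine: "p v \<in> closed_segment (p v1) (p v2)" if v: "v \<in> closed_segment v1 v2" for v v1 v2
  proof -
    obtain k where k: "0 \<le> k" "k \<le> 1" "v = (1 - k) * v1 + k * v2"
      using v by (auto simp: closed_segment_def)
    have "p v = (1 - k) *\<^sub>R p v1 + k *\<^sub>R p v2"
      unfolding k(3) p_def by (simp add: scaleR_conv_of_real algebra_simps)
    thus ?thesis using k(1,2) unfolding closed_segment_def by blast
  qed
  have p_in: "p t \<in> S" if "t \<in> {0..1}" for t
  proof -
    have "p t \<in> closed_segment z0 z"
      using affine[of t 0 1] that unfolding p0 p1 by (simp add: closed_segment_eq_real_ivl)
    thus ?thesis using closed_segment_subset[OF \<open>z0 \<in> S\<close> \<open>z \<in> S\<close> convex_S] by auto
  qed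
  have cont: "continuous_on {0..1} p" unfolding p_def by (intro continuous_intros)
  have seg: "closed_segment z0 (p t) \<subseteq> closed_segment z0 (p s) \<union> closed_segment (p s) (p t)"
    if "s \<in> {0..1}" "t \<in> {0..1}" for s t
  proof
    fix x assume "x \<in> closed_segment z0 (p t)"
    then obtain u where u: "0 \<le> u" "u \<le> 1" "x = (1 - u) *\<^sub>R z0 + u *\<^sub>R p t"
      by (auto simp: closed_segment_def)
    have x: "x = p (u * t)"
      unfolding u(3) p_def by (simp add: scaleR_conv_of_real algebra_simps)
    have ut: "0 \<le> u * t" "u * t \<le> t" using u that by (auto simp: mult_left_le_one_le)
    show "x \<in> closed_segment z0 (p s) \<union> closed_segment (p s) (p t)"
    proof (cases "u * t \<le> s")
      case True
      hence "u * t \<in> closed_segment 0 s" using ut by (simp add: closed_segment_eq_real_ivl)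
      thus ?thesis using affine[of "u * t" 0 s] x p0 by simp
    next
      case False
      hence "u * t \<in> closed_segment s t" using ut by (simp add: closed_segment_eq_real_ivl)
      thus ?thesis using affine[of "u * t" s t] x by simp
    qed
  qed
  have step: "good t" if "good s" "p s \<in> ball c \<epsilon>" "p t \<in> ball c \<epsilon>" "ball c \<epsilon> \<subseteq> S"
      "splits_over R (ball c \<epsilon> - B) G" "s \<in> {0..1}" "t \<in> {0..1}" for s t c \<epsilon> G
    using that(1) extend_step[OF N0(1-4) _ that(4,5,2,3) seg[OF that(6,7)]] unfolding good_def by blast
  \<comment> \<open>within a disc over which the fibers split, continuation to one point yields continuation to any other\<close>
  have locally_const: "\<exists>W. openin (top_of_set {0..1}) W \<and> t \<in> W \<and> W \<subseteq> {0..1} \<and> (\<forall>s\<in>W. good s \<longleftrightarrow> good t)"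
    if t: "t \<in> {0..1}" for t
  proof -
    obtain \<epsilon> G where eG: "\<epsilon> > 0" "ball (p t) \<epsilon> \<subseteq> S" "splits_over R (ball (p t) \<epsilon> - B) G"
      using locally[OF p_in[OF t]] by blast
    define W where "W = {0..1} \<inter> p -` ball (p t) \<epsilon>"
    have "openin (top_of_set {0..1}) W"
      unfolding W_def using cont by (intro continuous_openin_preimage_gen open_ball)
    moreover have "t \<in> W" "W \<subseteq> {0..1}" using t eG(1) by (simp_all add: W_def)
    moreover have "good s \<longleftrightarrow> good t" if "s \<in> W" for s
    proof -
      have s: "s \<in> {0..1}" "p s \<in> ball (p t) \<epsilon>" using that by (simp_all add: W_def)
      have t': "p t \<in> ball (p t) \<epsilon>" using eG(1) by simp
      show ?thesis
        using step[OF _ s(2) t' eG(2,3) s(1) t] step[OF _ t' s(2) eG(2,3) t s(1)] by (rule iffI)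
    qed
    ultimately show ?thesis by (intro exI[of _ W] conjI ballI)
  qed
  have "extends_along z0 N0 h0 (p 0) N0 h0"
    unfolding extends_along_def using N0 by (simp add: p0)
  hence "good 0" unfolding good_def by blast
  have open_good: "openin (top_of_set {0..1}) {t \<in> {0..1}. good t = b}" for b
  proof (subst openin_subopen, intro ballI)
    fix t assume "t \<in> {t \<in> {0..1}. good t = b}"
    hence t: "t \<in> {0..1}" "good t = b" by auto
    obtain W where "openin (top_of_set {0..1}) W" "t \<in> W" "W \<subseteq> {0..1}" "\<forall>s\<in>W. good s \<longleftrightarrow> good t"
      using locally_const[OF t(1)] by blast
    thus "\<exists>T. openin (top_of_set {0..1}) T \<and> t \<in> T \<and> T \<subseteq> {t \<in> {0..1}. good t = b}"
      using t by (intro exI[of _ W]) auto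
  qed
  define T where "T = {t \<in> {0..1}. good t = True}"
  have sub: "T \<subseteq> {0..1}" unfolding T_def by (rule Collect_restrict)
  have compl: "{0..1} - T = {t \<in> {0..1::real}. good t = False}" unfolding T_def by blast
  have "closedin (top_of_set {0..1}) T"
    unfolding closedin_def topspace_euclidean_subtopology compl using sub open_good[of False] by blast
  moreover have "openin (top_of_set {0..1}) T" unfolding T_def by (rule open_good)
  ultimately have "T = {} \<or> T = {0..1}"
    using connected_clopen[of "{0..1::real}"] by simp
  moreover have "0 \<in> T" using \<open>good 0\<close> by (simp add: T_def)
  ultimately have "T = {0..1}" by blast
  hence "1 \<in> T" by simp
  hence "good 1" by (simp add: T_def)
  thus ?thesis unfolding good_def p1 .
qed

text \<open>
  The continuations along all segments from \<open>z0\<close> fit together: two of their convex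
  domains meet in a convex set that contains \<open>z0\<close>, and near \<open>z0\<close> both
  continuations are \<open>h0\<close>.
\<close>

lemma global_section:
  assumes N0: "open N0" "convex N0" "N0 \<noteq> {}" "section_over R (N0 - B) h0" "N0 \<subseteq> S"
  shows "\<exists>h. section_over R (S - B) h \<and> (\<forall>z\<in>N0 - B. h z = h0 z)"
proof -
  obtain z0 where z0: "z0 \<in> N0" using N0(3) by blast
  have "\<forall>z\<in>S. \<exists>Nh. extends_along z0 N0 h0 z (fst Nh) (snd Nh)"
    using extend_along_segment[OF N0(1,2) z0 N0(4,5)] by simp
  from bchoice[OF this] obtain Nh where
    Nh: "\<forall>z\<in>S. extends_along z0 N0 h0 z (fst (Nh z)) (snd (Nh z))" ..
  define N where "N z = fst (Nh z)" for z
  define k where "k z = snd (Nh z)" for z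
  have N: "open (N z)" "convex (N z)" "closed_segment z0 z \<subseteq> N z" "N z \<subseteq> S"
    "section_over R (N z - B) (k z)" "\<forall>x\<in>N z \<inter> N0 - B. k z x = h0 x" if "z \<in> S" for z
    using bspec[OF Nh that] unfolding extends_along_def N_def k_def by simp_all
  have agree: "k z x = k z' x" if "z \<in> S" "z' \<in> S" "x \<in> N z \<inter> N z' - B" for z z' x
  proof (rule sections_agree[of "N z \<inter> N z'" "k z" "k z'" "N z \<inter> N z' \<inter> N0" x])
    show "open (N z \<inter> N z')" "convex (N z \<inter> N z')"
      by (intro open_Int convex_Int N(1,2) that)+
    show "open (N z \<inter> N z' \<inter> N0)" "convex (N z \<inter> N z' \<inter> N0)"
      by (intro open_Int convex_Int N(1,2) N0(1,2) that)+
    have "z0 \<in> N z \<inter> N z' \<inter> N0" using N(3)[OF that(1)] N(3)[OF that(2)] z0 by auto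
    thus "N z \<inter> N z' \<inter> N0 \<noteq> {}" by blast
    show "section_over R (N z \<inter> N z' - B) (k z)"
      by (rule section_over_subset[OF N(5)[OF that(1)]]) auto
    show "section_over R (N z \<inter> N z' - B) (k z')"
      by (rule section_over_subset[OF N(5)[OF that(2)]]) auto
    show "k z y = k z' y" if "y \<in> N z \<inter> N z' \<inter> N0 - B" for y
      using N(6)[OF \<open>z \<in> S\<close>] N(6)[OF \<open>z' \<in> S\<close>] that by simp
    show "N z \<inter> N z' \<inter> N0 \<subseteq> N z \<inter> N z'" by blast
  qed (fact that(3))
  define h where "h z = k z z" for z
  have h_eq: "h x = k z x" if "z \<in> S" "x \<in> N z - B" for x z
  proof -
    have "x \<in> S" using that N(4)[OF that(1)] by blast
    moreover have "x \<in> N x" using N(3)[OF \<open>x \<in> S\<close>] by auto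
    ultimately show ?thesis unfolding h_def using that by (intro agree) auto
  qed
  have mem: "z \<in> N z" if "z \<in> S" for z using N(3)[OF that] by auto
  have "h field_differentiable at z within (S - B)" if z: "z \<in> S - B" for z
  proof -
    have zS: "z \<in> S" using z by simp
    have op: "open (N z - B)" using N(1,2)[OF zS] by (rule punctured)
    have "k z holomorphic_on N z - B" using N(5)[OF zS] by (simp add: section_over_def)
    hence "h holomorphic_on N z - B" by (rule holomorphic_transform) (simp add: h_eq[OF zS])
    moreover have "z \<in> N z - B" using mem[OF zS] z by simp
    ultimately have "h field_differentiable at z" using op holomorphic_on_imp_differentiable_at by blast
    thus ?thesis by (rule field_differentiable_at_within)
  qed
  hence "h holomorphic_on S - B" by (simp add: holomorphic_on_def)
  moreover have "h z \<in> R z" if "z \<in> S - B" for z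
    using N(5)[of z] mem[of z] that by (simp add: h_def section_over_def)
  moreover have "h z = h0 z" if "z \<in> N0 - B" for z
  proof -
    have "z \<in> S" using that N0(5) by blast
    thus ?thesis using N(6)[of z] mem[of z] that by (simp add: h_def)
  qed
  ultimately show ?thesis unfolding section_over_def by (intro exI[of _ h]) simp
qed

text \<open>
  The monodromy theorem. A value over any point lies on a local branch there; continued to the base
  point, this branch is one of the branches over the base disc, so the continuations of the latter
  give all values.
\<close>

theorem split_globally: "\<exists>H. splits_over R (S - B) H"
proof (cases "S = {}")
  case True
  thus ?thesis by (intro exI[of _ "{}"]) (simp add: splits_over_def)
next
  case False
  then obtain z0 where z0: "z0 \<in> S" by blast
  obtain \<epsilon> G where G: "\<epsilon> > 0" "ball z0 \<epsilon> \<subseteq> S" "splits_over R (ball z0 \<epsilon> - B) G"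
    using locally[OF z0] by blast
  have "\<forall>g\<in>G. \<exists>h. section_over R (S - B) h \<and> (\<forall>z\<in>ball z0 \<epsilon> - B. h z = g z)"
    using G(1,2) by (intro ballI global_section splits_over_section[OF G(3)]) auto
  from bchoice[OF this] obtain ext where
    ext: "\<forall>g\<in>G. section_over R (S - B) (ext g) \<and> (\<forall>z\<in>ball z0 \<epsilon> - B. ext g z = g z)" ..
  have "R z = (\<lambda>h. h z) ` (ext ` G)" if z: "z \<in> S - B" for z
  proof
    show "(\<lambda>h. h z) ` (ext ` G) \<subseteq> R z" using ext z by (auto simp: section_over_def)
    show "R z \<subseteq> (\<lambda>h. h z) ` (ext ` G)"
    proof
      fix w assume w: "w \<in> R z"
      have "z \<in> S" using z by simp
      then obtain \<epsilon>1 G1 where G1: "\<epsilon>1 > 0" "ball z \<epsilon>1 \<subseteq> S" "splits_over R (ball z \<epsilon>1 - B) G1"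
        using locally by blast
      have "z \<in> ball z \<epsilon>1 - B" using z G1(1) by simp
      then obtain g1 where g1: "g1 \<in> G1" "g1 z = w"
        using w G1(3) unfolding splits_over_def by auto
      have "ball z \<epsilon>1 \<noteq> {}" using G1(1) by simp
      from global_section[OF open_ball convex_ball this splits_over_section[OF G1(3) g1(1)] G1(2)]
      obtain h where h: "section_over R (S - B) h" "\<forall>x\<in>ball z \<epsilon>1 - B. h x = g1 x"
        by (elim exE conjE)
      have ne: "ball z0 \<epsilon> \<noteq> {}" using G(1) by simp
      have sec: "section_over R (ball z0 \<epsilon> - B) h"
        by (rule section_over_subset[OF h(1)]) (use G(2) in blast)
      from section_of_splitting[OF G(3) punctured[OF open_ball convex_ball ] sec] ne
      obtain g where g: "g \<in> G" "\<forall>x\<in>ball z0 \<epsilon> - B. h x = g x" by auto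
      have "h z = ext g z"
      proof (rule sections_agree[of S h "ext g" "ball z0 \<epsilon>" z])
        show "h y = ext g y" if "y \<in> ball z0 \<epsilon> - B" for y using ext g that by simp
      qed (use open_S convex_S h(1) ext g(1) G(2) ne z in auto)
      moreover have "h z = w" using h(2) g1(2) \<open>z \<in> ball z \<epsilon>1 - B\<close> by simp
      ultimately show "w \<in> (\<lambda>h. h z) ` (ext ` G)" using g(1) by blast
    qed
  qed
  moreover have "finite (ext ` G)" using G(3) by (simp add: splits_over_def)
  moreover have "\<forall>h\<in>ext ` G. h holomorphic_on S - B" using ext by (simp add: section_over_def)
  ultimately show ?thesis unfolding splits_over_def by blast
qed

end

section \<open>Local monodromy\<close>

locale algebraic_fibers = squarefree_family +
  fixes P :: "complex poly fract poly"
  assumes fiber_eq: "\<And>x. x \<notin> B \<Longrightarrow> fiber P x = roots x"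

text \<open>
  The inverse of a local coordinate centred at a point of the sphere, as a map into the plane; at
  infinity only nonzero arguments are meaningful.
\<close>

fun sphere_coordinate :: "complex option \<Rightarrow> complex \<Rightarrow> complex" where
  "sphere_coordinate (Some a) s = a + s"
| "sphere_coordinate None s = inverse s"

lemma sphere_coordinate_holomorphic: "sphere_coordinate a holomorphic_on - {0}"
proof -
  have eq: "sphere_coordinate a = (\<lambda>s. case a of None \<Rightarrow> inverse s | Some b \<Rightarrow> b + s)"
    by (cases a) auto
  show ?thesis unfolding eq by (cases a) (auto intro!: holomorphic_intros)
qed

lemma (in squarefree_family) sphere_coordinate_avoids_B:
  obtains e where "e > 0" "\<And>s. s \<noteq> 0 \<Longrightarrow> norm s < e \<Longrightarrow> sphere_coordinate a s \<notin> B"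
proof -
  define c where "c = (\<lambda>x. case a of Some b \<Rightarrow> x - b | None \<Rightarrow> inverse x)"
  have "finite (c ` B - {0})" using finite_B by simp
  then obtain e where e: "e > 0" "\<forall>x\<in>c ` B - {0}. x \<noteq> 0 \<longrightarrow> e \<le> dist 0 x"
    using finite_set_avoid[of "c ` B - {0}" 0] by blast
  have "c (sphere_coordinate a s) = s" for s by (cases a) (simp_all add: c_def)
  hence "sphere_coordinate a s \<notin> B" if "s \<noteq> 0" "norm s < e" for s
    using e(2) that by (metis Diff_iff dist_0_norm image_eqI not_less singletonD)
  thus thesis using e(1) that by blast
qed

lemma sphere_coordinate_exp_holomorphic: "(\<lambda>t. sphere_coordinate a (exp t)) holomorphic_on UNIV"
proof -
  have "(exp :: complex \<Rightarrow> complex) ` UNIV \<subseteq> - {0}"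
  proof
    fix y :: complex assume "y \<in> range exp"
    then obtain x where "y = exp x" by (rule imageE)
    thus "y \<in> - {0}" by simp
  qed
  from holomorphic_on_compose_gen[OF holomorphic_on_exp sphere_coordinate_holomorphic this, of a]
  show ?thesis by (simp add: o_def)
qed

text \<open>
  A punctured neighbourhood of \<open>a\<close> free of exceptional points, with the branches
  \<open>Hs\<close> of the fibers pulled back to the half-plane that covers it by the exponential
  function.
\<close>

locale puncture = algebraic_fibers +
  fixes a :: "complex option" and e0 :: real and Hs :: "(complex \<Rightarrow> complex) set"
  assumes e0_pos: "e0 > 0"
    and avoids: "\<And>s. s \<noteq> 0 \<Longrightarrow> norm s < e0 \<Longrightarrow> sphere_coordinate a s \<notin> B"
    and splits: "splits_over (\<lambda>t. roots (sphere_coordinate a (exp t))) {t. Re t < ln e0} Hs"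
begin

definition halfplane :: "complex set" where "halfplane = {t. Re t < ln e0}"

definition cover :: "complex \<Rightarrow> complex" where "cover t = sphere_coordinate a (exp t)"

text \<open>
  Adding \<open>turn\<close> is the deck transformation that corresponds to one loop around
  \<open>a\<close>.
\<close>

definition turn :: complex where "turn = 2 * of_real pi * \<i>"

lemma halfplane: "open halfplane" "convex halfplane" "connected halfplane" "halfplane \<noteq> {}"
proof -
  show "open halfplane" unfolding halfplane_def by (rule open_halfspace_Re_lt)
  show c: "convex halfplane" unfolding halfplane_def by (rule convex_halfspace_Re_lt)
  show "connected halfplane" using c by (rule convex_connected)
  have "of_real (ln e0 - 1) \<in> halfplane" by (simp add: halfplane_def)
  thus "halfplane \<noteq> {}" by blast
qed

lemma turn_halfplane [simp]: "t + of_nat n * turn \<in> halfplane \<longleftrightarrow> t \<in> halfplane"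
    "t - of_nat n * turn \<in> halfplane \<longleftrightarrow> t \<in> halfplane"
  by (simp_all add: halfplane_def turn_def)

lemma exp_turn: "exp (t + of_nat n * turn) = exp t"
proof -
  have "t + of_nat n * turn = t + complex_of_real (real_of_int (2 * int n) * pi) * \<i>"
    by (simp add: turn_def)
  thus ?thesis unfolding exp_eq by (rule exI)
qed

lemma cover_turn: "cover (t + of_nat n * turn) = cover t"
  by (simp add: cover_def exp_turn)

lemma cover_good: "t \<in> halfplane \<Longrightarrow> cover t \<notin> B"
proof -
  assume "t \<in> halfplane"
  hence "exp (Re t) < exp (ln e0)" by (simp add: halfplane_def)
  hence "norm (exp t) < e0" using e0_pos by simp
  thus ?thesis unfolding cover_def by (intro avoids) simp_all
qed

lemma cover_continuous: "continuous_on A cover"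
proof -
  have "(\<lambda>t. sphere_coordinate a (exp t)) holomorphic_on UNIV"
    by (rule sphere_coordinate_exp_holomorphic)
  thus ?thesis unfolding cover_def using holomorphic_on_imp_continuous_on continuous_on_subset by blast
qed

abbreviation "branch \<equiv> section_over (\<lambda>t. roots (cover t)) halfplane"

lemma splits': "splits_over (\<lambda>t. roots (cover t)) halfplane Hs"
  using splits unfolding cover_def halfplane_def .

lemma branch_unique:
  assumes "branch h" "branch h'" "t0 \<in> halfplane" "h t0 = h' t0" "t \<in> halfplane"
  shows "h t = h' t"
proof (rule unique_lift[of halfplane cover h h' t0 t, OF halfplane(3) cover_continuous cover_good])
  show "continuous_on halfplane h" "continuous_on halfplane h'"
    using assms(1,2) unfolding section_over_def by (simp_all add: holomorphic_on_imp_continuous_on)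
  show "h t \<in> roots (cover t)" "h' t \<in> roots (cover t)" if "t \<in> halfplane" for t
    using assms(1,2) that unfolding section_over_def by simp_all
qed (use assms in simp_all)

lemma branch_shift:
  assumes "branch h"
  shows "branch (\<lambda>t. h (t + of_nat n * turn))"
proof -
  have "(h \<circ> (\<lambda>t. t + of_nat n * turn)) holomorphic_on halfplane"
    by (rule holomorphic_on_compose_gen[of _ _ _ halfplane])
       (use assms in \<open>auto simp: section_over_def intro!: holomorphic_intros\<close>)
  moreover have "h (t + of_nat n * turn) \<in> roots (cover t)" if "t \<in> halfplane" for t
    using assms that cover_turn[of t n] unfolding section_over_def by (metis turn_halfplane(1))
  ultimately show ?thesis unfolding section_over_def o_def by blast
qed

lemma loop_around_cover:
  assumes "0 < e"
  shows "loop_around a e s = cover (of_real (ln e) + of_real s * turn)"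
proof -
  have "exp (of_real (ln e) + of_real s * turn) = of_real e * exp (2 * of_real pi * \<i> * of_real s)"
    using assms by (simp add: exp_add exp_of_real turn_def mult_ac)
  thus ?thesis unfolding cover_def
    by (cases a) (simp_all add: circlepath_def part_circlepath_def linepath_def scaleR_conv_of_real mult_ac)
qed

text \<open>
  The loop lifts to the half-plane as a vertical segment from \<open>ln e\<close> to \<open>ln e +
  turn\<close>, and the composition of a branch with this segment is the unique continuation along
  the loop.
\<close>

lemma monodromy_branch:
  assumes "branch h" "0 < e" "e < e0"
  shows "monodromy P (loop_around a e) (h (of_real (ln e))) = h (of_real (ln e) + turn)"
proof -
  define u where "u s = of_real (ln e) + of_real s * turn" for s :: real
  have u_in: "u s \<in> halfplane" for s
    using assms(2,3) by (simp add: u_def halfplane_def turn_def)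
  have u_cont: "continuous_on {0..1} u" unfolding u_def by (intro continuous_intros)
  have fib: "fiber P (loop_around a e s) = roots (cover (u s))" for s
    using loop_around_cover[OF assms(2), of s] fiber_eq[OF cover_good[OF u_in[of s]]] by (simp add: u_def)
  have cont: "continuous_on {0..1} (h \<circ> u)"
    using assms(1) u_cont u_in unfolding section_over_def
    by (intro continuous_on_compose continuous_on_subset[OF holomorphic_on_imp_continuous_on]) auto
  have vals: "(h \<circ> u) s \<in> roots (cover (u s))" for s
    using assms(1) u_in[of s] by (simp add: section_over_def)
  show ?thesis unfolding monodromy_def
  proof (rule the_equality)
    show "\<exists>\<eta>. path \<eta> \<and> pathstart \<eta> = h (of_real (ln e)) \<and> pathfinish \<eta> = h (of_real (ln e) + turn) \<and>
            (\<forall>t\<in>{0..1}. \<eta> t \<in> fiber P (loop_around a e t))"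
      using cont vals by (intro exI[of _ "h \<circ> u"]) (simp add: path_def pathstart_def pathfinish_def fib, simp add: u_def)
  next
    fix w' assume "\<exists>\<eta>. path \<eta> \<and> pathstart \<eta> = h (of_real (ln e)) \<and> pathfinish \<eta> = w' \<and>
            (\<forall>t\<in>{0..1}. \<eta> t \<in> fiber P (loop_around a e t))"
    then obtain \<eta> where \<eta>: "path \<eta>" "pathstart \<eta> = h (of_real (ln e))" "pathfinish \<eta> = w'"
      "\<forall>t\<in>{0..1}. \<eta> t \<in> roots (cover (u t))"
      unfolding fib by blast
    have "\<eta> 1 = (h \<circ> u) 1"
    proof (rule unique_lift[of "{0..1}" "cover \<circ> u" \<eta> "h \<circ> u" 0])
      show "continuous_on {0..1} (cover \<circ> u)"
        by (intro continuous_on_compose u_cont cover_continuous)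
      show "continuous_on {0..1} \<eta>" using \<eta>(1) by (simp add: path_def)
      show "\<eta> 0 = (h \<circ> u) 0" using \<eta>(2) by (simp add: pathstart_def u_def)
    qed (use cont vals \<eta>(4) cover_good[OF u_in] in auto)
    thus "w' = h (of_real (ln e) + turn)" using \<eta>(3) by (simp add: pathfinish_def u_def)
  qed
qed

lemma monodromy_iterate:
  assumes "branch h" "0 < e" "e < e0"
  shows "(monodromy P (loop_around a e) ^^ k) (h (of_real (ln e))) = h (of_real (ln e) + of_nat k * turn)"
proof (induction k)
  case (Suc k)
  have "(monodromy P (loop_around a e) ^^ Suc k) (h (of_real (ln e))) =
        monodromy P (loop_around a e) (h (of_real (ln e) + of_nat k * turn))"
    using Suc by simp
  also have "\<dots> = h (of_real (ln e) + turn + of_nat k * turn)"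
    using monodromy_branch[OF branch_shift[OF assms(1), of k] assms(2,3)] .
  finally show ?case by (simp add: algebra_simps)
qed simp

definition period :: "nat \<Rightarrow> bool" where
  "period k \<longleftrightarrow> (\<forall>h\<in>Hs. \<forall>t\<in>halfplane. h (t + of_nat k * turn) = h t)"

text \<open>
  The values of the branches at the point \<open>ln e\<close> are the whole fiber, and a branch is
  determined by one value. So periodicity of all branches can be tested on the fiber over a single
  point.
\<close>

lemma period_iff:
  assumes "0 < e" "e < e0"
  shows "period k \<longleftrightarrow> (\<forall>w\<in>fiber P (pathstart (loop_around a e)). (monodromy P (loop_around a e) ^^ k) w = w)"
proof -
  have le: "of_real (ln e) \<in> halfplane" using assms by (simp add: halfplane_def)
  have "fiber P (pathstart (loop_around a e)) = roots (cover (of_real (ln e)))"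
    using loop_around_cover[OF assms(1), of 0] fiber_eq[OF cover_good[OF le]] by (simp add: pathstart_def)
  also have "\<dots> = (\<lambda>h. h (of_real (ln e))) ` Hs" using splits' le unfolding splits_over_def by blast
  finally have fib: "fiber P (pathstart (loop_around a e)) = (\<lambda>h. h (of_real (ln e))) ` Hs" .
  have br: "branch h" if "h \<in> Hs" for h using splits_over_section[OF splits' that] .
  show ?thesis unfolding fib
  proof
    assume "period k"
    thus "\<forall>w\<in>(\<lambda>h. h (of_real (ln e))) ` Hs. (monodromy P (loop_around a e) ^^ k) w = w"
      using monodromy_iterate[OF br assms] le by (auto simp: period_def)
  next
    assume *: "\<forall>w\<in>(\<lambda>h. h (of_real (ln e))) ` Hs. (monodromy P (loop_around a e) ^^ k) w = w"
    show "period k" unfolding period_def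
    proof (intro ballI)
      fix h t assume h: "h \<in> Hs" and t: "t \<in> halfplane"
      show "h (t + of_nat k * turn) = h t"
      proof (rule branch_unique[OF branch_shift[OF br[OF h]] br[OF h] le _ t])
        show "h (of_real (ln e) + of_nat k * turn) = h (of_real (ln e))"
          using monodromy_iterate[OF br[OF h] assms, of k] * h by simp
      qed
    qed
  qed
qed

lemma period_multiple:
  assumes "h \<in> Hs" "\<forall>t\<in>halfplane. h (t + of_nat k * turn) = h t" "t \<in> halfplane"
  shows "h (t + of_nat (k * m) * turn) = h t"
  using assms(3)
proof (induction m arbitrary: t)
  case (Suc m)
  have "h (t + of_nat (k * Suc m) * turn) = h ((t + of_nat k * turn) + of_nat (k * m) * turn)"
    by (simp add: algebra_simps)
  also have "\<dots> = h (t + of_nat k * turn)" using Suc.prems by (intro Suc.IH) simp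
  also have "\<dots> = h t" using assms(2) Suc.prems by blast
  finally show ?case .
qed simp

text \<open>
  Shifting a branch by multiples of \<open>turn\<close> gives branches again. As there are only
  finitely many, two shifts coincide.
\<close>

lemma period_exists: "\<exists>k>0. period k"
proof -
  have fin: "finite Hs" using splits' by (simp add: splits_over_def)
  have one: "\<exists>k>0. \<forall>t\<in>halfplane. h (t + of_nat k * turn) = h t" if h: "h \<in> Hs" for h
  proof -
    have "\<forall>n. \<exists>g. g \<in> Hs \<and> (\<forall>t\<in>halfplane. h (t + of_nat n * turn) = g t)"
      using section_of_splitting[OF splits' halfplane(1,3,4) branch_shift[OF splits_over_section[OF splits' h]]]
      by blast
    from choice[OF this] obtain g where
      g: "\<forall>n. g n \<in> Hs \<and> (\<forall>t\<in>halfplane. h (t + of_nat n * turn) = g n t)" ..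
    have "finite (range g)" by (rule finite_subset[OF _ fin]) (use g in blast)
    hence "\<not> inj g" using finite_imageD infinite_UNIV_nat by blast
    then obtain i j where ij: "i < j" "g i = g j"
      unfolding inj_def by (metis nat_neq_iff)
    have "h (t + of_nat (j - i) * turn) = h t" if t: "t \<in> halfplane" for t
    proof -
      define s where "s = t - of_nat i * turn"
      have "s \<in> halfplane" using t by (simp add: s_def)
      hence "h (s + of_nat j * turn) = h (s + of_nat i * turn)" using g ij(2) by simp
      moreover have "s + of_nat j * turn = t + of_nat (j - i) * turn"
        using ij(1) by (simp add: s_def of_nat_diff algebra_simps)
      moreover have "s + of_nat i * turn = t" by (simp add: s_def)
      ultimately show ?thesis by simp
    qed
    thus ?thesis using ij(1) by (intro exI[of _ "j - i"]) simp
  qed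
  hence "\<forall>h\<in>Hs. \<exists>k. k > 0 \<and> (\<forall>t\<in>halfplane. h (t + of_nat k * turn) = h t)" by blast
  from bchoice[OF this] obtain k where
    k: "\<forall>h\<in>Hs. k h > 0 \<and> (\<forall>t\<in>halfplane. h (t + of_nat (k h) * turn) = h t)" ..
  \<comment> \<open>a common multiple of the periods of the individual branches\<close>
  have "period (\<Prod>h\<in>Hs. k h)" unfolding period_def
  proof (intro ballI)
    fix h t assume h: "h \<in> Hs" and t: "t \<in> halfplane"
    have "(\<Prod>h\<in>Hs. k h) = k h * (\<Prod>h\<in>Hs - {h}. k h)" using fin h by (simp add: prod.remove)
    moreover have "h (t + of_nat (k h * (\<Prod>h\<in>Hs - {h}. k h)) * turn) = h t"
      by (rule period_multiple[OF h _ t]) (use k h in blast)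
    ultimately show "h (t + of_nat (\<Prod>h\<in>Hs. k h) * turn) = h t" by metis
  qed
  moreover have "(\<Prod>h\<in>Hs. k h) > 0" using k by (simp add: prod_pos)
  ultimately show ?thesis by blast
qed

text \<open>
  The condition \<open>period k\<close> does not mention the radius of the loop, so the permutation
  order is the same for all small loops.
\<close>

theorem least_period_is_order:
  obtains k where "k > 0" "period k" "local_monodromy_order P a k"
proof -
  define k where "k = (LEAST k. k > 0 \<and> period k)"
  have k: "k > 0 \<and> period k" unfolding k_def using period_exists by (rule LeastI_ex)
  have "\<forall>\<^sub>F e in at_right 0. permutation_order (fiber P (pathstart (loop_around a e)))
          (monodromy P (loop_around a e)) = k"
  proof (rule eventually_at_rightI[of 0 e0])
    fix e assume "e \<in> {0<..<e0}"
    thus "permutation_order (fiber P (pathstart (loop_around a e))) (monodromy P (loop_around a e)) = k"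
      unfolding permutation_order_def k_def using period_iff[of e] by simp
  qed (rule e0_pos)
  thus thesis using k by (intro that[of k]) (simp_all add: local_monodromy_order_def)
qed

end

context puncture begin

lemma period_int:
  assumes "period k" "h \<in> Hs" "t \<in> halfplane"
  shows "h (t + of_nat k * (of_int n * turn)) = h t"
proof (cases "n \<ge> 0")
  case True
  then obtain m where m: "n = int m" using nonneg_int_cases by blast
  have "h (t + of_nat (k * m) * turn) = h t"
    using assms by (intro period_multiple) (auto simp: period_def)
  thus ?thesis by (simp add: m mult_ac)
next
  case False
  then obtain m where m: "n = - int m" by (metis int_cases4 neg_0_le_iff_le of_nat_0_le_iff)
  define t' where "t' = t - of_nat (k * m) * turn"
  have "t' \<in> halfplane" using assms(3) unfolding t'_def turn_halfplane .
  hence "h (t' + of_nat (k * m) * turn) = h t'"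
    using assms by (intro period_multiple) (auto simp: period_def)
  moreover have "t' + of_nat (k * m) * turn = t" by (simp add: t'_def)
  moreover have "t + of_nat k * (of_int n * turn) = t'" by (simp add: t'_def m)
  ultimately show ?thesis by simp
qed

text \<open>
  On the half-plane put \<open>t = k log s\<close>. Different logarithms of \<open>s\<close> give
  values of \<open>t\<close> that differ by multiples of the period \<open>k \<cdot> turn\<close>,
  so the branches become single-valued functions of \<open>s\<close>.
\<close>

theorem Puiseux:
  assumes "k > 0" "period k"
  obtains \<rho> Y where "\<rho> > 0" "\<And>s. norm s < \<rho> \<Longrightarrow> s \<noteq> 0 \<Longrightarrow> sphere_coordinate a (s ^ k) \<notin> B"
    "splits_over (\<lambda>s. fiber P (sphere_coordinate a (s ^ k))) (ball 0 \<rho> - {0}) Y"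
proof -
  \<comment> \<open>the radius for which \<open>s ^ k\<close> stays in the disc of radius \<open>e0\<close>\<close>
  define \<rho> where "\<rho> = exp (ln e0 / of_nat k)"
  define Y where "Y = (\<lambda>h s. h (of_nat k * Ln s)) ` Hs"
  have in_half: "of_nat k * L \<in> halfplane" if "s \<in> ball 0 \<rho> - {0}" "exp L = s" for s L :: complex
  proof -
    have "exp (Re L) = norm s" using that(2) by (metis norm_exp_eq_Re)
    hence "exp (Re L) < \<rho>" using that(1) by simp
    hence "Re L < ln e0 / of_nat k" by (simp add: \<rho>_def)
    thus ?thesis using assms(1) by (simp add: halfplane_def field_simps)
  qed
  have cover_pow: "cover (of_nat k * L) = sphere_coordinate a (s ^ k)" if "exp L = s" for L s
    using that by (simp add: cover_def exp_of_nat_mult)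
  have indep: "h (of_nat k * L) = h (of_nat k * Ln s)"
    if "h \<in> Hs" "s \<in> ball 0 \<rho> - {0}" "exp L = s" for h s L
  proof -
    have "exp L = exp (Ln s)" using that by simp
    then obtain n where n: "L = Ln s + of_real (of_int (2 * n) * pi) * \<i>" using exp_eq[of L "Ln s"] by blast
    have "of_nat k * L = of_nat k * Ln s + of_nat k * (of_int n * turn)"
      unfolding n turn_def by (simp add: algebra_simps)
    moreover have "exp (Ln s) = s" using that(2) by simp
    ultimately show ?thesis
      using period_int[OF assms(2) that(1) in_half[OF that(2)], of "Ln s" n] by simp
  qed
  have good: "sphere_coordinate a (s ^ k) \<notin> B" if "s \<in> ball 0 \<rho> - {0}" for s :: complex
  proof -
    have "exp (Ln s) = s" using that by simp
    thus ?thesis using cover_good[OF in_half[OF that]] cover_pow by metis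
  qed
  have "splits_over (\<lambda>s. fiber P (sphere_coordinate a (s ^ k))) (ball 0 \<rho> - {0}) Y"
    unfolding splits_over_def
  proof (intro conjI ballI)
    show "finite Y" using splits' by (simp add: Y_def splits_over_def)
  next
    fix s :: complex assume s: "s \<in> ball 0 \<rho> - {0}"
    have e: "exp (Ln s) = s" using s by simp
    have "fiber P (sphere_coordinate a (s ^ k)) = roots (cover (of_nat k * Ln s))"
      using fiber_eq[OF good[OF s]] cover_pow[OF e] by simp
    also have "\<dots> = (\<lambda>h. h (of_nat k * Ln s)) ` Hs"
      using splits' in_half[OF s e] unfolding splits_over_def by blast
    finally show "fiber P (sphere_coordinate a (s ^ k)) = (\<lambda>h. h s) ` Y"
      by (simp add: Y_def image_image)
  next
    fix y assume "y \<in> Y"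
    then obtain h where h: "h \<in> Hs" "y = (\<lambda>s. h (of_nat k * Ln s))" by (auto simp: Y_def)
    have "y field_differentiable at s0" if s0: "s0 \<in> ball 0 \<rho> - {0}" for s0
    proof -
      \<comment> \<open>a logarithm near \<open>s0\<close>\<close>
      define L where "L s = Ln (s / s0) + Ln s0" for s
      define N where "N = (ball 0 \<rho> - {0}) \<inter> ball s0 (norm s0)"
      have N: "open N" "s0 \<in> N" using s0 by (auto simp: N_def)
      have slit: "s / s0 \<notin> \<real>\<^sub>\<le>\<^sub>0" if "s \<in> N" for s
      proof
        assume "s / s0 \<in> \<real>\<^sub>\<le>\<^sub>0"
        then obtain r where r: "r \<le> 0" "s / s0 = of_real r" by (elim nonpos_Reals_cases)
        hence "s = of_real r * s0" using s0 by (simp add: field_simps)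
        hence "s0 - s = of_real (1 - r) * s0" by (simp add: algebra_simps)
        hence "norm (s0 - s) = (1 - r) * norm s0" using r(1) by (simp add: norm_mult del: of_real_diff)
        moreover have "1 * norm s0 \<le> (1 - r) * norm s0" using r(1) by (intro mult_right_mono) auto
        ultimately show False using that by (simp add: N_def dist_norm)
      qed
      have expL: "exp (L s) = s" if "s \<in> N" for s
        using s0 that by (simp add: L_def exp_add N_def)
      have "L holomorphic_on N"
        unfolding L_def using s0 slit by (intro holomorphic_intros) auto
      hence "(\<lambda>s. of_nat k * L s) holomorphic_on N" by (intro holomorphic_intros)
      moreover have "h holomorphic_on halfplane" using splits' h(1) by (simp add: splits_over_def)
      moreover have "(\<lambda>s. of_nat k * L s) ` N \<subseteq> halfplane"
        using in_half[OF _ expL] by (simp add: image_subset_iff N_def)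
      ultimately have "(h \<circ> (\<lambda>s. of_nat k * L s)) holomorphic_on N"
        by (rule holomorphic_on_compose_gen)
      moreover have "(h \<circ> (\<lambda>s. of_nat k * L s)) s = y s" if "s \<in> N" for s
        using indep[OF h(1) _ expL[OF that]] that by (simp add: h(2) N_def)
      ultimately have "y holomorphic_on N" by (rule holomorphic_transform)
      thus ?thesis using N holomorphic_on_imp_differentiable_at by blast
    qed
    thus "y holomorphic_on ball 0 \<rho> - {0}"
      by (simp add: holomorphic_on_def field_differentiable_at_within)
  qed
  moreover have "\<rho> > 0" by (simp add: \<rho>_def)
  ultimately show thesis using good by (intro that[of \<rho> Y]) auto
qed

end

context algebraic_fibers begin

text \<open>
  The pulled back fibers split locally over the half-plane, hence globally because it is convex.
  This provides the branches to which the preceding results apply.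
\<close>

theorem fiber_uniformization:
  obtains k \<rho> Y where "k > 0" "local_monodromy_order P a k" "\<rho> > 0"
    "\<And>s. norm s < \<rho> \<Longrightarrow> s \<noteq> 0 \<Longrightarrow> sphere_coordinate a (s ^ k) \<notin> B"
    "splits_over (\<lambda>s. fiber P (sphere_coordinate a (s ^ k))) (ball 0 \<rho> - {0}) Y"
proof -
  obtain e0 where e0: "e0 > 0" "\<And>s. s \<noteq> 0 \<Longrightarrow> norm s < e0 \<Longrightarrow> sphere_coordinate a s \<notin> B"
    using sphere_coordinate_avoids_B[of a] by blast
  define H where "H = {t. Re t < ln e0}"
  define \<gamma> where "\<gamma> t = sphere_coordinate a (exp t)" for t
  have H: "open H" "convex H" unfolding H_def by (rule open_halfspace_Re_lt convex_halfspace_Re_lt)+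
  have hol: "\<gamma> holomorphic_on UNIV"
    unfolding \<gamma>_def by (rule sphere_coordinate_exp_holomorphic)
  have good: "\<gamma> t \<notin> B" if "t \<in> H" for t
  proof -
    have "exp (Re t) < exp (ln e0)" using that by (simp add: H_def)
    thus ?thesis unfolding \<gamma>_def using e0 by (intro e0(2)) simp_all
  qed
  have "locally_split (\<lambda>t. roots (\<gamma> t)) H {}"
  proof
    fix t0 assume t0: "t0 \<in> H"
    obtain \<epsilon> G where G: "\<epsilon> > 0" "finite G" "ball (\<gamma> t0) \<epsilon> \<inter> B = {}"
      "\<And>g. g \<in> G \<Longrightarrow> g holomorphic_on ball (\<gamma> t0) \<epsilon>"
      "\<And>x. x \<in> ball (\<gamma> t0) \<epsilon> \<Longrightarrow> roots x = (\<lambda>g. g x) ` G"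
      by (rule local_sections[OF good[OF t0]]) (rule that)
    have "open (H \<inter> \<gamma> -` ball (\<gamma> t0) \<epsilon>)"
      using H(1) hol by (intro open_Int open_vimage) (auto simp: holomorphic_on_imp_continuous_on)
    moreover have "t0 \<in> H \<inter> \<gamma> -` ball (\<gamma> t0) \<epsilon>" using t0 G(1) by simp
    ultimately obtain \<delta> where \<delta>: "\<delta> > 0" "ball t0 \<delta> \<subseteq> H \<inter> \<gamma> -` ball (\<gamma> t0) \<epsilon>"
      using open_contains_ball_eq by metis
    have "splits_over (\<lambda>t. roots (\<gamma> t)) (ball t0 \<delta> - {}) ((\<lambda>g. g \<circ> \<gamma>) ` G)"
      unfolding splits_over_def
    proof (intro conjI ballI)
      show "finite ((\<lambda>g. g \<circ> \<gamma>) ` G)" using G(2) by simp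
      show "roots (\<gamma> t) = (\<lambda>h. h t) ` ((\<lambda>g. g \<circ> \<gamma>) ` G)" if "t \<in> ball t0 \<delta> - {}" for t
        using G(5)[of "\<gamma> t"] \<delta>(2) that by (auto simp: image_image)
      fix h assume "h \<in> (\<lambda>g. g \<circ> \<gamma>) ` G"
      then obtain g where g: "g \<in> G" "h = g \<circ> \<gamma>" by blast
      show "h holomorphic_on ball t0 \<delta> - {}"
        unfolding g(2) by (rule holomorphic_on_compose_gen[OF holomorphic_on_subset[OF hol] G(4)[OF g(1)]])
          (use \<delta>(2) in auto)
    qed
    thus "\<exists>\<epsilon>>0. \<exists>G. ball t0 \<epsilon> \<subseteq> H \<and> splits_over (\<lambda>t. roots (\<gamma> t)) (ball t0 \<epsilon> - {}) G"
      using \<delta> by (intro exI[of _ \<delta>] conjI exI[of _ "(\<lambda>g. g \<circ> \<gamma>) ` G"]) auto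
  qed (use H in simp_all)
  then obtain Hs where "splits_over (\<lambda>t. roots (\<gamma> t)) (H - {}) Hs"
    using locally_split.split_globally by blast
  hence split: "splits_over (\<lambda>t. roots (sphere_coordinate a (exp t))) {t. Re t < ln e0} Hs"
    by (simp add: H_def \<gamma>_def)
  interpret puncture Q B P a e0 Hs
    by unfold_locales (use e0 split in auto)
  obtain k where k: "k > 0" "period k" "local_monodromy_order P a k"
    by (rule least_period_is_order)
  obtain \<rho> Y where "\<rho> > 0" "\<And>s. norm s < \<rho> \<Longrightarrow> s \<noteq> 0 \<Longrightarrow> sphere_coordinate a (s ^ k) \<notin> B"
    "splits_over (\<lambda>s. fiber P (sphere_coordinate a (s ^ k))) (ball 0 \<rho> - {0}) Y"
    by (rule Puiseux[OF k(1,2)]) (rule that)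
  with k show thesis by (intro that[of k \<rho> Y]) auto
qed

end

lemma local_monodromy_order_unique:
  assumes "local_monodromy_order P a k" "local_monodromy_order P a k'"
  shows "k = k'"
proof -
  have "\<forall>\<^sub>F e in at_right (0::real). k = k'"
    using assms unfolding local_monodromy_order_def by eventually_elim simp
  thus ?thesis by (simp add: eventually_const_iff)
qed

section \<open>Inverse branches by radicals\<close>

lemma holomorphic_poly: "poly q holomorphic_on A" for q :: "complex poly"
  by (auto simp: holomorphic_on_def field_differentiable_def
        intro: poly_DERIV has_field_derivative_at_within)

lemma obtainable_holomorphic:
  assumes "obtainable m U f" "open U"
  shows "f holomorphic_on U"
  using assms(1)
proof induction
  case (rational q p)
  thus ?case by (intro holomorphic_intros) auto
next
  case (divide f g)
  thus ?case by (intro holomorphic_on_divide) auto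
qed (auto intro: holomorphic_intros)

lemma obtainable_subset:
  assumes "obtainable m U f" "V \<subseteq> U"
  shows "obtainable m V f"
  using assms(1)
proof induction
  case (rational q p)
  thus ?case using assms(2) by (intro obtainable.rational) auto
next
  case (divide f g)
  thus ?case using assms(2) by (intro obtainable.divide) auto
next
  case (root g n f)
  thus ?case using assms(2) by (intro obtainable.root[of m V g n f]) (auto intro: holomorphic_on_subset)
next
  case (equation d c f)
  thus ?case using assms(2) by (intro obtainable.equation[of d m V c f]) (auto intro: holomorphic_on_subset)
qed (auto intro: obtainable.intros)

lemma obtainable_const: "obtainable m U (\<lambda>_. c)"
  using obtainable.rational[of U 1 m "[:c:]"] by simp

lemma obtainable_id: "obtainable m U (\<lambda>x. x)"
  using obtainable.rational[of U 1 m "[:0, 1:]"] by simp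

lemma obtainable_poly: "obtainable m U g \<Longrightarrow> obtainable m U (\<lambda>x. poly p (g x))"
proof (induction p)
  case (pCons a p)
  thus ?case using obtainable.add[OF obtainable_const obtainable.mult[of m U g "\<lambda>x. poly p (g x)"]] by simp
qed (simp add: obtainable_const)

text \<open>
  The inductive definition is sensitive to the values of a function outside \<open>U\<close>, except
  in the rules for roots and equations. Extraction of a first root removes this dependence.
\<close>

lemma obtainable_transfer:
  assumes "obtainable m U f" "open U" "\<And>x. x \<in> U \<Longrightarrow> f x = g x"
  shows "obtainable m U g"
proof (rule obtainable.root[OF assms(1), where n = 1])
  show "g holomorphic_on U"
    using obtainable_holomorphic[OF assms(1,2)] assms(3) by (rule holomorphic_transform)
qed (use assms(3) in auto)

text \<open>
  Obtainable functions that are injective on their domain. Injectivity keeps a function from being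
  constant, so that finitely many values can be avoided by shrinking the domain. It survives every
  step in which the old function can be recovered from the new one.
\<close>

definition reachable :: "nat \<Rightarrow> complex set \<Rightarrow> (complex \<Rightarrow> complex) \<Rightarrow> bool" where
  "reachable m U s \<longleftrightarrow> open U \<and> connected U \<and> U \<noteq> {} \<and> obtainable m U s \<and> inj_on s U"

lemma reachable_id: "open U \<Longrightarrow> connected U \<Longrightarrow> U \<noteq> {} \<Longrightarrow> reachable m U (\<lambda>x. x)"
  by (simp add: reachable_def obtainable_id)

lemma reachable_subset:
  "reachable m U s \<Longrightarrow> V \<subseteq> U \<Longrightarrow> open V \<Longrightarrow> connected V \<Longrightarrow> V \<noteq> {} \<Longrightarrow> reachable m V s"
  unfolding reachable_def by (auto intro: obtainable_subset inj_on_subset)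

lemma reachable_holomorphic: "reachable m U s \<Longrightarrow> s holomorphic_on U"
  unfolding reachable_def by (auto intro: obtainable_holomorphic)

lemma reachable_avoiding:
  assumes "reachable m U s" "finite F"
  obtains V where "V \<subseteq> U" "reachable m V s" "\<And>x. x \<in> V \<Longrightarrow> s x \<notin> F"
proof -
  define E where "E = s -` F \<inter> U"
  have U: "open U" "connected U" "U \<noteq> {}" "inj_on s U" using assms(1) by (auto simp: reachable_def)
  have fin: "finite E" unfolding E_def using assms(2) U(4) by (rule finite_vimage_IntI)
  have op: "open (U - E)" using U(1) fin by (simp add: finite_imp_closed open_Diff)
  have con: "connected (U - E)" using connected_open_delete_finite[OF U(1,2) _ fin] by simp
  have "U - E \<noteq> {}"
  proof
    assume "U - E = {}"
    hence "U \<subseteq> E" by simp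
    hence "finite U" using fin by (rule finite_subset)
    from finite_imp_not_open[OF this U(1)] U(3) show False by simp
  qed
  with reachable_subset[OF assms(1) _ op con] have "reachable m (U - E) s" by simp
  thus thesis by (intro that[of "U - E"]) (auto simp: E_def)
qed

lemma reachable_on_ball:
  assumes "reachable m U s"
  obtains x0 e where "e > 0" "ball x0 e \<subseteq> U" "reachable m (ball x0 e) s"
proof -
  obtain x0 where x0: "x0 \<in> U" using assms unfolding reachable_def by blast
  moreover have "open U" using assms unfolding reachable_def by blast
  ultimately obtain e where e: "e > 0" "ball x0 e \<subseteq> U" using open_contains_ball by blast
  have "reachable m (ball x0 e) s"
    by (rule reachable_subset[OF assms e(2)]) (use e(1) in auto)
  with e show thesis by (rule that)
qed

lemma reachable_root:
  assumes "reachable m U s" "n > 0"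
  obtains V t where "V \<subseteq> U" "reachable m V t" "\<And>x. x \<in> V \<Longrightarrow> t x ^ n = s x"
proof -
  obtain W where W: "W \<subseteq> U" "reachable m W s" "\<And>x. x \<in> W \<Longrightarrow> s x \<notin> {0}"
    using reachable_avoiding[OF assms(1), of "{0}"] by blast
  obtain x0 e where e: "e > 0" "ball x0 e \<subseteq> W" "reachable m (ball x0 e) s"
    by (rule reachable_on_ball[OF W(2)])
  have hol: "s holomorphic_on ball x0 e" by (rule reachable_holomorphic[OF e(3)])
  have nz: "s x \<noteq> 0" if "x \<in> ball x0 e" for x using W(3) e(2) that by blast
  obtain g where g: "g holomorphic_on ball x0 e" "\<And>x. x \<in> ball x0 e \<Longrightarrow> s x = exp (g x)"
    using contractible_imp_holomorphic_log[OF hol convex_imp_contractible[OF convex_ball] nz] by blast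
  define t where "t x = exp (g x / of_nat n)" for x
  have t: "t x ^ n = s x" if "x \<in> ball x0 e" for x
    using g(2)[OF that] assms(2) by (simp add: t_def exp_of_nat_mult[symmetric])
  have "t holomorphic_on ball x0 e" unfolding t_def using assms(2) g(1) by (intro holomorphic_intros) auto
  moreover have "obtainable m (ball x0 e) s" using e(3) by (simp add: reachable_def)
  ultimately have "obtainable m (ball x0 e) t"
    using t by (intro obtainable.root[of m _ s n t] assms(2)) auto
  moreover have "inj_on t (ball x0 e)"
  proof (rule inj_onI)
    fix x y assume xy: "x \<in> ball x0 e" "y \<in> ball x0 e" "t x = t y"
    hence "s x = s y" using t by metis
    thus "x = y" using e(3) xy(1,2) by (auto simp: reachable_def inj_on_def)
  qed
  ultimately have "reachable m (ball x0 e) t" using e(1) by (simp add: reachable_def)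
  thus thesis using t e(2) W(1) by (intro that[of "ball x0 e" t]) auto
qed

lemma reachable_moebius:
  assumes "reachable m U s" "\<alpha> * \<delta> - \<beta> * \<gamma> \<noteq> 0"
  obtains V where "V \<subseteq> U" "reachable m V (\<lambda>x. (\<alpha> * s x + \<beta>) / (\<gamma> * s x + \<delta>))"
    "\<And>x. x \<in> V \<Longrightarrow> \<gamma> * s x + \<delta> \<noteq> 0"
proof -
  have "[:\<delta>, \<gamma>:] \<noteq> 0" using assms(2) by auto
  hence "finite {w. poly [:\<delta>, \<gamma>:] w = 0}" by (rule poly_roots_finite)
  then obtain V where V: "V \<subseteq> U" "reachable m V s" "\<And>x. x \<in> V \<Longrightarrow> s x \<notin> {w. poly [:\<delta>, \<gamma>:] w = 0}"
    using reachable_avoiding[OF assms(1)] by metis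
  have nz: "\<gamma> * s x + \<delta> \<noteq> 0" if "x \<in> V" for x
    using V(3)[OF that] by (simp add: add.commute mult.commute)
  have ob: "obtainable m V s" using V(2) by (simp add: reachable_def)
  have "obtainable m V (\<lambda>x. (\<alpha> * s x + \<beta>) / (\<gamma> * s x + \<delta>))"
    using nz by (intro obtainable.divide obtainable.add obtainable.mult obtainable_const ob) auto
  moreover have "inj_on (\<lambda>x. (\<alpha> * s x + \<beta>) / (\<gamma> * s x + \<delta>)) V"
  proof (rule inj_onI)
    fix x y assume xy: "x \<in> V" "y \<in> V" "(\<alpha> * s x + \<beta>) / (\<gamma> * s x + \<delta>) = (\<alpha> * s y + \<beta>) / (\<gamma> * s y + \<delta>)"
    hence "(\<alpha> * s x + \<beta>) * (\<gamma> * s y + \<delta>) = (\<alpha> * s y + \<beta>) * (\<gamma> * s x + \<delta>)"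
      using nz by (simp add: frac_eq_eq)
    hence "(\<alpha> * \<delta> - \<beta> * \<gamma>) * (s x - s y) = 0" by (simp add: algebra_simps)
    hence "s x = s y" using assms(2) by simp
    thus "x = y" using V(2) xy(1,2) by (auto simp: reachable_def inj_on_def)
  qed
  ultimately have "reachable m V (\<lambda>x. (\<alpha> * s x + \<beta>) / (\<gamma> * s x + \<delta>))"
    using V(2) by (simp add: reachable_def)
  thus thesis using V(1) nz by (intro that)
qed

text \<open>
  Away from the critical values of \<open>q\<close> a local holomorphic inverse of \<open>q\<close>
  exists.
\<close>

lemma reachable_polynomial_equation:
  assumes "reachable m U s" "1 \<le> degree q" "degree q \<le> m"
  obtains V t where "V \<subseteq> U" "reachable m V t" "\<And>x. x \<in> V \<Longrightarrow> poly q (t x) = s x"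
proof -
  have "pderiv q \<noteq> 0" using assms(2) by (simp add: pderiv_eq_0_iff)
  hence "finite (poly q ` {r. poly (pderiv q) r = 0})" by (intro finite_imageI poly_roots_finite)
  then obtain W where W: "W \<subseteq> U" "reachable m W s" "\<And>x. x \<in> W \<Longrightarrow> s x \<notin> poly q ` {r. poly (pderiv q) r = 0}"
    using reachable_avoiding[OF assms(1)] by metis
  obtain x0 where x0: "x0 \<in> W" using W(2) by (auto simp: reachable_def)
  have "degree (q + [:- s x0:]) = degree q" using assms(2) by (intro degree_add_eq_left) auto
  hence "\<not> constant (poly (q + [:- s x0:]))" using assms(2) by (simp add: constant_degree)
  then obtain r0 where "poly (q + [:- s x0:]) r0 = 0" using fundamental_theorem_of_algebra by blast
  hence r0: "poly q r0 = s x0" by simp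
  hence "poly (pderiv q) r0 \<noteq> 0" using W(3)[OF x0] imageI[of r0 "{r. poly (pderiv q) r = 0}" "poly q"] by auto
  hence "deriv (poly q) r0 \<noteq> 0" using poly_DERIV[of q r0] DERIV_imp_deriv by fastforce
  then obtain \<rho> where \<rho>: "\<rho> > 0" "open (poly q ` ball r0 \<rho>)" "inj_on (poly q) (ball r0 \<rho>)"
    using has_complex_derivative_locally_invertible[OF holomorphic_poly[of q UNIV] UNIV_I open_UNIV] by metis
  obtain g where g: "g holomorphic_on poly q ` ball r0 \<rho>" "\<And>r. r \<in> ball r0 \<rho> \<Longrightarrow> g (poly q r) = r"
    using holomorphic_has_inverse[OF holomorphic_poly open_ball \<rho>(3)] by metis
  have holW: "s holomorphic_on W" and opW: "open W"
    using reachable_holomorphic[OF W(2)] W(2) by (auto simp: reachable_def)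
  have "open (s -` (poly q ` ball r0 \<rho>) \<inter> W)"
    using holomorphic_on_imp_continuous_on[OF holW] opW \<rho>(2) continuous_on_open_vimage by blast
  moreover have "x0 \<in> s -` (poly q ` ball r0 \<rho>) \<inter> W"
    using x0 r0 \<rho>(1) by (auto intro!: image_eqI[of _ _ r0])
  ultimately obtain e where e: "e > 0" "ball x0 e \<subseteq> s -` (poly q ` ball r0 \<rho>) \<inter> W"
    using open_contains_ball by blast
  define t where "t x = g (s x)" for x
  have qt: "poly q (t x) = s x" if x: "x \<in> ball x0 e" for x
  proof -
    have "s x \<in> poly q ` ball r0 \<rho>" using e(2) x by blast
    then obtain r where "r \<in> ball r0 \<rho>" "s x = poly q r" by blast
    thus ?thesis using g(2) by (simp add: t_def)
  qed
  have re: "reachable m (ball x0 e) s"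
    by (rule reachable_subset[OF W(2)]) (use e in auto)
  have "(g \<circ> s) holomorphic_on ball x0 e"
    by (rule holomorphic_on_compose_gen[OF holomorphic_on_subset[OF holW] g(1)]) (use e(2) in auto)
  hence tol: "t holomorphic_on ball x0 e" by (simp add: t_def[abs_def] o_def)
  have "obtainable m (ball x0 e) t"
  proof (rule obtainable.equation[of "degree q" m _ "\<lambda>i. if i = 0 then (\<lambda>x. coeff q 0 - s x) else (\<lambda>_. coeff q i)"])
    fix i show "obtainable m (ball x0 e) (if i = 0 then (\<lambda>x. coeff q 0 - s x) else (\<lambda>_. coeff q i))"
      using re by (auto intro: obtainable.diff obtainable_const simp: reachable_def)
  next
    show "\<forall>x\<in>ball x0 e. (\<Sum>i\<le>degree q. (if i = 0 then \<lambda>x. coeff q 0 - s x else (\<lambda>_. coeff q i)) x * t x ^ i) = 0"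
    proof
      fix x assume x: "x \<in> ball x0 e"
      have "(\<Sum>i\<le>degree q. (if i = 0 then \<lambda>x. coeff q 0 - s x else (\<lambda>_. coeff q i)) x * t x ^ i) =
            (\<Sum>i\<le>degree q. coeff q i * t x ^ i - (if i = 0 then s x else 0))"
        by (intro sum.cong) auto
      also have "\<dots> = poly q (t x) - s x" by (simp add: sum_subtractf poly_altdef)
      finally show "(\<Sum>i\<le>degree q. (if i = 0 then \<lambda>x. coeff q 0 - s x else (\<lambda>_. coeff q i)) x * t x ^ i) = 0"
        using qt[OF x] by simp
    qed
  qed (use assms tol in auto)
  moreover have "inj_on t (ball x0 e)"
  proof (rule inj_onI)
    fix x y assume xy: "x \<in> ball x0 e" "y \<in> ball x0 e" "t x = t y"
    hence "s x = s y" using qt by metis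
    thus "x = y" using re xy(1,2) by (auto simp: reachable_def inj_on_def)
  qed
  ultimately have "reachable m (ball x0 e) t" using e(1) by (simp add: reachable_def)
  thus thesis using qt e(2) W(1) by (intro that[of "ball x0 e" t]) auto
qed

section \<open>Klein's forms and their inversion\<close>

text \<open>
  The rational function \<open>u / v\<close> can be inverted: whenever \<open>\<xi>\<close> is
  obtained, so is some branch \<open>z\<close> of the solution of \<open>u(z) / v(z) =
  \<xi>\<close>.
\<close>

definition unwinds :: "nat \<Rightarrow> complex poly \<Rightarrow> complex poly \<Rightarrow> bool" where
  "unwinds m u v \<longleftrightarrow> (\<forall>U \<xi>. reachable m U \<xi> \<longrightarrow>
     (\<exists>V z. V \<subseteq> U \<and> reachable m V z \<and> (\<forall>x\<in>V. poly v (z x) \<noteq> 0 \<and> poly u (z x) = \<xi> x * poly v (z x))))"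

definition power_up_to_scalar :: "nat \<Rightarrow> complex poly \<Rightarrow> bool" where
  "power_up_to_scalar r u \<longleftrightarrow> (\<exists>c X. u = smult c (X ^ r))"

text \<open>
  The rational function \<open>u / v\<close> has multiplicities divisible by \<open>r1\<close>,
  \<open>r2\<close>, \<open>r3\<close> over \<open>0\<close>, \<open>\<infinity>\<close> and
  \<open>1\<close>, respectively, at all finite points.
\<close>

definition klein_triple :: "nat \<Rightarrow> nat \<Rightarrow> nat \<Rightarrow> nat \<Rightarrow> complex poly \<Rightarrow> complex poly \<Rightarrow> bool" where
  "klein_triple m r1 r2 r3 u v \<longleftrightarrow> unwinds m u v \<and> (\<forall>z. poly u z \<noteq> 0 \<or> poly v z \<noteq> 0) \<and>
     power_up_to_scalar r1 u \<and> power_up_to_scalar r2 v \<and> power_up_to_scalar r3 (u - v)"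

lemma power_up_to_scalar_power: "power_up_to_scalar r (smult c (X ^ r))" "power_up_to_scalar r (X ^ r)"
  unfolding power_up_to_scalar_def by (blast, metis smult_1_left)

lemma power_up_to_scalar_smult: "power_up_to_scalar r u \<Longrightarrow> power_up_to_scalar r (smult c u)"
  unfolding power_up_to_scalar_def by (metis smult_smult)

lemma power_up_to_scalar_mult:
  assumes "power_up_to_scalar r u" "power_up_to_scalar r v"
  shows "power_up_to_scalar r (u * v)"
proof -
  obtain c X d Y where "u = smult c (X ^ r)" "v = smult d (Y ^ r)"
    using assms unfolding power_up_to_scalar_def by blast
  hence "u * v = smult (c * d) ((X * Y) ^ r)" by (simp add: power_mult_distrib mult_ac)
  thus ?thesis unfolding power_up_to_scalar_def by blast
qed

lemma unwindsI:
  assumes "\<And>U \<xi>. reachable m U \<xi> \<Longrightarrow>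
     \<exists>V z. V \<subseteq> U \<and> reachable m V z \<and> (\<forall>x\<in>V. poly v (z x) \<noteq> 0 \<and> poly u (z x) = \<xi> x * poly v (z x))"
  shows "unwinds m u v"
  using assms unfolding unwinds_def by blast

lemma unwindsE:
  assumes "unwinds m u v" "reachable m U \<xi>"
  obtains V z where "V \<subseteq> U" "reachable m V z"
    "\<And>x. x \<in> V \<Longrightarrow> poly v (z x) \<noteq> 0" "\<And>x. x \<in> V \<Longrightarrow> poly u (z x) = \<xi> x * poly v (z x)"
proof -
  from assms(1)[unfolded unwinds_def, rule_format, OF assms(2)]
  obtain V z where "V \<subseteq> U" "reachable m V z"
    "\<forall>x\<in>V. poly v (z x) \<noteq> 0 \<and> poly u (z x) = \<xi> x * poly v (z x)" by (elim exE conjE)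
  thus thesis by (intro that) auto
qed

lemma unwinds_cyclic:
  assumes "n > 0"
  shows "unwinds m ([:0, 1:] ^ n) 1"
proof (rule unwindsI)
  fix U \<xi> assume "reachable m U \<xi>"
  then obtain V t where "V \<subseteq> U" "reachable m V t" "\<And>x. x \<in> V \<Longrightarrow> t x ^ n = \<xi> x"
    by (rule reachable_root[OF _ assms]) (rule that)
  thus "\<exists>V z. V \<subseteq> U \<and> reachable m V z \<and>
      (\<forall>x\<in>V. poly 1 (z x) \<noteq> 0 \<and> poly ([:0, 1:] ^ n) (z x) = \<xi> x * poly 1 (z x))"
    by (intro exI[of _ V] exI[of _ t]) (simp add: poly_power)
qed

text \<open>
  The identity \<open>(z ^ n + 1)\<^sup>2 - (z ^ n - 1)\<^sup>2 = 4 z ^ n\<close>. Inversion takes a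
  square root, a Moebius map and an \<open>n\<close>-th root.
\<close>

lemma klein_triple_dihedral:
  assumes "n > 0"
  shows "klein_triple m 2 2 n (([:0, 1:] ^ n + 1) ^ 2) (([:0, 1:] ^ n - 1) ^ 2)"
  unfolding klein_triple_def
proof (intro conjI allI)
  have "([:0, 1:] ^ n + 1) ^ 2 - ([:0, 1:] ^ n - 1) ^ 2 = smult 4 ([:0, 1 :: complex:] ^ n)"
    by (simp add: power2_eq_square algebra_simps numeral_poly)
  thus "power_up_to_scalar n (([:0, 1:] ^ n + 1) ^ 2 - ([:0, 1:] ^ n - 1) ^ 2)"
    by (simp only: power_up_to_scalar_power)
  fix z :: complex
  show "poly (([:0, 1:] ^ n + 1) ^ 2) z \<noteq> 0 \<or> poly (([:0, 1:] ^ n - 1) ^ 2) z \<noteq> 0"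
    by (auto simp: poly_power)
next
  show "unwinds m (([:0, 1:] ^ n + 1) ^ 2) (([:0, 1:] ^ n - 1) ^ 2)"
  proof (rule unwindsI)
    fix U \<xi> assume r: "reachable m U \<xi>"
    obtain V1 s where V1: "V1 \<subseteq> U" "reachable m V1 s" "\<And>x. x \<in> V1 \<Longrightarrow> s x ^ 2 = \<xi> x"
      by (rule reachable_root[OF r zero_less_numeral]) (rule that)
    have det: "1 * (-1) - 1 * (1 :: complex) \<noteq> 0" by simp
    obtain V2 where V2: "V2 \<subseteq> V1" "reachable m V2 (\<lambda>x. (1 * s x + 1) / (1 * s x + (-1)))"
      "\<And>x. x \<in> V2 \<Longrightarrow> 1 * s x + (-1) \<noteq> 0"
      by (rule reachable_moebius[OF V1(2) det]) (rule that)
    obtain V3 z where V3: "V3 \<subseteq> V2" "reachable m V3 z" "\<And>x. x \<in> V3 \<Longrightarrow> z x ^ n = (1 * s x + 1) / (1 * s x + (-1))"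
      by (rule reachable_root[OF V2(2) assms]) (rule that)
    have "poly (([:0, 1:] ^ n - 1) ^ 2) (z x) \<noteq> 0 \<and>
          poly (([:0, 1:] ^ n + 1) ^ 2) (z x) = \<xi> x * poly (([:0, 1:] ^ n - 1) ^ 2) (z x)" if x: "x \<in> V3" for x
    proof -
      have nz: "s x - 1 \<noteq> 0" using V2(3)[of x] V3(1) x by auto
      have zn: "z x ^ n = (s x + 1) / (s x - 1)" using V3(3)[OF x] by simp
      have 1: "z x ^ n - 1 = 2 / (s x - 1)" and 2: "z x ^ n + 1 = 2 * s x / (s x - 1)"
        using nz unfolding zn by (simp_all add: field_simps)
      have "\<xi> x = s x ^ 2" using V1(3)[of x] V2(1) V3(1) x by auto
      thus ?thesis using nz by (simp add: poly_power 1 2 power_divide power_mult_distrib)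
    qed
    thus "\<exists>V z. V \<subseteq> U \<and> reachable m V z \<and> (\<forall>x\<in>V. poly (([:0, 1:] ^ n - 1) ^ 2) (z x) \<noteq> 0 \<and>
        poly (([:0, 1:] ^ n + 1) ^ 2) (z x) = \<xi> x * poly (([:0, 1:] ^ n - 1) ^ 2) (z x))"
      using V1(1) V2(1) V3(1,2) by (intro exI[of _ V3] exI[of _ z]) blast
  qed
qed (rule power_up_to_scalar_power)+

text \<open>
  Klein's tetrahedral forms \<open>z ^ 4 \<plusminus> 2 \<i> \<surd>3 z ^ 2 + 1\<close>, whose zeros
  are the face centres and the vertices of a tetrahedron, and \<open>z (z ^ 4 - 1)\<close>, whose
  zeros are the finite edge midpoints (the sixth one is at infinity).
\<close>

definition tet_const :: complex where "tet_const = 2 * \<i> * of_real (sqrt 3)"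

definition tet_face :: "complex poly" where "tet_face = [:1, 0, tet_const, 0, 1:]"
definition tet_vertex :: "complex poly" where "tet_vertex = [:1, 0, - tet_const, 0, 1:]"
definition tet_edge :: "complex poly" where "tet_edge = [:0, -1, 0, 0, 0, 1:]"

lemma tet_const_square: "tet_const ^ 2 = -12"
  by (simp add: tet_const_def power_mult_distrib flip: of_real_power)

lemma tet_const_nonzero: "tet_const \<noteq> 0"
  using tet_const_square by auto

lemma poly_tet:
  "poly tet_face z = (z ^ 4 + 1) + tet_const * z ^ 2"
  "poly tet_vertex z = (z ^ 4 + 1) - tet_const * z ^ 2"
  "poly tet_edge z = z * (z ^ 4 - 1)"
  by (simp_all add: tet_face_def tet_vertex_def tet_edge_def algebra_simps power2_eq_square power4_eq_xxxx)

lemma tetrahedral_identity: "tet_face ^ 3 - tet_vertex ^ 3 = smult (6 * tet_const) (tet_edge ^ 2)"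
proof -
  have "poly (tet_face ^ 3 - tet_vertex ^ 3) z = poly (smult (6 * tet_const) (tet_edge ^ 2)) z" for z
  proof -
    define a b where "a = z ^ 4 + 1" and "b = tet_const * z ^ 2"
    have b2: "b ^ 2 = -12 * z ^ 4"
      by (simp add: b_def power_mult_distrib tet_const_square flip: power_mult)
    have "(a + b) ^ 3 - (a - b) ^ 3 = 2 * b * (3 * a ^ 2 + b ^ 2)"
      by (simp add: power2_eq_square power3_eq_cube algebra_simps)
    also have "\<dots> = 6 * b * (a ^ 2 - 4 * z ^ 4)" by (simp add: b2 algebra_simps)
    also have "a ^ 2 - 4 * z ^ 4 = (z ^ 4 - 1) ^ 2"
      by (simp add: a_def power2_eq_square algebra_simps)
    also have "6 * b * (z ^ 4 - 1) ^ 2 = 6 * tet_const * (z * (z ^ 4 - 1)) ^ 2"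
      by (simp add: b_def power_mult_distrib)
    finally show ?thesis by (simp add: poly_power poly_tet a_def b_def)
  qed
  thus ?thesis by (simp add: poly_eq_poly_eq_iff[symmetric] fun_eq_iff)
qed

lemma tet_no_common_zero: "poly tet_face z \<noteq> 0 \<or> poly tet_vertex z \<noteq> 0"
proof (rule ccontr)
  assume "\<not> ?thesis"
  hence f: "poly tet_face z = 0" and v: "poly tet_vertex z = 0" by blast+
  have "2 * tet_const * z ^ 2 = poly tet_face z - poly tet_vertex z"
    by (simp add: poly_tet)
  hence "z = 0" using tet_const_nonzero by (simp add: f v)
  with f show False by (simp add: poly_tet)
qed

text \<open>
  A cube root \<open>s\<close> of \<open>\<xi>\<close> is the quotient of the face form by the
  vertex form. With \<open>\<beta> = z\<^sup>2 + z\<^sup>-\<^sup>2\<close> this quotient is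
  \<open>(\<beta> + c) / (\<beta> - c)\<close>, which gives \<open>\<beta>\<close> by a Moebius map.
  Since \<open>(\<beta> + 2) / (\<beta> - 2)\<close> is the square of \<open>\<eta> = (z\<^sup>2 +
  1) / (z\<^sup>2 - 1)\<close>, two square roots alternating with Moebius maps give
  \<open>z\<close>.
\<close>

lemma unwinds_tetrahedral: "unwinds m (tet_face ^ 3) (tet_vertex ^ 3)"
proof (rule unwindsI)
  fix U \<xi> assume r: "reachable m U \<xi>"
  define c where "c = tet_const"
  have c: "c \<noteq> 0" using tet_const_nonzero by (simp add: c_def)
  obtain V1 s where V1: "V1 \<subseteq> U" "reachable m V1 s" "\<And>x. x \<in> V1 \<Longrightarrow> s x ^ 3 = \<xi> x"
    by (rule reachable_root[OF r zero_less_numeral]) (rule that)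
  have det1: "c * (-1) - c * 1 \<noteq> 0" using c by simp
  obtain V2 where V2: "V2 \<subseteq> V1" "reachable m V2 (\<lambda>x. (c * s x + c) / (1 * s x + (-1)))"
    "\<And>x. x \<in> V2 \<Longrightarrow> 1 * s x + (-1) \<noteq> 0"
    by (rule reachable_moebius[OF V1(2) det1]) (rule that)
  define \<beta> where "\<beta> x = (c * s x + c) / (1 * s x + (-1))" for x
  have det2: "1 * (-2) - 2 * (1 :: complex) \<noteq> 0" by simp
  obtain V3 where V3: "V3 \<subseteq> V2" "reachable m V3 (\<lambda>x. (1 * \<beta> x + 2) / (1 * \<beta> x + (-2)))"
    "\<And>x. x \<in> V3 \<Longrightarrow> 1 * \<beta> x + (-2) \<noteq> 0"
    by (rule reachable_moebius[OF V2(2)[folded \<beta>_def] det2]) (rule that)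
  obtain V4 \<eta> where V4: "V4 \<subseteq> V3" "reachable m V4 \<eta>" "\<And>x. x \<in> V4 \<Longrightarrow> \<eta> x ^ 2 = (1 * \<beta> x + 2) / (1 * \<beta> x + (-2))"
    by (rule reachable_root[OF V3(2) zero_less_numeral]) (rule that)
  have det3: "1 * (-1) - 1 * (1 :: complex) \<noteq> 0" by simp
  obtain V5 where V5: "V5 \<subseteq> V4" "reachable m V5 (\<lambda>x. (1 * \<eta> x + 1) / (1 * \<eta> x + (-1)))"
    "\<And>x. x \<in> V5 \<Longrightarrow> 1 * \<eta> x + (-1) \<noteq> 0"
    by (rule reachable_moebius[OF V4(2) det3]) (rule that)
  obtain V6 z where V6: "V6 \<subseteq> V5" "reachable m V6 z" "\<And>x. x \<in> V6 \<Longrightarrow> z x ^ 2 = (1 * \<eta> x + 1) / (1 * \<eta> x + (-1))"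
    by (rule reachable_root[OF V5(2) zero_less_numeral]) (rule that)
  have "poly (tet_vertex ^ 3) (z x) \<noteq> 0 \<and> poly (tet_face ^ 3) (z x) = \<xi> x * poly (tet_vertex ^ 3) (z x)"
    if x: "x \<in> V6" for x
  proof -
    have x: "x \<in> V1" "x \<in> V2" "x \<in> V3" "x \<in> V4" "x \<in> V5" "x \<in> V6"
      using x V6(1) V5(1) V4(1) V3(1) V2(1) by blast+
    have s1: "s x - 1 \<noteq> 0" using V2(3)[OF x(2)] by simp
    have \<beta>: "\<beta> x * (s x - 1) = c * (s x + 1)" using s1 by (simp add: \<beta>_def field_simps)
    have \<beta>2: "\<beta> x - 2 \<noteq> 0" using V3(3)[OF x(3)] by simp
    have \<eta>: "\<eta> x ^ 2 * (\<beta> x - 2) = \<beta> x + 2" using V4(3)[OF x(4)] \<beta>2 by simp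
    have \<eta>1: "\<eta> x - 1 \<noteq> 0" using V5(3)[OF x(5)] by simp
    have z: "z x ^ 2 * (\<eta> x - 1) = \<eta> x + 1" using V6(3)[OF x(6)] \<eta>1 by simp
    define w where "w = z x ^ 2"
    have w: "w * (\<eta> x - 1) = \<eta> x + 1" using z by (simp add: w_def)
    have z4: "z x ^ 4 = w ^ 2" by (simp add: w_def flip: power_mult)
    let ?K = "(\<eta> x - 1) ^ 2 * (\<beta> x - 2) * (s x - 1)"
    have K: "?K \<noteq> 0" using \<eta>1 \<beta>2 s1 by simp
    have f: "?K * poly tet_face (z x) = 8 * c * s x"
    proof -
      have "(\<eta> x - 1) ^ 2 * (w ^ 2 + 1 + c * w) = \<eta> x ^ 2 * (2 + c) + (2 - c)"
        using w by algebra
      hence "(\<eta> x - 1) ^ 2 * (\<beta> x - 2) * (w ^ 2 + 1 + c * w) = 4 * \<beta> x + 4 * c"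
        using \<eta> by algebra
      hence "?K * (w ^ 2 + 1 + c * w) = 8 * c * s x" using \<beta> by algebra
      moreover have "poly tet_face (z x) = w ^ 2 + 1 + c * w"
        unfolding poly_tet z4 w_def[symmetric] c_def[symmetric] by (simp add: add.commute)
      ultimately show ?thesis by (simp only:)
    qed
    have g: "?K * poly tet_vertex (z x) = 8 * c"
    proof -
      have "(\<eta> x - 1) ^ 2 * (w ^ 2 + 1 - c * w) = \<eta> x ^ 2 * (2 - c) + (2 + c)"
        using w by algebra
      hence "(\<eta> x - 1) ^ 2 * (\<beta> x - 2) * (w ^ 2 + 1 - c * w) = 4 * \<beta> x - 4 * c"
        using \<eta> by algebra
      hence "?K * (w ^ 2 + 1 - c * w) = 8 * c" using \<beta> by algebra
      moreover have "poly tet_vertex (z x) = w ^ 2 + 1 - c * w"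
        unfolding poly_tet z4 w_def[symmetric] c_def[symmetric] by (simp add: add.commute)
      ultimately show ?thesis by (simp only:)
    qed
    have nz: "poly tet_vertex (z x) \<noteq> 0" using g c by auto
    have "?K * poly tet_face (z x) = ?K * (s x * poly tet_vertex (z x))"
      using f g by (simp add: mult_ac)
    hence "poly tet_face (z x) = s x * poly tet_vertex (z x)" using K by (simp only: mult_cancel_left) simp
    hence "poly tet_face (z x) ^ 3 = \<xi> x * poly tet_vertex (z x) ^ 3"
      using V1(3)[OF x(1)] by (simp add: power_mult_distrib)
    thus ?thesis using nz by (simp add: poly_power)
  qed
  thus "\<exists>V z. V \<subseteq> U \<and> reachable m V z \<and> (\<forall>x\<in>V. poly (tet_vertex ^ 3) (z x) \<noteq> 0 \<and>
      poly (tet_face ^ 3) (z x) = \<xi> x * poly (tet_vertex ^ 3) (z x))"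
    using V1(1) V2(1) V3(1) V4(1) V5(1) V6(1,2) by (intro exI[of _ V6] exI[of _ z]) blast
qed

lemma klein_triple_tetrahedral: "klein_triple m 3 3 2 (tet_face ^ 3) (tet_vertex ^ 3)"
  unfolding klein_triple_def tetrahedral_identity
  using unwinds_tetrahedral tet_no_common_zero by (simp add: power_up_to_scalar_power poly_power)

text \<open>
  With \<open>f\<close> and \<open>g\<close> the cubes of the face and vertex forms, the identity is
  \<open>(f + g)\<^sup>2 - 4 f g = (f - g)\<^sup>2\<close>, and \<open>f - g\<close> is itself a
  square up to a constant. The octahedral group contains the tetrahedral group with index two, so
  one square root reduces the inversion to the tetrahedral case: \<open>\<xi> / (\<xi> - 1)\<close>
  is the square of \<open>(\<tau> + 1) / (\<tau> - 1)\<close> for \<open>\<tau> = f / g\<close>.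
\<close>

lemma klein_triple_octahedral:
  "klein_triple m 2 3 4 ((tet_face ^ 3 + tet_vertex ^ 3) ^ 2) (smult 4 ((tet_face * tet_vertex) ^ 3))"
  unfolding klein_triple_def
proof (intro conjI allI)
  have "(tet_face ^ 3 + tet_vertex ^ 3) ^ 2 - smult 4 ((tet_face * tet_vertex) ^ 3) =
        (tet_face ^ 3 - tet_vertex ^ 3) ^ 2"
  proof -
    have "smult 4 ((tet_face * tet_vertex) ^ 3) = 4 * (tet_face ^ 3 * tet_vertex ^ 3)"
      by (simp add: power_mult_distrib numeral_poly)
    thus ?thesis by (simp add: power2_eq_square algebra_simps)
  qed
  also have "\<dots> = smult ((6 * tet_const) ^ 2) (tet_edge ^ 4)"
    unfolding tetrahedral_identity by (simp add: smult_power flip: power_mult)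
  finally show "power_up_to_scalar 4 ((tet_face ^ 3 + tet_vertex ^ 3) ^ 2 - smult 4 ((tet_face * tet_vertex) ^ 3))"
    by (simp only: power_up_to_scalar_power)
  fix z :: complex
  show "poly ((tet_face ^ 3 + tet_vertex ^ 3) ^ 2) z \<noteq> 0 \<or> poly (smult 4 ((tet_face * tet_vertex) ^ 3)) z \<noteq> 0"
    using tet_no_common_zero[of z] by (auto simp: poly_power)
next
  show "unwinds m ((tet_face ^ 3 + tet_vertex ^ 3) ^ 2) (smult 4 ((tet_face * tet_vertex) ^ 3))"
  proof (rule unwindsI)
    fix U \<xi> assume r: "reachable m U \<xi>"
    have det1: "1 * (-1) - 0 * (1 :: complex) \<noteq> 0" by simp
    obtain V1 where V1: "V1 \<subseteq> U" "reachable m V1 (\<lambda>x. (1 * \<xi> x + 0) / (1 * \<xi> x + (-1)))"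
      "\<And>x. x \<in> V1 \<Longrightarrow> 1 * \<xi> x + (-1) \<noteq> 0"
      by (rule reachable_moebius[OF r det1]) (rule that)
    obtain V2 \<eta> where V2: "V2 \<subseteq> V1" "reachable m V2 \<eta>" "\<And>x. x \<in> V2 \<Longrightarrow> \<eta> x ^ 2 = (1 * \<xi> x + 0) / (1 * \<xi> x + (-1))"
      by (rule reachable_root[OF V1(2) zero_less_numeral]) (rule that)
    have det2: "1 * (-1) - 1 * (1 :: complex) \<noteq> 0" by simp
    obtain V3 where V3: "V3 \<subseteq> V2" "reachable m V3 (\<lambda>x. (1 * \<eta> x + 1) / (1 * \<eta> x + (-1)))"
      "\<And>x. x \<in> V3 \<Longrightarrow> 1 * \<eta> x + (-1) \<noteq> 0"
      by (rule reachable_moebius[OF V2(2) det2]) (rule that)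
    define \<tau> where "\<tau> x = (1 * \<eta> x + 1) / (1 * \<eta> x + (-1))" for x
    obtain V4 where V4: "V4 \<subseteq> V3" "reachable m V4 \<tau>" "\<And>x. x \<in> V4 \<Longrightarrow> \<tau> x \<notin> {0}"
      using reachable_avoiding[OF V3(2)[folded \<tau>_def], of "{0}"] by blast
    obtain V5 z where V5: "V5 \<subseteq> V4" "reachable m V5 z" "\<And>x. x \<in> V5 \<Longrightarrow> poly (tet_vertex ^ 3) (z x) \<noteq> 0"
      "\<And>x. x \<in> V5 \<Longrightarrow> poly (tet_face ^ 3) (z x) = \<tau> x * poly (tet_vertex ^ 3) (z x)"
      by (rule unwindsE[OF unwinds_tetrahedral V4(2)]) (rule that)
    have "poly (smult 4 ((tet_face * tet_vertex) ^ 3)) (z x) \<noteq> 0 \<and>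
        poly ((tet_face ^ 3 + tet_vertex ^ 3) ^ 2) (z x) = \<xi> x * poly (smult 4 ((tet_face * tet_vertex) ^ 3)) (z x)"
      if x: "x \<in> V5" for x
    proof -
      have x: "x \<in> V1" "x \<in> V2" "x \<in> V3" "x \<in> V4" "x \<in> V5"
        using x V5(1) V4(1) V3(1) V2(1) by blast+
      define f g where "f = poly tet_face (z x) ^ 3" and "g = poly tet_vertex (z x) ^ 3"
      have fg: "f = \<tau> x * g" "g \<noteq> 0" using V5(3,4)[OF x(5)] by (simp_all add: f_def g_def poly_power)
      have \<tau>0: "\<tau> x \<noteq> 0" using V4(3)[OF x(4)] by simp
      have \<xi>1: "\<xi> x - 1 \<noteq> 0" using V1(3)[OF x(1)] by simp
      have \<eta>: "\<eta> x ^ 2 * (\<xi> x - 1) = \<xi> x" using V2(3)[OF x(2)] \<xi>1 by simp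
      have \<eta>1: "\<eta> x - 1 \<noteq> 0" using V3(3)[OF x(3)] by simp
      have \<tau>: "\<tau> x * (\<eta> x - 1) = \<eta> x + 1" using \<eta>1 by (simp add: \<tau>_def)
      have "(\<eta> x - 1) ^ 2 * ((\<tau> x + 1) ^ 2 - 4 * \<tau> x * \<xi> x) = 0"
        using \<tau> \<eta> by algebra
      hence "(\<tau> x + 1) ^ 2 = 4 * \<tau> x * \<xi> x" using \<eta>1 by simp
      hence "(f + g) ^ 2 = \<xi> x * (4 * (f * g))" unfolding fg(1) by algebra
      moreover have "4 * (f * g) \<noteq> 0" using fg \<tau>0 by simp
      ultimately show ?thesis by (simp add: poly_power power_mult_distrib f_def g_def)
    qed
    thus "\<exists>V z. V \<subseteq> U \<and> reachable m V z \<and> (\<forall>x\<in>V. poly (smult 4 ((tet_face * tet_vertex) ^ 3)) (z x) \<noteq> 0 \<and>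
        poly ((tet_face ^ 3 + tet_vertex ^ 3) ^ 2) (z x) = \<xi> x * poly (smult 4 ((tet_face * tet_vertex) ^ 3)) (z x))"
      using V1(1) V2(1) V3(1) V4(1) V5(1,2) by (intro exI[of _ V5] exI[of _ z]) blast
  qed
qed (simp_all only: power_up_to_scalar_power)

text \<open>
  Klein's resolvent of degree five of the icosahedral equation, made homogeneous with \<open>r = X /
  D\<close>: \<open>r (r\<^sup>2 - 10 r + 45)\<^sup>2 - 1728 = (r - 3)\<^sup>3 (r\<^sup>2 - 11 r +
  64)\<close>.
\<close>

lemma icosahedral_identity:
  fixes X D :: "'a::comm_ring_1"
  shows "X * (X ^ 2 - 10 * X * D + 45 * D ^ 2) ^ 2 - 1728 * D ^ 5 =
         (X - 3 * D) ^ 3 * (X ^ 2 - 11 * X * D + 64 * D ^ 2)"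
  by (simp add: power_numeral_reduce algebra_simps)

text \<open>
  The icosahedral group contains the tetrahedral group with index five, and \<open>r = X / D\<close>
  is a coordinate on the tetrahedral quotient: over the value \<open>1728\<close> of the resolvent
  the unramified points are the roots \<open>\<rho>1\<close>, \<open>\<rho>2\<close> of
  \<open>r\<^sup>2 - 11 r + 64\<close>, and over the value \<open>0\<close> it is \<open>r =
  0\<close>. The forms \<open>X\<close> and \<open>D\<close> are chosen as linear combinations of
  the cubes of the face and vertex forms for which \<open>X - \<rho>1 D\<close>, \<open>X - \<rho>2
  D\<close> and \<open>X\<close> are multiples of the face cube, the vertex cube and the edge
  square. So the multiplicities three and two missing at these points of the resolvent are supplied
  by the tetrahedral forms. For the inversion, \<open>r\<close> is a root of the resolvent equation,
  and a Moebius map takes \<open>r\<close> to the tetrahedral quotient.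
\<close>

lemma klein_triple_icosahedral:
  assumes "m \<ge> 5"
  obtains u v where "klein_triple m 2 5 3 u v"
proof -
  \<comment> \<open>\<open>d\<close> is a square root of the discriminant of \<open>r\<^sup>2 - 11 r + 64\<close>, with roots \<open>\<rho>1\<close>, \<open>\<rho>2\<close>\<close>
  define d where "d = \<i> * complex_of_real (sqrt 135)"
  have d2: "d ^ 2 = -135" by (simp add: d_def power_mult_distrib flip: of_real_power)
  define \<rho>1 \<rho>2 where "\<rho>1 = (11 + d) / 2" and "\<rho>2 = (11 - d) / 2"
  have \<rho>sum: "\<rho>1 + \<rho>2 = 11" by (simp add: \<rho>1_def \<rho>2_def field_simps)
  have "4 * (\<rho>1 * \<rho>2) = (2 * \<rho>1) * (2 * \<rho>2)" by simp
  also have "2 * \<rho>1 = 11 + d" by (simp add: \<rho>1_def)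
  also have "2 * \<rho>2 = 11 - d" by (simp add: \<rho>2_def)
  also have "(11 + d) * (11 - d) = 121 - d ^ 2" by (simp add: power2_eq_square algebra_simps)
  finally have "4 * (\<rho>1 * \<rho>2) = 121 - d ^ 2" .
  hence \<rho>prod: "\<rho>1 * \<rho>2 = 64" by (simp add: d2)
  have "d \<noteq> 0" using d2 by auto
  hence \<rho>ne: "\<rho>1 \<noteq> \<rho>2" by (auto simp: \<rho>1_def \<rho>2_def field_simps)
  have \<rho>0: "\<rho>1 \<noteq> 0" "\<rho>2 \<noteq> 0" using \<rho>prod by auto
  define F G where "F = tet_face ^ 3" and "G = tet_vertex ^ 3"
  define D where "D = smult \<rho>2 G - smult \<rho>1 F"
  \<comment> \<open>by \<open>64 = \<rho>1 \<rho>2\<close> the following identities \<open>X1\<close> and \<open>X2\<close> hold\<close>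
  define X where "X = smult 64 (G - F)"
  define u where "u = X * (X ^ 2 - 10 * X * D + 45 * D ^ 2) ^ 2"
  define v where "v = 1728 * D ^ 5"
  have quad: "X ^ 2 - 11 * X * D + 64 * D ^ 2 = (X - smult \<rho>1 D) * (X - smult \<rho>2 D)"
  proof -
    have "(X - smult \<rho>1 D) * (X - smult \<rho>2 D) = X ^ 2 - smult (\<rho>1 + \<rho>2) (X * D) + smult (\<rho>1 * \<rho>2) (D ^ 2)"
      by (simp add: power2_eq_square algebra_simps smult_add_left)
    also have "\<dots> = X ^ 2 - 11 * X * D + 64 * D ^ 2"
      by (simp add: \<rho>sum \<rho>prod numeral_poly)
    finally show ?thesis by simp
  qed
  have X1: "X - smult \<rho>1 D = smult (\<rho>1 * (\<rho>1 - \<rho>2)) F"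
    unfolding X_def D_def \<rho>prod[symmetric] by (simp add: algebra_simps smult_diff_right smult_diff_left)
  have X2: "X - smult \<rho>2 D = smult (\<rho>2 * (\<rho>1 - \<rho>2)) G"
    unfolding X_def D_def \<rho>prod[symmetric] by (simp add: algebra_simps smult_diff_right smult_diff_left)
  have "power_up_to_scalar 3 (u - v)"
  proof -
    have "u - v = (X - 3 * D) ^ 3 * (smult (\<rho>1 * (\<rho>1 - \<rho>2)) (tet_face ^ 3) * smult (\<rho>2 * (\<rho>1 - \<rho>2)) (tet_vertex ^ 3))"
      unfolding u_def v_def icosahedral_identity quad X1 X2 F_def G_def ..
    thus ?thesis by (simp only: power_up_to_scalar_mult power_up_to_scalar_power)
  qed
  moreover have "power_up_to_scalar 2 u"
  proof -
    have "G - F = - (F - G)" by simp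
    hence "X = smult (- 64 * (6 * tet_const)) (tet_edge ^ 2)"
      unfolding X_def F_def G_def by (simp add: tetrahedral_identity)
    thus ?thesis unfolding u_def by (simp only: power_up_to_scalar_mult power_up_to_scalar_power)
  qed
  moreover have "power_up_to_scalar 5 v"
    using power_up_to_scalar_power(1)[of 5 1728 D] by (simp add: v_def numeral_poly)
  moreover have "poly u z \<noteq> 0 \<or> poly v z \<noteq> 0" for z
  proof (rule ccontr)
    assume "\<not> ?thesis"
    hence uz: "poly u z = 0" and "poly v z = 0" by blast+
    hence Dz: "poly D z = 0" by (simp add: v_def)
    have "poly X z ^ 5 = 0" using uz Dz by (simp add: u_def power_numeral_reduce)
    hence Xz: "poly X z = 0" by simp
    have "smult (\<rho>1 * (\<rho>1 - \<rho>2)) F = X - smult \<rho>1 D" "smult (\<rho>2 * (\<rho>1 - \<rho>2)) G = X - smult \<rho>2 D"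
      using X1 X2 by simp_all
    hence "poly (smult (\<rho>1 * (\<rho>1 - \<rho>2)) F) z = 0" "poly (smult (\<rho>2 * (\<rho>1 - \<rho>2)) G) z = 0"
      using Xz Dz by simp_all
    hence "poly F z = 0" "poly G z = 0" using \<rho>0 \<rho>ne by simp_all
    thus False using tet_no_common_zero[of z] by (simp add: F_def G_def)
  qed
  moreover have "unwinds m u v"
  proof (rule unwindsI)
    fix U \<xi> assume r: "reachable m U \<xi>"
    define q where "q = ([:0, 1:] * [:45, -10, 1:] ^ 2 :: complex poly)"
    have q: "poly q t = t * (t ^ 2 - 10 * t + 45) ^ 2" for t
      by (simp add: q_def algebra_simps power2_eq_square)
    have "degree q = 5" by (simp add: q_def degree_mult_eq power2_eq_square)
    hence deg: "1 \<le> degree q" "degree q \<le> m" using assms by simp_all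
    have det1: "1728 * 1 - 0 * (0 :: complex) \<noteq> 0" by simp
    obtain V1 where V1: "V1 \<subseteq> U" "reachable m V1 (\<lambda>x. (1728 * \<xi> x + 0) / (0 * \<xi> x + 1))"
      by (rule reachable_moebius[OF r det1]) (rule that)
    obtain V2 t where V2: "V2 \<subseteq> V1" "reachable m V2 t" "\<And>x. x \<in> V2 \<Longrightarrow> poly q (t x) = (1728 * \<xi> x + 0) / (0 * \<xi> x + 1)"
      by (rule reachable_polynomial_equation[OF V1(2) deg]) (rule that)
    have det2: "\<rho>2 * (- (\<rho>1 * \<rho>2)) - (- (\<rho>2 * \<rho>1)) * \<rho>1 \<noteq> 0" using \<rho>0 \<rho>ne by auto
    obtain V3 where V3: "V3 \<subseteq> V2"
      "reachable m V3 (\<lambda>x. (\<rho>2 * t x + (- (\<rho>2 * \<rho>1))) / (\<rho>1 * t x + (- (\<rho>1 * \<rho>2))))"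
      "\<And>x. x \<in> V3 \<Longrightarrow> \<rho>1 * t x + (- (\<rho>1 * \<rho>2)) \<noteq> 0"
      by (rule reachable_moebius[OF V2(2) det2]) (rule that)
    define \<tau> where "\<tau> x = (\<rho>2 * t x + (- (\<rho>2 * \<rho>1))) / (\<rho>1 * t x + (- (\<rho>1 * \<rho>2)))" for x
    obtain V4 z where V4: "V4 \<subseteq> V3" "reachable m V4 z" "\<And>x. x \<in> V4 \<Longrightarrow> poly (tet_vertex ^ 3) (z x) \<noteq> 0"
      "\<And>x. x \<in> V4 \<Longrightarrow> poly (tet_face ^ 3) (z x) = \<tau> x * poly (tet_vertex ^ 3) (z x)"
      by (rule unwindsE[OF unwinds_tetrahedral V3(2)[folded \<tau>_def]]) (rule that)
    have "poly v (z x) \<noteq> 0 \<and> poly u (z x) = \<xi> x * poly v (z x)" if x: "x \<in> V4" for x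
    proof -
      have x: "x \<in> V1" "x \<in> V2" "x \<in> V3" "x \<in> V4" using x V4(1) V3(1) V2(1) by blast+
      define g where "g = poly G (z x)"
      define \<delta> where "\<delta> = poly D (z x)"
      have g: "g \<noteq> 0" "poly F (z x) = \<tau> x * g" using V4(3,4)[OF x(4)] by (simp_all add: g_def F_def G_def)
      have t2: "t x - \<rho>2 \<noteq> 0" using V3(3)[OF x(3)] by (auto simp: algebra_simps)
      have "\<tau> x = \<rho>2 * (t x - \<rho>1) / (\<rho>1 * (t x - \<rho>2))" by (simp add: \<tau>_def right_diff_distrib)
      hence \<tau>: "\<tau> x * (\<rho>1 * (t x - \<rho>2)) = \<rho>2 * (t x - \<rho>1)" using t2 \<rho>0 by simp
      have \<delta>_eq: "\<delta> = \<rho>2 * g - \<rho>1 * (\<tau> x * g)" by (simp add: \<delta>_def D_def g(2) g_def[symmetric])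
      have \<delta>: "\<delta> * (t x - \<rho>2) = \<rho>2 * (\<rho>1 - \<rho>2) * g" using \<delta>_eq \<tau> by algebra
      hence \<delta>0: "\<delta> \<noteq> 0" using \<rho>0 \<rho>ne g(1) by auto
      have "poly X (z x) = \<rho>1 * \<rho>2 * (g - \<tau> x * g)"
        unfolding X_def \<rho>prod[symmetric] by (simp add: g(2) g_def[symmetric])
      hence "poly X (z x) * (t x - \<rho>2) = t x * \<delta> * (t x - \<rho>2)" using \<delta> \<tau> by algebra
      hence X: "poly X (z x) = t x * \<delta>" using t2 by simp
      have "poly u (z x) = \<delta> ^ 5 * poly q (t x)"
        unfolding u_def q by (simp add: X \<delta>_def[symmetric]) (simp add: power_numeral_reduce algebra_simps)
      also have "poly q (t x) = 1728 * \<xi> x" using V2(3)[OF x(2)] by simp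
      finally have "poly u (z x) = \<xi> x * poly v (z x)" by (simp add: v_def \<delta>_def)
      moreover have "poly v (z x) \<noteq> 0" using \<delta>0 by (simp add: v_def \<delta>_def)
      ultimately show ?thesis by blast
    qed
    thus "\<exists>V z. V \<subseteq> U \<and> reachable m V z \<and> (\<forall>x\<in>V. poly v (z x) \<noteq> 0 \<and> poly u (z x) = \<xi> x * poly v (z x))"
      using V1(1) V2(1) V3(1) V4(1,2) by (intro exI[of _ V4] exI[of _ z]) blast
  qed
  ultimately show thesis by (intro that[of u v]) (simp add: klein_triple_def)
qed

fun homogeneous_coords :: "complex option \<Rightarrow> complex \<times> complex" where
  "homogeneous_coords (Some a) = (a, 1)"
| "homogeneous_coords None = (1, 0)"

text \<open>
  A polynomial that vanishes exactly where \<open>p / q\<close> takes the value \<open>a\<close>;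
  for infinity it is \<open>- q\<close>.
\<close>

definition zero_form :: "complex option \<Rightarrow> complex poly \<Rightarrow> complex poly \<Rightarrow> complex poly" where
  "zero_form a p q = smult (snd (homogeneous_coords a)) p - smult (fst (homogeneous_coords a)) q"

text \<open>
  The determinant of the homogeneous coordinates of two points.
\<close>

definition bracket :: "complex option \<Rightarrow> complex option \<Rightarrow> complex" where
  "bracket a b = fst (homogeneous_coords a) * snd (homogeneous_coords b) -
                 snd (homogeneous_coords a) * fst (homogeneous_coords b)"

lemma bracket_nonzero: "a \<noteq> b \<Longrightarrow> bracket a b \<noteq> 0"
  by (cases a; cases b) (auto simp: bracket_def)

text \<open>
  The three-term Pluecker relation between vectors in the plane.
\<close>

lemma zero_form_dependence:
  "smult (bracket b c) (zero_form a p q) + smult (bracket c a) (zero_form b p q) +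
   smult (bracket a b) (zero_form c p q) = 0"
  by (rule poly_eqI) (simp add: zero_form_def bracket_def algebra_simps)

text \<open>
  Up to a scalar, each form vanishing over \<open>a\<close> is an \<open>r a\<close>-th power: this
  is divisibility of all multiplicities over \<open>a\<close>, in a form from which a root can be
  extracted.
\<close>

definition uniformizes :: "nat \<Rightarrow> complex option set \<Rightarrow> (complex option \<Rightarrow> nat) \<Rightarrow> complex poly \<Rightarrow> complex poly \<Rightarrow> bool" where
  "uniformizes m A r p q \<longleftrightarrow> unwinds m p q \<and> (\<forall>z. poly p z \<noteq> 0 \<or> poly q z \<noteq> 0) \<and>
     (\<forall>a\<in>A. power_up_to_scalar (r a) (zero_form a p q))"

text \<open>
  The Moebius map that takes the values \<open>0\<close> and \<open>\<infinity>\<close> of \<open>u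
  / v\<close> to \<open>a\<close> and \<open>b\<close>; the factors \<open>\<kappa>\<close> and
  \<open>\<mu>\<close> leave room to prescribe a third value.
\<close>

lemma prescribe_zero_forms:
  assumes "a \<noteq> b" "unwinds m u v" "\<And>z. poly u z \<noteq> 0 \<or> poly v z \<noteq> 0" "\<kappa> \<noteq> 0" "\<mu> \<noteq> 0"
  obtains p q where "unwinds m p q" "\<And>z. poly p z \<noteq> 0 \<or> poly q z \<noteq> 0"
    "zero_form a p q = smult \<kappa> u" "zero_form b p q = smult \<mu> v"
proof -
  define a1 a2 b1 b2 where "a1 = fst (homogeneous_coords a)" and "a2 = snd (homogeneous_coords a)"
    and "b1 = fst (homogeneous_coords b)" and "b2 = snd (homogeneous_coords b)"
  define \<Delta> where "\<Delta> = bracket a b"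
  have \<Delta>: "\<Delta> \<noteq> 0" "\<Delta> = a1 * b2 - a2 * b1"
    using bracket_nonzero[OF assms(1)] by (simp_all add: \<Delta>_def bracket_def a1_def a2_def b1_def b2_def)
  define p where "p = smult (1 / \<Delta>) (smult (a1 * \<mu>) v - smult (b1 * \<kappa>) u)"
  define q where "q = smult (1 / \<Delta>) (smult (a2 * \<mu>) v - smult (b2 * \<kappa>) u)"
  have forms: "zero_form a p q = smult \<kappa> u" "zero_form b p q = smult \<mu> v"
  proof -
    have "zero_form a p q = smult (1 / \<Delta>) (smult (\<Delta> * \<kappa>) u)"
      unfolding zero_form_def p_def q_def a1_def[symmetric] a2_def[symmetric] \<Delta>(2)
      by (rule poly_eqI) (simp add: algebra_simps)
    thus "zero_form a p q = smult \<kappa> u" using \<Delta>(1) by simp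
    have "zero_form b p q = smult (1 / \<Delta>) (smult (\<Delta> * \<mu>) v)"
      unfolding zero_form_def p_def q_def b1_def[symmetric] b2_def[symmetric] \<Delta>(2)
      by (rule poly_eqI) (simp add: algebra_simps)
    thus "zero_form b p q = smult \<mu> v" using \<Delta>(1) by simp
  qed
  have pz: "\<Delta> * poly p z = a1 * \<mu> * poly v z - b1 * \<kappa> * poly u z"
    and qz: "\<Delta> * poly q z = a2 * \<mu> * poly v z - b2 * \<kappa> * poly u z" for z
    using \<Delta>(1) by (simp_all add: p_def q_def)
  have nz: "poly p z \<noteq> 0 \<or> poly q z \<noteq> 0" for z
  proof (rule ccontr)
    assume *: "\<not> ?thesis"
    have "poly (zero_form a p q) z = 0" "poly (zero_form b p q) z = 0"
      using * by (simp_all add: zero_form_def)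
    thus False using assms(3)[of z] assms(4,5) by (simp add: forms)
  qed
  have "unwinds m p q"
  proof (rule unwindsI)
    fix U \<xi> assume r: "reachable m U \<xi>"
    have det: "(a2 * \<mu>) * (- (b1 * \<kappa>)) - (- (a1 * \<mu>)) * (b2 * \<kappa>) \<noteq> 0"
    proof -
      have "(a2 * \<mu>) * (- (b1 * \<kappa>)) - (- (a1 * \<mu>)) * (b2 * \<kappa>) = \<Delta> * (\<kappa> * \<mu>)"
        by (simp add: \<Delta>(2) algebra_simps)
      thus ?thesis using \<Delta>(1) assms(4,5) by simp
    qed
    obtain V1 where V1: "V1 \<subseteq> U"
      "reachable m V1 (\<lambda>x. (a2 * \<mu> * \<xi> x + (- (a1 * \<mu>))) / (b2 * \<kappa> * \<xi> x + (- (b1 * \<kappa>))))"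
      "\<And>x. x \<in> V1 \<Longrightarrow> b2 * \<kappa> * \<xi> x + (- (b1 * \<kappa>)) \<noteq> 0"
      by (rule reachable_moebius[OF r det]) (rule that)
    obtain V2 z where V2: "V2 \<subseteq> V1" "reachable m V2 z" "\<And>x. x \<in> V2 \<Longrightarrow> poly v (z x) \<noteq> 0"
      "\<And>x. x \<in> V2 \<Longrightarrow> poly u (z x) = ((a2 * \<mu> * \<xi> x + (- (a1 * \<mu>))) / (b2 * \<kappa> * \<xi> x + (- (b1 * \<kappa>)))) * poly v (z x)"
      by (rule unwindsE[OF assms(2) V1(2)]) (rule that)
    have "poly q (z x) \<noteq> 0 \<and> poly p (z x) = \<xi> x * poly q (z x)" if x: "x \<in> V2" for x
    proof -
      have x1: "x \<in> V1" using x V2(1) by blast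
      have "(b2 * \<kappa> * \<xi> x + (- (b1 * \<kappa>))) * poly u (z x) = (a2 * \<mu> * \<xi> x + (- (a1 * \<mu>))) * poly v (z x)"
        using V1(3)[OF x1] V2(4)[OF x] by simp
      moreover have "\<Delta> * (poly p (z x) - \<xi> x * poly q (z x)) =
          (b2 * \<kappa> * \<xi> x + (- (b1 * \<kappa>))) * poly u (z x) - (a2 * \<mu> * \<xi> x + (- (a1 * \<mu>))) * poly v (z x)"
        by (simp add: right_diff_distrib pz mult.left_commute[of \<Delta>] qz) (simp add: algebra_simps)
      ultimately have eq: "poly p (z x) = \<xi> x * poly q (z x)" using \<Delta>(1) by simp
      thus ?thesis using nz[of "z x"] by auto
    qed
    thus "\<exists>V z. V \<subseteq> U \<and> reachable m V z \<and> (\<forall>x\<in>V. poly q (z x) \<noteq> 0 \<and> poly p (z x) = \<xi> x * poly q (z x))"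
      using V1(1) V2(1,2) by (intro exI[of _ V2] exI[of _ z]) blast
  qed
  thus thesis using nz forms by (intro that) auto
qed

lemma uniformizes_two:
  assumes "a \<noteq> b" "r a = n" "r b = n" "n > 0"
  shows "\<exists>p q. uniformizes m {a, b} r p q"
proof -
  have nz: "poly ([:0, 1:] ^ n) z \<noteq> 0 \<or> poly 1 z \<noteq> 0" for z :: complex by simp
  obtain p q where pq: "unwinds m p q" "\<And>z. poly p z \<noteq> 0 \<or> poly q z \<noteq> 0"
    "zero_form a p q = smult 1 ([:0, 1:] ^ n)" "zero_form b p q = smult 1 1"
    by (rule prescribe_zero_forms[OF assms(1) unwinds_cyclic[OF assms(4)] nz one_neq_zero one_neq_zero]) (rule that)
  have pq4: "zero_form b p q = smult 1 (1 ^ n)" using pq(4) by (simp only: power_one)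
  have "power_up_to_scalar (r a) (zero_form a p q)" "power_up_to_scalar (r b) (zero_form b p q)"
    unfolding pq(3) pq4 assms(2,3) by (rule power_up_to_scalar_power)+
  hence "uniformizes m {a, b} r p q"
    unfolding uniformizes_def using pq(1,2) by blast
  thus ?thesis by blast
qed

text \<open>
  The scalars \<open>bracket c a\<close> and \<open>- bracket b c\<close> are those for which the
  dependence between the three forms turns the form over \<open>c\<close> into a multiple of
  \<open>u - v\<close>.
\<close>

lemma uniformizes_three:
  assumes "klein_triple m (r a) (r b) (r c) u v" "a \<noteq> b" "b \<noteq> c" "a \<noteq> c"
  shows "\<exists>p q. uniformizes m {a, b, c} r p q"
proof -
  have k: "unwinds m u v" "\<And>z. poly u z \<noteq> 0 \<or> poly v z \<noteq> 0" "power_up_to_scalar (r a) u"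
    "power_up_to_scalar (r b) v" "power_up_to_scalar (r c) (u - v)"
    using assms(1) unfolding klein_triple_def by auto
  have b1: "bracket c a \<noteq> 0" "- bracket b c \<noteq> 0" "bracket a b \<noteq> 0"
    using bracket_nonzero assms(2-4) by auto
  obtain p q where pq: "unwinds m p q" "\<And>z. poly p z \<noteq> 0 \<or> poly q z \<noteq> 0"
    "zero_form a p q = smult (bracket c a) u" "zero_form b p q = smult (- bracket b c) v"
    by (rule prescribe_zero_forms[OF assms(2) k(1,2) b1(1,2)]) (rule that)
  have "smult (bracket a b) (zero_form c p q) = smult (- (bracket b c * bracket c a)) (u - v)"
    using zero_form_dependence[of b c a p q] unfolding pq(3,4)
    by (simp add: algebra_simps smult_diff_right add_eq_0_iff)
  hence "smult (1 / bracket a b) (smult (bracket a b) (zero_form c p q)) =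
         smult (1 / bracket a b) (smult (- (bracket b c * bracket c a)) (u - v))" by (rule arg_cong)
  hence "zero_form c p q = smult (1 / bracket a b) (smult (- (bracket b c * bracket c a)) (u - v))"
    using b1(3) by simp
  hence "power_up_to_scalar (r c) (zero_form c p q)" using k(5) by (simp only: power_up_to_scalar_smult)
  hence "uniformizes m {a, b, c} r p q"
    unfolding uniformizes_def using pq k(3,4) by (simp add: power_up_to_scalar_smult del: smult_minus_left)
  thus ?thesis by blast
qed

section \<open>Spherical signatures\<close>

lemma card_three_sorted:
  fixes r :: "'a \<Rightarrow> nat"
  assumes "card A = 3"
  obtains a b c where "A = {a, b, c}" "a \<noteq> b" "b \<noteq> c" "a \<noteq> c" "r a \<le> r b" "r b \<le> r c"
proof -
  obtain x y z where A: "A = {x, y, z}" and d: "x \<noteq> y" "y \<noteq> z" "x \<noteq> z"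
    using assms unfolding card_3_iff by blast
  consider "r x \<le> r y" "r y \<le> r z" | "r x \<le> r z" "r z \<le> r y" | "r y \<le> r x" "r x \<le> r z"
    | "r y \<le> r z" "r z \<le> r x" | "r z \<le> r x" "r x \<le> r y" | "r z \<le> r y" "r y \<le> r x" by linarith
  thus thesis
  proof cases
    case 1 thus ?thesis using that[of x y z] A d by auto
  next
    case 2 thus ?thesis using that[of x z y] A d by auto
  next
    case 3 thus ?thesis using that[of y x z] A d by auto
  next
    case 4 thus ?thesis using that[of y z x] A d by auto
  next
    case 5 thus ?thesis using that[of z x y] A d by auto
  next
    case 6 thus ?thesis using that[of z y x] A d by auto
  qed
qed

lemma platonic_orders:
  fixes k l n :: nat
  assumes "2 \<le> k" "k \<le> l" "l \<le> n" "1 / real k + 1 / real l + 1 / real n > 1"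
  shows "k = 2 \<and> (l = 2 \<or> l = 3 \<and> n \<in> {3, 4, 5})"
proof -
  have inv: "1 / real y \<le> 1 / real x" if "0 < x" "x \<le> y" for x y :: nat
    using that by (intro divide_left_mono) auto
  have "k = 2"
  proof (rule ccontr)
    assume "k \<noteq> 2"
    hence "1 / real k \<le> 1 / 3" "1 / real l \<le> 1 / 3" "1 / real n \<le> 1 / 3"
      using inv[of 3 k] inv[of 3 l] inv[of 3 n] assms(1-3) by simp_all
    thus False using assms(4) by linarith
  qed
  moreover have "l \<le> 3"
  proof (rule ccontr)
    assume "\<not> l \<le> 3"
    hence "1 / real l \<le> 1 / 4" "1 / real n \<le> 1 / 4"
      using inv[of 4 l] inv[of 4 n] assms(3) by simp_all
    thus False using assms(4) \<open>k = 2\<close> by simp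
  qed
  moreover have "n \<le> 5" if "l = 3"
  proof (rule ccontr)
    assume "\<not> n \<le> 5"
    hence "1 / real n \<le> 1 / 6" using inv[of 6 n] by simp
    thus False using assms(4) \<open>k = 2\<close> \<open>l = 3\<close> by simp
  qed
  ultimately show ?thesis using assms(2,3) by auto
qed

theorem spherical_signature_uniformizable:
  assumes "card A \<ge> 2" "card A = 2 \<longrightarrow> (\<forall>a\<in>A. \<forall>b\<in>A. r a = r b)"
    and "\<And>a. a \<in> A \<Longrightarrow> r a \<ge> 2" "(\<Sum>a\<in>A. 1 - 1 / real (r a)) < 2"
    and m: "orders A r = {#2, 3, 5#} \<Longrightarrow> m \<ge> 5"
  shows "\<exists>p q. uniformizes m A r p q"
proof -
  have fin: "finite A" using assms(1) by (metis card.infinite not_numeral_le_zero)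
  have "real (card A) / 2 = (\<Sum>a\<in>A. 1 / 2)" by simp
  also have "\<dots> \<le> (\<Sum>a\<in>A. 1 - 1 / real (r a))"
  proof (rule sum_mono)
    fix a assume "a \<in> A"
    hence "1 / real (r a) \<le> 1 / 2" using assms(3)[of a] by (intro divide_left_mono) auto
    thus "1 / 2 \<le> 1 - 1 / real (r a)" by simp
  qed
  finally have "card A < 4" using assms(4) by linarith
  then consider "card A = 2" | "card A = 3" using assms(1) by linarith
  thus ?thesis
  proof cases
    case 1
    then obtain a b where ab: "A = {a, b}" "a \<noteq> b" unfolding card_2_iff by blast
    have in_A: "a \<in> A" "b \<in> A" unfolding ab(1) by simp_all
    have "r b = r a" using assms(2) 1 in_A by blast
    moreover have "r a > 0" using assms(3)[OF in_A(1)] by linarith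
    ultimately show ?thesis using uniformizes_two[OF ab(2) refl] unfolding ab(1) by blast
  next
    case 2
    obtain a b c where A: "A = {a, b, c}" "a \<noteq> b" "b \<noteq> c" "a \<noteq> c" "r a \<le> r b" "r b \<le> r c"
      by (rule card_three_sorted[OF 2]) (rule that)
    have "(\<Sum>x\<in>{a, b, c}. 1 - 1 / real (r x)) = (1 - 1 / real (r a)) + ((1 - 1 / real (r b)) + (1 - 1 / real (r c)))"
      using A(2-4) by (simp del: diff_gt_0_iff_gt)
    hence sum: "1 / real (r a) + 1 / real (r b) + 1 / real (r c) > 1"
      using assms(4)[unfolded A(1)] by linarith
    have "2 \<le> r a" using assms(3)[of a] unfolding A(1) by simp
    hence cases: "r a = 2 \<and> (r b = 2 \<or> r b = 3 \<and> r c \<in> {3, 4, 5})"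
      using A(5,6) sum by (rule platonic_orders)
    \<comment> \<open>the triples are stated with the orders \<open>(3, 3, 2)\<close> and \<open>(2, 5, 3)\<close>\<close>
    have perm: "{b, c, a} = A" "{a, c, b} = A" using A(1) by auto
    consider "r a = 2" "r b = 2" | "r a = 2" "r b = 3" "r c = 3" | "r a = 2" "r b = 3" "r c = 4"
      | "r a = 2" "r b = 3" "r c = 5" using cases by blast
    thus ?thesis
    proof cases
      case 1
      have "r c > 0" using assms(3)[of c] A(1) by simp
      from klein_triple_dihedral[OF this] obtain u v where "klein_triple m (r a) (r b) (r c) u v"
        unfolding 1 by blast
      from uniformizes_three[OF this A(2-4)] show ?thesis unfolding A(1) .
    next
      case 2
      have "klein_triple m (r b) (r c) (r a) (tet_face ^ 3) (tet_vertex ^ 3)"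
        unfolding 2 by (rule klein_triple_tetrahedral)
      from uniformizes_three[OF this A(3) A(4)[symmetric] A(2)[symmetric]] show ?thesis unfolding perm .
    next
      case 3
      from klein_triple_octahedral obtain u v where "klein_triple m (r a) (r b) (r c) u v"
        unfolding 3 by blast
      from uniformizes_three[OF this A(2-4)] show ?thesis unfolding A(1) .
    next
      case 4
      have "orders A r = {#2, 3, 5#}"
        using A(2-4) unfolding orders_def A(1) by (simp add: 4)
      hence "m \<ge> 5" by (rule m)
      then obtain u v where "klein_triple m (r a) (r c) (r b) u v"
        unfolding 4 by (rule klein_triple_icosahedral)
      from uniformizes_three[OF this A(4) A(3)[symmetric] A(2)] show ?thesis unfolding perm .
    qed
  qed
qed

section \<open>Rationality of single-valued algebraic functions\<close>

text \<open>
  Multiplication by a power of \<open>z - b\<close> for each singularity \<open>b\<close> makes the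
  function entire of polynomial growth, hence a polynomial by the theorem of Liouville.
\<close>

theorem rational_from_growth:
  fixes f :: "complex \<Rightarrow> complex"
  assumes "finite B" "f holomorphic_on - B"
    and poles: "\<And>b. b \<in> B \<Longrightarrow> \<exists>k. ((\<lambda>z. (z - b) ^ k * f z) \<longlongrightarrow> 0) (at b)"
    and growth: "\<And>z. norm z \<ge> R \<Longrightarrow> z \<notin> B \<Longrightarrow> norm (f z) \<le> C * norm z ^ n"
  obtains N L where "\<And>z. z \<notin> B \<Longrightarrow> poly L z \<noteq> 0" "\<And>z. z \<notin> B \<Longrightarrow> f z = poly N z / poly L z"
proof -
  have "\<forall>b\<in>B. \<exists>k. ((\<lambda>z. (z - b) ^ k * f z) \<longlongrightarrow> 0) (at b)" using poles by blast
  from bchoice[OF this] obtain k where k: "\<forall>b\<in>B. ((\<lambda>z. (z - b) ^ k b * f z) \<longlongrightarrow> 0) (at b)" ..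
  define L where "L = (\<Prod>b\<in>B. [:-b, 1:] ^ k b)"
  have L: "poly L z = (\<Prod>b\<in>B. (z - b) ^ k b)" for z
    by (simp add: L_def poly_prod poly_power)
  have L0: "poly L z \<noteq> 0" if "z \<notin> B" for z
    using that assms(1) by (auto simp: L)
  define g where "g z = (if z \<in> B then 0 else f z * poly L z)" for z
  have opB: "open (- B)" using assms(1) by (simp add: finite_imp_closed open_Compl)
  have fL: "(\<lambda>z. f z * poly L z) holomorphic_on - B"
    using assms(2) by (intro holomorphic_intros holomorphic_poly[unfolded eta_contract_eq])
  have "g field_differentiable at z" for z
  proof (cases "z \<in> B")
    case False
    have "g holomorphic_on - B" using fL by (rule holomorphic_transform) (simp add: g_def)
    thus ?thesis using False opB holomorphic_on_imp_differentiable_at by blast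
  next
    case True
    obtain d where d: "d > 0" "\<forall>x\<in>B. x \<noteq> z \<longrightarrow> d \<le> dist z x"
      using finite_set_avoid[OF assms(1), of z] by blast
    have ball: "ball z d \<inter> B = {z}" using d True by force
    have lim: "((\<lambda>y. f y * poly L y) \<longlongrightarrow> 0) (at z)"
    proof -
      have split: "poly L y = (y - z) ^ k z * (\<Prod>b\<in>B - {z}. (y - b) ^ k b)" for y
        unfolding L by (rule prod.remove[OF assms(1) True])
      have "((\<lambda>y. ((y - z) ^ k z * f y) * (\<Prod>b\<in>B - {z}. (y - b) ^ k b)) \<longlongrightarrow>
              0 * (\<Prod>b\<in>B - {z}. (z - b) ^ k b)) (at z)"
        using bspec[OF k True] by (intro tendsto_intros)
      thus ?thesis by (simp add: split mult_ac)
    qed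
    have "(\<lambda>y. f y * poly L y) holomorphic_on ball z d - {z}"
      by (rule holomorphic_on_subset[OF fL]) (use ball in blast)
    from removable_singularity[OF this open_ball lim]
    have "g holomorphic_on ball z d"
    proof (rule holomorphic_transform)
      fix y assume "y \<in> ball z d"
      hence "y \<in> B \<longleftrightarrow> y = z" using ball by blast
      thus "(if y = z then 0 else f y * poly L y) = g y" by (simp add: g_def)
    qed
    thus ?thesis using d(1) holomorphic_on_imp_differentiable_at[OF _ open_ball] by simp
  qed
  hence entire: "g holomorphic_on UNIV" by (simp add: holomorphic_on_def)
  define S where "S = (\<Sum>j\<le>degree L. norm (coeff L j))"
  have bounded: "norm (g z) \<le> (\<bar>C\<bar> * S) * norm z ^ (n + degree L)" if z: "max 1 R \<le> norm z" for z
  proof (cases "z \<in> B")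
    case True
    thus ?thesis by (simp add: g_def S_def sum_nonneg)
  next
    case False
    have "norm (poly L z) \<le> (\<Sum>j\<le>degree L. norm (coeff L j * z ^ j))"
      unfolding poly_altdef by (rule norm_sum)
    also have "\<dots> \<le> (\<Sum>j\<le>degree L. norm (coeff L j) * norm z ^ degree L)"
      using z by (intro sum_mono) (auto simp: norm_mult norm_power intro!: mult_left_mono power_increasing)
    also have "\<dots> = S * norm z ^ degree L" by (simp add: S_def sum_distrib_right)
    finally have Lb: "norm (poly L z) \<le> S * norm z ^ degree L" .
    have "norm (f z) \<le> \<bar>C\<bar> * norm z ^ n"
      using growth[of z] z False by (intro order.trans[OF growth] mult_right_mono) auto
    hence "norm (f z) * norm (poly L z) \<le> (\<bar>C\<bar> * norm z ^ n) * (S * norm z ^ degree L)"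
      using Lb by (intro mult_mono) auto
    thus ?thesis using False by (simp add: g_def norm_mult power_add mult_ac)
  qed
  have Liouville: "g z = (\<Sum>j\<le>n + degree L. (deriv ^^ j) g 0 / fact j * z ^ j)" for z
    by (rule Liouville_polynomial[OF entire bounded])
  define N where "N = (\<Sum>j\<le>n + degree L. monom ((deriv ^^ j) g 0 / fact j) j)"
  have N: "poly N z = g z" for z
    unfolding Liouville[of z] by (simp add: N_def poly_sum poly_monom)
  show thesis
  proof (rule that[of L N])
    fix z assume z: "z \<notin> B"
    show "poly L z \<noteq> 0" using L0[OF z] .
    show "f z = poly N z / poly L z" using L0[OF z] z by (simp add: N g_def)
  qed
qed

lemma monic_root_bound:
  fixes w :: complex
  assumes "d > 0" "w ^ d + (\<Sum>i<d. e i * w ^ i) = 0"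
  shows "norm w \<le> 1 + (\<Sum>i<d. norm (e i))"
proof (cases "norm w \<le> 1")
  case True
  have "0 \<le> (\<Sum>i<d. norm (e i))" by (rule sum_nonneg) simp
  thus ?thesis using True by linarith
next
  case False
  have "norm w ^ d = norm (\<Sum>i<d. e i * w ^ i)"
    using assms(2) by (metis add_eq_0_iff norm_minus_cancel norm_power)
  also have "\<dots> \<le> (\<Sum>i<d. norm (e i * w ^ i))" by (rule norm_sum)
  also have "\<dots> \<le> (\<Sum>i<d. norm (e i) * norm w ^ (d - 1))"
    using False by (intro sum_mono) (auto simp: norm_mult norm_power intro!: mult_left_mono power_increasing)
  also have "\<dots> = (\<Sum>i<d. norm (e i)) * norm w ^ (d - 1)" by (simp add: sum_distrib_right)
  finally have le: "norm w ^ d \<le> (\<Sum>i<d. norm (e i)) * norm w ^ (d - 1)" .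
  have "norm w ^ d = norm w * norm w ^ (d - 1)" using assms(1) by (simp add: power_eq_if)
  with le have "norm w * norm w ^ (d - 1) \<le> (\<Sum>i<d. norm (e i)) * norm w ^ (d - 1)" by simp
  moreover have "norm w > 0" using False by linarith
  hence "norm w ^ (d - 1) > 0" by simp
  ultimately have "norm w \<le> (\<Sum>i<d. norm (e i))" by (rule mult_right_le_imp_le)
  thus ?thesis by simp
qed

text \<open>
  Multiplied by the leading coefficient \<open>a d\<close>, the function \<open>h\<close> satisfies
  a monic equation with polynomial coefficients. The roots of a monic polynomial are bounded by its
  coefficients, so the product is bounded near the points of \<open>B\<close> and of polynomial
  growth at infinity.
\<close>

lemma algebraic_over_polynomials_rational:
  fixes a :: "nat \<Rightarrow> complex poly" and h :: "complex \<Rightarrow> complex"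
  assumes "finite B" "h holomorphic_on - B" "d > 0"
    and lead: "\<And>z. z \<notin> B \<Longrightarrow> poly (a d) z \<noteq> 0"
    and eq: "\<And>z. z \<notin> B \<Longrightarrow> (\<Sum>i\<le>d. poly (a i) z * h z ^ i) = 0"
  obtains N L where "\<And>z. z \<notin> B \<Longrightarrow> poly L z \<noteq> 0" "\<And>z. z \<notin> B \<Longrightarrow> h z = poly N z / poly L z"
proof -
  \<comment> \<open>the coefficients of the monic equation for \<open>f = a d * h\<close>\<close>
  define e where "e i = a i * a d ^ (d - 1 - i)" for i
  define f where "f z = poly (a d) z * h z" for z
  define M where "M z = 1 + (\<Sum>i<d. norm (poly (e i) z))" for z
  have bound: "norm (f z) \<le> M z" if z: "z \<notin> B" for z
    unfolding M_def
  proof (rule monic_root_bound[OF assms(3)])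
    let ?l = "poly (a d) z"
    have "0 = ?l ^ (d - 1) * (\<Sum>i\<le>d. poly (a i) z * h z ^ i)" using eq[OF z] by simp
    also have "{..d} = insert d {..<d}" by auto
    also have "?l ^ (d - 1) * (\<Sum>i\<in>insert d {..<d}. poly (a i) z * h z ^ i) =
       ?l ^ (d - 1) * (?l * h z ^ d) + (\<Sum>i<d. ?l ^ (d - 1) * (poly (a i) z * h z ^ i))"
      by (simp add: distrib_left sum_distrib_left)
    also have "?l ^ (d - 1) * (?l * h z ^ d) = f z ^ d"
      using assms(3) by (cases d) (simp_all add: f_def power_mult_distrib mult_ac)
    also have "(\<Sum>i<d. ?l ^ (d - 1) * (poly (a i) z * h z ^ i)) = (\<Sum>i<d. poly (e i) z * f z ^ i)"
    proof (rule sum.cong[OF refl])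
      fix i assume "i \<in> {..<d}"
      hence "?l ^ (d - 1) = ?l ^ (d - 1 - i) * ?l ^ i" by (simp flip: power_add)
      thus "?l ^ (d - 1) * (poly (a i) z * h z ^ i) = poly (e i) z * f z ^ i"
        by (simp add: e_def f_def poly_power power_mult_distrib mult_ac)
    qed
    finally show "f z ^ d + (\<Sum>i<d. poly (e i) z * f z ^ i) = 0" by simp
  qed
  have fh: "f holomorphic_on - B"
    unfolding f_def using assms(2) holomorphic_poly by (intro holomorphic_on_mult) auto
  have M_cont: "isCont M z" for z unfolding M_def by (intro continuous_intros)
  have opB: "open (- B)" using assms(1) by (simp add: finite_imp_closed open_Compl)
  have poles: "\<exists>k. ((\<lambda>z. (z - b) ^ k * f z) \<longlongrightarrow> 0) (at b)" if b: "b \<in> B" for b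
  proof -
    obtain r where r: "r > 0" "\<forall>x\<in>B. x \<noteq> b \<longrightarrow> r \<le> dist b x"
      using finite_set_avoid[OF assms(1), of b] by blast
    have "\<forall>\<^sub>F z in at b. dist z b < r" using r(1) by (auto simp: eventually_at)
    moreover have "\<forall>\<^sub>F z in at b. z \<noteq> b" by (simp add: eventually_at_filter)
    ultimately have ev: "\<forall>\<^sub>F z in at b. norm ((z - b) ^ 1 * f z) \<le> norm (z - b) * M z"
    proof eventually_elim
      case (elim z)
      hence "z \<notin> B" using r(2) by (auto simp: dist_commute)
      thus ?case using bound[of z] by (simp add: norm_mult mult_left_mono)
    qed
    have "((\<lambda>z. norm (z - b) * M z) \<longlongrightarrow> norm (b - b) * M b) (at b)"
      using M_cont[of b] unfolding isCont_def by (intro tendsto_intros)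
    hence "((\<lambda>z. norm (z - b) * M z) \<longlongrightarrow> 0) (at b)" by simp
    hence "((\<lambda>z. (z - b) ^ 1 * f z) \<longlongrightarrow> 0) (at b)" by (rule Lim_null_comparison[OF ev])
    thus ?thesis by blast
  qed
  define n where "n = (\<Sum>i<d. degree (e i))"
  define C where "C = 1 + (\<Sum>i<d. \<Sum>j\<le>degree (e i). norm (coeff (e i) j))"
  have growth: "norm (f z) \<le> C * norm z ^ n" if z: "1 \<le> norm z" "z \<notin> B" for z
  proof -
    have "norm (poly (e i) z) \<le> (\<Sum>j\<le>degree (e i). norm (coeff (e i) j)) * norm z ^ n" if "i < d" for i
    proof -
      have dn: "degree (e i) \<le> n" unfolding n_def using that by (intro member_le_sum) auto
      have "norm (poly (e i) z) \<le> (\<Sum>j\<le>degree (e i). norm (coeff (e i) j * z ^ j))"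
        unfolding poly_altdef by (rule norm_sum)
      also have "\<dots> \<le> (\<Sum>j\<le>degree (e i). norm (coeff (e i) j) * norm z ^ n)"
        using z(1) dn by (intro sum_mono) (auto simp: norm_mult norm_power intro!: mult_left_mono power_increasing)
      finally show ?thesis by (simp add: sum_distrib_right)
    qed
    hence "(\<Sum>i<d. norm (poly (e i) z)) \<le> (\<Sum>i<d. (\<Sum>j\<le>degree (e i). norm (coeff (e i) j)) * norm z ^ n)"
      by (intro sum_mono) auto
    moreover have "1 \<le> norm z ^ n" using z(1) by simp
    ultimately have "M z \<le> C * norm z ^ n"
      unfolding M_def C_def by (simp add: distrib_right sum_distrib_right)
    thus ?thesis using bound[OF z(2)] by simp
  qed
  show thesis
  proof (rule rational_from_growth[OF assms(1) fh, where R = 1 and C = C and n = n])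
    show "\<exists>k. ((\<lambda>z. (z - b) ^ k * f z) \<longlongrightarrow> 0) (at b)" if "b \<in> B" for b using poles[OF that] .
    show "norm (f z) \<le> C * norm z ^ n" if "1 \<le> norm z" "z \<notin> B" for z using growth[OF that] .
    fix N L assume NL: "\<And>z. z \<notin> B \<Longrightarrow> poly L z \<noteq> 0" "\<And>z. z \<notin> B \<Longrightarrow> f z = poly N z / poly L z"
    show thesis
    proof (rule that[of "L * a d" N])
      fix z assume z: "z \<notin> B"
      show "poly (L * a d) z \<noteq> 0" using NL(1)[OF z] lead[OF z] by simp
      have "h z = f z / poly (a d) z" using lead[OF z] by (simp add: f_def)
      thus "h z = poly N z / poly (L * a d) z" by (simp add: NL(2)[OF z])
    qed
  qed
qed

section \<open>Pulling the algebraic function back\<close>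

text \<open>
  The rational function \<open>p / q\<close> takes infinitely many values, since it has a right
  inverse on a nonempty open set.
\<close>

lemma unwinds_distinct:
  assumes "unwinds m p q"
  shows "q \<noteq> 0" "p - smult b q \<noteq> 0"
proof -
  have "reachable m UNIV (\<lambda>x. x)" by (rule reachable_id) auto
  then obtain V z where V: "reachable m V z" "\<And>x. x \<in> V \<Longrightarrow> poly q (z x) \<noteq> 0"
      "\<And>x. x \<in> V \<Longrightarrow> poly p (z x) = x * poly q (z x)"
    by (rule unwindsE[OF assms]) (rule that)
  have "open V" "V \<noteq> {}" using V(1) by (auto simp: reachable_def)
  hence inf: "infinite V" using finite_imp_not_open by blast
  show "q \<noteq> 0" using \<open>V \<noteq> {}\<close> V(2) by auto
  show "p - smult b q \<noteq> 0"
  proof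
    assume "p - smult b q = 0"
    hence "x = b" if "x \<in> V" for x using V(2,3)[OF that] by auto
    hence "V \<subseteq> {b}" by auto
    thus False using inf finite_subset by blast
  qed
qed

lemma zero_form_nonzero: "unwinds m p q \<Longrightarrow> zero_form a p q \<noteq> 0"
  using unwinds_distinct[of m p q] by (cases a) (auto simp: zero_form_def)

context algebraic_fibers begin

definition pulled_back_bad :: "complex poly \<Rightarrow> complex poly \<Rightarrow> complex set" where
  "pulled_back_bad p q = {z. poly q z = 0} \<union> (\<Union>b\<in>B. {z. poly (p - smult b q) z = 0})"

lemma finite_pulled_back_bad: "unwinds m p q \<Longrightarrow> finite (pulled_back_bad p q)"
  unfolding pulled_back_bad_def using finite_B
  by (intro finite_UnI finite_UN_I poly_roots_finite unwinds_distinct)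

lemma pulled_back_good:
  assumes "z \<notin> pulled_back_bad p q"
  shows "poly q z \<noteq> 0" "poly p z / poly q z \<notin> B"
proof -
  show q: "poly q z \<noteq> 0" using assms by (simp add: pulled_back_bad_def)
  show "poly p z / poly q z \<notin> B"
  proof
    assume "poly p z / poly q z \<in> B"
    moreover have "poly (p - smult (poly p z / poly q z) q) z = 0" using q by simp
    ultimately show False using assms unfolding pulled_back_bad_def by blast
  qed
qed

text \<open>
  Near a point with good image the branches are those over the image, composed with \<open>p /
  q\<close>.
\<close>

lemma pullback_splits_at_good_point:
  assumes z0: "z0 \<notin> pulled_back_bad p q"
  shows "\<exists>\<epsilon>>0. \<exists>G. splits_over (\<lambda>z. roots (poly p z / poly q z)) (ball z0 \<epsilon> - pulled_back_bad p q) G"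
proof -
  define \<Phi> where "\<Phi> z = poly p z / poly q z" for z
  obtain \<epsilon> G where G: "\<epsilon> > 0" "finite G" "ball (\<Phi> z0) \<epsilon> \<inter> B = {}"
    "\<And>g. g \<in> G \<Longrightarrow> g holomorphic_on ball (\<Phi> z0) \<epsilon>"
    "\<And>x. x \<in> ball (\<Phi> z0) \<epsilon> \<Longrightarrow> roots x = (\<lambda>g. g x) ` G"
    by (rule local_sections[OF pulled_back_good(2)[OF z0, folded \<Phi>_def]]) (rule that)
  have "isCont \<Phi> z0"
    unfolding \<Phi>_def using pulled_back_good(1)[OF z0] by (intro continuous_intros)
  then obtain \<delta> where \<delta>: "\<delta> > 0" "\<Phi> ` ball z0 \<delta> \<subseteq> ball (\<Phi> z0) \<epsilon>"
    using G(1) unfolding continuous_at_ball by blast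
  have hol: "\<Phi> holomorphic_on ball z0 \<delta> - pulled_back_bad p q"
    unfolding \<Phi>_def using pulled_back_good(1) by (intro holomorphic_intros holomorphic_poly[unfolded eta_contract_eq]) auto
  have "splits_over (\<lambda>z. roots (\<Phi> z)) (ball z0 \<delta> - pulled_back_bad p q) ((\<lambda>g. g \<circ> \<Phi>) ` G)"
    unfolding splits_over_def
  proof (intro conjI ballI)
    show "finite ((\<lambda>g. g \<circ> \<Phi>) ` G)" using G(2) by simp
    show "roots (\<Phi> z) = (\<lambda>h. h z) ` ((\<lambda>g. g \<circ> \<Phi>) ` G)" if "z \<in> ball z0 \<delta> - pulled_back_bad p q" for z
    proof -
      have "\<Phi> z \<in> ball (\<Phi> z0) \<epsilon>" using that \<delta>(2) by blast
      thus ?thesis using G(5) by (simp add: image_image)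
    qed
    fix h assume "h \<in> (\<lambda>g. g \<circ> \<Phi>) ` G"
    then obtain g where g: "g \<in> G" "h = g \<circ> \<Phi>" by blast
    have "\<Phi> ` (ball z0 \<delta> - pulled_back_bad p q) \<subseteq> ball (\<Phi> z0) \<epsilon>" using \<delta>(2) by blast
    thus "h holomorphic_on ball z0 \<delta> - pulled_back_bad p q"
      unfolding g(2) by (rule holomorphic_on_compose_gen[OF hol G(4)[OF g(1)]])
  qed
  thus ?thesis using \<delta>(1) unfolding \<Phi>_def by blast
qed

text \<open>
  The heart of the argument. The local coordinate of \<open>p / q\<close> at the image point
  \<open>a\<close> is, up to a unit, a form that is a \<open>k\<close>-th power, so it is the
  \<open>k\<close>-th power of a holomorphic function \<open>\<xi>\<close>. Over a
  \<open>k\<close>-th root of the coordinate the branches are single-valued, and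
  \<open>\<xi>\<close> supplies such a root.
\<close>

lemma pullback_splits_at_bad_point:
  assumes z0: "z0 \<in> pulled_back_bad p q" and "unwinds m p q" and cop: "poly p z0 \<noteq> 0 \<or> poly q z0 \<noteq> 0"
    and powers: "\<And>a k. local_monodromy_order P a k \<Longrightarrow> power_up_to_scalar k (zero_form a p q)"
  shows "\<exists>\<epsilon>>0. \<exists>G. splits_over (\<lambda>z. roots (poly p z / poly q z)) (ball z0 \<epsilon> - pulled_back_bad p q) G"
proof -
  define a where "a = (if poly q z0 = 0 then None else Some (poly p z0 / poly q z0))"
  \<comment> \<open>the unit by which the form and the local coordinate differ; it takes care of the two kinds of points \<open>a\<close>\<close>
  define M where "M = (if poly q z0 = 0 then - p else q)"
  have Mz0: "poly M z0 \<noteq> 0" using cop by (auto simp: M_def)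
  have form0: "poly (zero_form a p q) z0 = 0" by (simp add: zero_form_def a_def)
  have coord: "sphere_coordinate a (poly (zero_form a p q) z / poly M z) = poly p z / poly q z"
    if "poly q z \<noteq> 0" for z
    using that by (simp add: a_def M_def zero_form_def field_simps)
  have form_bad: "z \<in> pulled_back_bad p q" if "poly (zero_form a p q) z = 0" for z
  proof (cases "poly q z0 = 0")
    case True
    thus ?thesis using that by (simp add: a_def zero_form_def pulled_back_bad_def)
  next
    case False
    then obtain b where b: "b \<in> B" "poly (p - smult b q) z0 = 0" using z0 by (auto simp: pulled_back_bad_def)
    hence "poly p z0 / poly q z0 = b" using False by (simp add: field_simps)
    hence "poly (p - smult b q) z = 0" using that False by (simp add: a_def zero_form_def)
    thus ?thesis using b(1) unfolding pulled_back_bad_def by blast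
  qed
  obtain k \<rho> Y where k: "k > 0" "local_monodromy_order P a k" and \<rho>: "\<rho> > 0"
    and good: "\<And>s. norm s < \<rho> \<Longrightarrow> s \<noteq> 0 \<Longrightarrow> sphere_coordinate a (s ^ k) \<notin> B"
    and Y: "splits_over (\<lambda>s. fiber P (sphere_coordinate a (s ^ k))) (ball 0 \<rho> - {0}) Y"
    by (rule fiber_uniformization[of a]) (rule that)
  obtain c X where X: "zero_form a p q = smult c (X ^ k)"
    using powers[OF k(2)] unfolding power_up_to_scalar_def by blast
  have c: "c \<noteq> 0" using zero_form_nonzero[OF assms(2), of a] X by auto
  obtain \<delta>1 where \<delta>1: "\<delta>1 > 0" "\<And>z. z \<in> ball z0 \<delta>1 \<Longrightarrow> poly M z \<noteq> 0"
    using continuous_at_avoid[of z0 "poly M" 0] Mz0 by (auto simp: dist_commute)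
  have "(\<lambda>z. c / poly M z) holomorphic_on ball z0 \<delta>1"
    using \<delta>1(2) by (intro holomorphic_intros holomorphic_poly[unfolded eta_contract_eq]) auto
  moreover have "c / poly M z \<noteq> 0" if "z \<in> ball z0 \<delta>1" for z using \<delta>1(2)[OF that] c by simp
  ultimately obtain g where g: "g holomorphic_on ball z0 \<delta>1" "\<And>z. z \<in> ball z0 \<delta>1 \<Longrightarrow> c / poly M z = exp (g z)"
    using contractible_imp_holomorphic_log[of "\<lambda>z. c / poly M z" "ball z0 \<delta>1"] convex_imp_contractible[OF convex_ball] by blast
  \<comment> \<open>a local \<open>k\<close>-th root of the coordinate of the image point\<close>
  define \<xi> where "\<xi> z = poly X z * exp (g z / of_nat k)" for z
  have \<xi>_pow: "\<xi> z ^ k = poly (zero_form a p q) z / poly M z" if "z \<in> ball z0 \<delta>1" for z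
  proof -
    have "\<xi> z ^ k = poly X z ^ k * exp (g z)"
      using k(1) by (simp add: \<xi>_def power_mult_distrib exp_of_nat_mult[symmetric])
    thus ?thesis unfolding g(2)[OF that, symmetric] X by (simp add: poly_power)
  qed
  have \<xi>_hol: "\<xi> holomorphic_on ball z0 \<delta>1"
    unfolding \<xi>_def using g(1) k(1)
    by (intro holomorphic_intros holomorphic_poly[unfolded eta_contract_eq]) auto
  have "isCont \<xi> z0"
    using holomorphic_on_imp_continuous_on[OF \<xi>_hol] \<delta>1(1) by (simp add: continuous_on_eq_continuous_at)
  then obtain \<delta>2 where \<delta>2: "\<delta>2 > 0" "\<xi> ` ball z0 \<delta>2 \<subseteq> ball (\<xi> z0) \<rho>"
    using \<rho> unfolding continuous_at_ball by blast
  have "\<xi> z0 ^ k = 0" using \<xi>_pow[of z0] \<delta>1(1) form0 by simp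
  hence \<xi>0: "\<xi> z0 = 0" by simp
  define \<delta> where "\<delta> = min \<delta>1 \<delta>2"
  have \<delta>: "\<delta> > 0" "ball z0 \<delta> \<subseteq> ball z0 \<delta>1" "ball z0 \<delta> \<subseteq> ball z0 \<delta>2" using \<delta>1 \<delta>2 by (auto simp: \<delta>_def)
  have \<xi>_in: "\<xi> z \<in> ball 0 \<rho> - {0}" if z: "z \<in> ball z0 \<delta> - pulled_back_bad p q" for z
  proof -
    have "z \<in> ball z0 \<delta>1" using z \<delta>(2) by blast
    hence "\<xi> z ^ k \<noteq> 0" using form_bad[of z] z \<xi>_pow \<delta>1(2) by auto
    hence "\<xi> z \<noteq> 0" using k(1) by auto
    moreover have "\<xi> z \<in> ball 0 \<rho>"
    proof -
      have "\<xi> z \<in> \<xi> ` ball z0 \<delta>2" using z \<delta>(3) by blast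
      thus ?thesis using \<delta>2(2) unfolding \<xi>0 by blast
    qed
    ultimately show ?thesis by simp
  qed
  have "splits_over (\<lambda>z. roots (poly p z / poly q z)) (ball z0 \<delta> - pulled_back_bad p q) ((\<lambda>y. y \<circ> \<xi>) ` Y)"
    unfolding splits_over_def
  proof (intro conjI ballI)
    show "finite ((\<lambda>y. y \<circ> \<xi>) ` Y)" using Y by (simp add: splits_over_def)
    fix z assume z: "z \<in> ball z0 \<delta> - pulled_back_bad p q"
    have z1: "z \<in> ball z0 \<delta>1" using z \<delta>(2) by blast
    have zg: "z \<notin> pulled_back_bad p q" using z by blast
    have "poly p z / poly q z = sphere_coordinate a (\<xi> z ^ k)"
      using coord[OF pulled_back_good(1)[OF zg]] \<xi>_pow[OF z1] by simp
    moreover have "roots (poly p z / poly q z) = fiber P (poly p z / poly q z)"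
      using fiber_eq[OF pulled_back_good(2)[OF zg]] by simp
    moreover have "fiber P (sphere_coordinate a (\<xi> z ^ k)) = (\<lambda>y. y (\<xi> z)) ` Y"
      using Y \<xi>_in[OF z] unfolding splits_over_def by blast
    ultimately show "roots (poly p z / poly q z) = (\<lambda>h. h z) ` ((\<lambda>y. y \<circ> \<xi>) ` Y)"
      by (simp add: image_image)
  next
    fix h assume "h \<in> (\<lambda>y. y \<circ> \<xi>) ` Y"
    then obtain y where y: "y \<in> Y" "h = y \<circ> \<xi>" by blast
    have y_hol: "y holomorphic_on ball 0 \<rho> - {0}" using Y y(1) by (simp add: splits_over_def)
    have \<xi>_hol': "\<xi> holomorphic_on ball z0 \<delta> - pulled_back_bad p q"
      by (rule holomorphic_on_subset[OF \<xi>_hol]) (use \<delta>(2) in blast)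
    have \<xi>_image: "\<xi> ` (ball z0 \<delta> - pulled_back_bad p q) \<subseteq> ball 0 \<rho> - {0}"
      by (rule image_subsetI) (rule \<xi>_in)
    show "h holomorphic_on ball z0 \<delta> - pulled_back_bad p q"
      using holomorphic_on_compose_gen[OF \<xi>_hol' y_hol \<xi>_image] by (simp only: y(2))
  qed
  thus ?thesis using \<delta>(1) by blast
qed

lemma pullback_splits:
  assumes "unwinds m p q" "\<And>z. poly p z \<noteq> 0 \<or> poly q z \<noteq> 0"
    and "\<And>a k. local_monodromy_order P a k \<Longrightarrow> power_up_to_scalar k (zero_form a p q)"
  shows "\<exists>H. splits_over (\<lambda>z. roots (poly p z / poly q z)) (- pulled_back_bad p q) H"
proof -
  have "locally_split (\<lambda>z. roots (poly p z / poly q z)) UNIV (pulled_back_bad p q)"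
  proof
    show "finite (pulled_back_bad p q)" by (rule finite_pulled_back_bad[OF assms(1)])
    fix z0 :: complex
    have "\<exists>\<epsilon>>0. \<exists>G. splits_over (\<lambda>z. roots (poly p z / poly q z)) (ball z0 \<epsilon> - pulled_back_bad p q) G"
      using pullback_splits_at_good_point pullback_splits_at_bad_point[OF _ assms(1,2,3)] by blast
    thus "\<exists>\<epsilon>>0. \<exists>G. ball z0 \<epsilon> \<subseteq> UNIV \<and>
        splits_over (\<lambda>z. roots (poly p z / poly q z)) (ball z0 \<epsilon> - pulled_back_bad p q) G" by simp
  qed auto
  thus ?thesis unfolding Compl_eq_Diff_UNIV by (rule locally_split.split_globally)
qed

text \<open>
  Substituting \<open>p / q\<close> into the coefficients of \<open>Q\<close> and clearing
  denominators by \<open>q ^ D\<close> gives an equation with polynomial coefficients.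
\<close>

lemma pulled_back_section_rational:
  assumes "unwinds m p q" "section_over (\<lambda>z. roots (poly p z / poly q z)) (- pulled_back_bad p q) h"
  obtains N L where "\<And>z. z \<notin> pulled_back_bad p q \<Longrightarrow> poly L z \<noteq> 0"
    "\<And>z. z \<notin> pulled_back_bad p q \<Longrightarrow> h z = poly N z / poly L z"
proof -
  define D where "D = (\<Sum>i\<le>degree Q. degree (coeff Q i))"
  \<comment> \<open>\<open>q ^ D\<close> times the \<open>i\<close>-th coefficient of \<open>Q\<close> at \<open>p / q\<close>\<close>
  define e where "e i = (\<Sum>j\<le>degree (coeff Q i). smult (coeff (coeff Q i) j) (p ^ j * q ^ (D - j)))" for i
  have e: "poly (e i) z = poly q z ^ D * poly (coeff Q i) (poly p z / poly q z)"
    if "i \<le> degree Q" "poly q z \<noteq> 0" for i z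
  proof -
    have dD: "degree (coeff Q i) \<le> D" unfolding D_def using that(1) by (intro member_le_sum) auto
    have "poly q z ^ D * poly (coeff Q i) (poly p z / poly q z) =
      (\<Sum>j\<le>degree (coeff Q i). coeff (coeff Q i) j * (poly q z ^ D * (poly p z / poly q z) ^ j))"
      unfolding poly_altdef[of "coeff Q i"] sum_distrib_left by (intro sum.cong refl) (simp add: mult_ac)
    also have "\<dots> = (\<Sum>j\<le>degree (coeff Q i). coeff (coeff Q i) j * (poly p z ^ j * poly q z ^ (D - j)))"
    proof (rule sum.cong[OF refl])
      fix j assume "j \<in> {..degree (coeff Q i)}"
      hence "poly q z ^ D = poly q z ^ j * poly q z ^ (D - j)" using dD by (simp flip: power_add)
      hence "poly q z ^ D * (poly p z / poly q z) ^ j = poly p z ^ j * poly q z ^ (D - j)"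
        using that(2) by (simp add: power_divide)
      thus "coeff (coeff Q i) j * (poly q z ^ D * (poly p z / poly q z) ^ j) =
            coeff (coeff Q i) j * (poly p z ^ j * poly q z ^ (D - j))" by simp
    qed
    also have "\<dots> = poly (e i) z" by (simp add: e_def poly_sum poly_power)
    finally show ?thesis by simp
  qed
  have hol: "h holomorphic_on - pulled_back_bad p q" using assms(2) by (simp add: section_over_def)
  have lead: "poly (e (degree Q)) z \<noteq> 0" if z: "z \<notin> pulled_back_bad p q" for z
    using e[OF order.refl pulled_back_good(1)[OF z]] pulled_back_good[OF z] lead_nonzero by simp
  have eq: "(\<Sum>i\<le>degree Q. poly (e i) z * h z ^ i) = 0" if z: "z \<notin> pulled_back_bad p q" for z
  proof -
    have "h z \<in> roots (poly p z / poly q z)" using assms(2) z by (simp add: section_over_def)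
    hence "0 = poly q z ^ D * bipoly Q (poly p z / poly q z) (h z)" by (simp add: roots_def)
    also have "\<dots> = (\<Sum>i\<le>degree Q. poly (e i) z * h z ^ i)"
      unfolding bipoly_altdef sum_distrib_left
      by (intro sum.cong refl) (simp add: e[OF _ pulled_back_good(1)[OF z]] mult_ac)
    finally show ?thesis by simp
  qed
  show thesis
    by (rule algebraic_over_polynomials_rational[OF finite_pulled_back_bad[OF assms(1)] hol degree_pos, of e])
       (fact lead, fact eq, rule that)
qed

text \<open>
  If \<open>\<sigma>\<close> is an obtainable branch of the inverse of \<open>p / q\<close>, then
  \<open>f\<close> coincides with \<open>h \<circ> \<sigma>\<close> for one of the finitely many
  pulled back branches \<open>h\<close>, and \<open>h\<close> is rational.
\<close>

theorem uniformized_imp_representable: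
  assumes "unwinds m p q" "\<And>z. poly p z \<noteq> 0 \<or> poly q z \<noteq> 0"
    and "\<And>a k. local_monodromy_order P a k \<Longrightarrow> power_up_to_scalar k (zero_form a p q)"
    and finite_coeffs: "\<And>x. x \<notin> B \<Longrightarrow> coeffs_finite_at P x"
  shows "representable m P"
  unfolding representable_def
proof (intro allI impI)
  fix D f assume "is_branch P D f"
  hence D: "open D" "connected D" "D \<noteq> {}" "f holomorphic_on D"
    "\<And>x. x \<in> D \<Longrightarrow> coeffs_finite_at P x \<Longrightarrow> f x \<in> fiber P x"
    unfolding is_branch_def by auto
  obtain H where H: "splits_over (\<lambda>z. roots (poly p z / poly q z)) (- pulled_back_bad p q) H"
    using pullback_splits[OF assms(1-3)] by blast
  have "reachable m D (\<lambda>x. x)" using D(1-3) by (rule reachable_id)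
  then obtain U0 where U0: "U0 \<subseteq> D" "reachable m U0 (\<lambda>x. x)" "\<And>x. x \<in> U0 \<Longrightarrow> x \<notin> B"
    using finite_B by (rule reachable_avoiding) (rule that)
  obtain U \<sigma> where U: "U \<subseteq> U0" "reachable m U \<sigma>" "\<And>x. x \<in> U \<Longrightarrow> poly q (\<sigma> x) \<noteq> 0"
    "\<And>x. x \<in> U \<Longrightarrow> poly p (\<sigma> x) = x * poly q (\<sigma> x)"
    by (rule unwindsE[OF assms(1) U0(2)]) (rule that)
  have UB: "x \<notin> B" "x \<in> D" if "x \<in> U" for x using U0(1,3) U(1) that by blast+
  have right_inverse: "poly p (\<sigma> x) / poly q (\<sigma> x) = x" if "x \<in> U" for x using U(3,4)[OF that] by simp
  have \<sigma>_good: "\<sigma> x \<in> - pulled_back_bad p q" if x: "x \<in> U" for x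
  proof
    assume "\<sigma> x \<in> pulled_back_bad p q"
    then obtain b where "b \<in> B" "poly (p - smult b q) (\<sigma> x) = 0"
      using U(3)[OF x] by (auto simp: pulled_back_bad_def)
    hence "x = b" using U(3,4)[OF x] by simp
    thus False using UB(1)[OF x] \<open>b \<in> B\<close> by simp
  qed
  have \<sigma>: "\<sigma> holomorphic_on U" "open U" "connected U" "U \<noteq> {}" "obtainable m U \<sigma>"
    using reachable_holomorphic[OF U(2)] U(2) by (auto simp: reachable_def)
  have f: "f holomorphic_on U" using D(4) by (rule holomorphic_on_subset) (use UB in blast)
  have "\<exists>g\<in>(\<lambda>h. h \<circ> \<sigma>) ` H. \<forall>x\<in>U. f x = g x"
  proof (rule holomorphic_selection[OF \<sigma>(2-4) _ f])
    show "finite ((\<lambda>h. h \<circ> \<sigma>) ` H)" using H by (simp add: splits_over_def)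
    show "g holomorphic_on U" if "g \<in> (\<lambda>h. h \<circ> \<sigma>) ` H" for g
    proof -
      obtain h where h: "h \<in> H" "g = h \<circ> \<sigma>" using \<open>g \<in> _\<close> by blast
      have "h holomorphic_on - pulled_back_bad p q" using H h(1) by (simp add: splits_over_def)
      moreover have "\<sigma> ` U \<subseteq> - pulled_back_bad p q" using \<sigma>_good by blast
      ultimately show ?thesis unfolding h(2) by (rule holomorphic_on_compose_gen[OF \<sigma>(1)])
    qed
    fix x assume x: "x \<in> U"
    have "f x \<in> roots x"
      using D(5)[OF UB(2)[OF x] finite_coeffs[OF UB(1)[OF x]]] fiber_eq[OF UB(1)[OF x]] by simp
    also have "roots (poly p (\<sigma> x) / poly q (\<sigma> x)) = (\<lambda>h. h (\<sigma> x)) ` H"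
      using H \<sigma>_good[OF x] unfolding splits_over_def by blast
    hence "roots x = (\<lambda>h. h (\<sigma> x)) ` H" unfolding right_inverse[OF x] .
    finally show "f x \<in> (\<lambda>g. g x) ` ((\<lambda>h. h \<circ> \<sigma>) ` H)" by (simp add: image_image)
  qed
  then obtain h where h: "h \<in> H" "\<And>x. x \<in> U \<Longrightarrow> f x = h (\<sigma> x)" by auto
  obtain N L where NL: "\<And>z. z \<notin> pulled_back_bad p q \<Longrightarrow> poly L z \<noteq> 0"
    "\<And>z. z \<notin> pulled_back_bad p q \<Longrightarrow> h z = poly N z / poly L z"
    by (rule pulled_back_section_rational[OF assms(1) splits_over_section[OF H h(1)]]) (rule that)
  have "obtainable m U (\<lambda>x. poly N (\<sigma> x) / poly L (\<sigma> x))"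
    using NL(1) \<sigma>_good by (intro obtainable.divide obtainable_poly \<sigma>(5)) auto
  hence "obtainable m U f"
    by (rule obtainable_transfer) (use \<sigma>(2) h(2) NL(2) \<sigma>_good in auto)
  thus "\<exists>U\<subseteq>D. open U \<and> connected U \<and> U \<noteq> {} \<and> obtainable m U f"
    using \<sigma>(2-4) UB(2) by (intro exI[of _ U]) blast
qed

end

section \<open>Counting ramification\<close>

definition wronskian :: "complex poly \<Rightarrow> complex poly \<Rightarrow> complex poly" where
  "wronskian p q = pderiv p * q - p * pderiv q"

text \<open>
  The Wronskian is an alternating bilinear form, so a linear change of \<open>p\<close> and
  \<open>q\<close> multiplies it by the determinant. It therefore sees the ramification over all
  values at once.
\<close>

lemma wronskian_zero_form:
  "wronskian (zero_form a p q) (zero_form b p q) = smult (bracket a b) (wronskian p q)"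
  by (rule poly_eqI)
     (simp add: wronskian_def zero_form_def bracket_def pderiv_diff pderiv_smult algebra_simps)

lemma degree_wronskian:
  "degree (wronskian p q) \<le> degree p + degree q - 1"
proof -
  have "degree (pderiv p * q) \<le> degree p + degree q - 1" for p q :: "complex poly"
  proof (cases "degree p = 0")
    case True
    hence "pderiv p = 0" by (simp add: pderiv_eq_0_iff)
    thus ?thesis by simp
  next
    case False
    have "degree (pderiv p * q) \<le> degree (pderiv p) + degree q" by (rule degree_mult_le)
    thus ?thesis using False by (simp add: degree_pderiv)
  qed
  from this[of p q] this[of q p] show ?thesis
    unfolding wronskian_def by (intro degree_diff_le) (simp_all add: mult.commute add.commute)
qed

lemma power_dvd_pderiv:
  assumes "[:-z, 1:] ^ Suc n dvd (f :: complex poly)"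
  shows "[:-z, 1:] ^ n dvd pderiv f"
proof -
  obtain g where g: "f = [:-z, 1:] ^ Suc n * g" using assms by (elim dvdE)
  have "pderiv f = [:-z, 1:] ^ n * (smult (of_nat (Suc n)) g + [:-z, 1:] * pderiv g)"
    unfolding g pderiv_mult pderiv_power_Suc by (simp add: algebra_simps pderiv_pCons)
  thus ?thesis by simp
qed

lemma order_wronskian:
  assumes "wronskian f g \<noteq> 0"
  shows "order z f - 1 \<le> order z (wronskian f g)"
proof (cases "order z f")
  case (Suc n)
  have "[:-z, 1:] ^ Suc n dvd f" using order_1[of z f] Suc by simp
  hence "[:-z, 1:] ^ n dvd pderiv f" "[:-z, 1:] ^ n dvd f"
    using power_dvd_pderiv by (blast, metis power_Suc dvd_mult_right)
  hence "[:-z, 1:] ^ n dvd wronskian f g"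
    unfolding wronskian_def by (intro dvd_diff dvd_mult2)
  thus ?thesis using assms Suc by (simp add: order_divides)
qed simp

text \<open>
  At a zero of \<open>q\<close> the two products in the Wronskian have different orders, because
  \<open>p\<close> does not vanish there.
\<close>

lemma wronskian_nonzero:
  assumes cop: "\<And>z. poly p z \<noteq> 0 \<or> poly q z \<noteq> 0" and "degree q > 0"
  shows "wronskian p q \<noteq> 0"
proof
  assume "wronskian p q = 0"
  hence eq: "p * pderiv q = pderiv p * q" by (simp add: wronskian_def)
  have "\<not> constant (poly q)" using assms(2) by (simp add: constant_degree)
  then obtain z where z: "poly q z = 0" using fundamental_theorem_of_algebra by blast
  have q: "q \<noteq> 0" "pderiv q \<noteq> 0" using assms(2) by (auto simp: pderiv_eq_0_iff)
  have pz: "poly p z \<noteq> 0" using cop[of z] z by simp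
  hence "p \<noteq> 0" by auto
  have oq: "order z q = Suc (order z (pderiv q))" by (rule order_pderiv[OF q(1) z])
  have "p * pderiv q \<noteq> 0" using \<open>p \<noteq> 0\<close> q by simp
  hence "order z (p * pderiv q) = order z (pderiv q)"
    using pz by (simp add: order_mult order_0I)
  moreover have "order z (pderiv p * q) \<ge> order z q"
    using \<open>p * pderiv q \<noteq> 0\<close> unfolding eq by (simp add: order_mult)
  ultimately show False using eq oq by simp
qed

lemma card_roots_mult_le_degree:
  fixes f :: "complex poly"
  assumes "f \<noteq> 0" "\<And>z. poly f z = 0 \<Longrightarrow> k \<le> order z f" "k > 0"
  shows "real (degree f) * (1 - 1 / real k) \<le> real (\<Sum>z | poly f z = 0. order z f - 1)"
proof -
  have fin: "finite {z. poly f z = 0}" using assms(1) by (rule poly_roots_finite)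
  have deg: "(\<Sum>z | poly f z = 0. order z f) = degree f"
  proof -
    have "degree f = degree (\<Prod>z | poly f z = 0. [:-z, 1:] ^ order z f)"
      using arg_cong[OF complex_poly_decompose[of f], of degree] assms(1) by simp
    also have "\<dots> = (\<Sum>z | poly f z = 0. degree ([:-z, 1:] ^ order z f))"
      by (rule degree_prod_sum_eq) simp
    also have "\<dots> = (\<Sum>z | poly f z = 0. order z f)" by (simp add: degree_power_eq)
    finally show ?thesis by simp
  qed
  have "card {z. poly f z = 0} * k \<le> (\<Sum>z | poly f z = 0. order z f)"
    using sum_mono[of "{z. poly f z = 0}" "\<lambda>_. k" "\<lambda>z. order z f"] assms(2) by simp
  hence "real (card {z. poly f z = 0}) * real k \<le> real (degree f)"
    unfolding deg by (metis of_nat_le_iff of_nat_mult)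
  hence "real (card {z. poly f z = 0}) \<le> real (degree f) / real k"
    using assms(3) by (simp add: field_simps)
  moreover have "(\<Sum>z | poly f z = 0. order z f - 1) + card {z. poly f z = 0} = degree f"
  proof -
    have "(\<Sum>z | poly f z = 0. order z f - 1) + card {z. poly f z = 0} =
          (\<Sum>z | poly f z = 0. (order z f - 1) + 1)" unfolding sum.distrib by simp
    also have "\<dots> = (\<Sum>z | poly f z = 0. order z f)"
      using assms(1) by (intro sum.cong refl) (simp add: order_root)
    finally show ?thesis by (simp add: deg)
  qed
  hence "real (\<Sum>z | poly f z = 0. order z f - 1) + real (card {z. poly f z = 0}) = real (degree f)"
    by (simp only: of_nat_add[symmetric])
  ultimately show ?thesis unfolding right_diff_distrib by simp
qed

text \<open>
  A zero of order \<open>n\<close> of the form over \<open>a\<close> is a zero of order at least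
  \<open>n - 1\<close> of the Wronskian. Let \<open>N\<close> be the larger one of the degrees of
  \<open>p\<close> and \<open>q\<close>. All forms have degree \<open>N\<close>, except for at most
  one, over the value at infinity, which may have a smaller degree \<open>d0\<close>; the Wronskian
  has degree at most \<open>d0 + N - 1\<close>. If \<open>T\<close> denotes the sum over the other
  points of \<open>A\<close>, counting zeros gives \<open>d0 (1 - 1 / r a0) + N T \<le> d0 + N -
  1\<close>. As \<open>d0 \<le> N\<close>, this implies \<open>T < 1 + 1 / r a0\<close>.
\<close>

theorem ramification_inequality:
  assumes cop: "\<And>z. poly p z \<noteq> 0 \<or> poly q z \<noteq> 0"
    and nonzero: "\<And>a. zero_form a p q \<noteq> 0"
    and A: "finite A" "card A \<ge> 2"
    and r: "\<And>a. a \<in> A \<Longrightarrow> r a > 0"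
    and ram: "\<And>a z. a \<in> A \<Longrightarrow> poly (zero_form a p q) z = 0 \<Longrightarrow> r a \<le> order z (zero_form a p q)"
  shows "(\<Sum>a\<in>A. 1 - 1 / real (r a)) < 2"
proof -
  define L where "L a = zero_form a p q" for a
  define W where "W = wronskian p q"
  have WL: "wronskian (L a) (L b) = smult (bracket a b) W" for a b
    unfolding L_def W_def by (rule wronskian_zero_form)
  have copL: "poly (L a) z \<noteq> 0 \<or> poly (L b) z \<noteq> 0" if "a \<noteq> b" for a b z
  proof (rule ccontr)
    assume *: "\<not> ?thesis"
    define a1 a2 b1 b2 where "a1 = fst (homogeneous_coords a)" and "a2 = snd (homogeneous_coords a)"
      and "b1 = fst (homogeneous_coords b)" and "b2 = snd (homogeneous_coords b)"
    have e: "a2 * poly p z = a1 * poly q z" "b2 * poly p z = b1 * poly q z"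
      using * by (simp_all add: L_def zero_form_def a1_def a2_def b1_def b2_def)
    have \<Delta>: "a1 * b2 - a2 * b1 \<noteq> 0"
      using bracket_nonzero[OF that] by (simp add: bracket_def a1_def a2_def b1_def b2_def)
    have "(a1 * b2 - a2 * b1) * poly p z = 0" "(a1 * b2 - a2 * b1) * poly q z = 0"
      using e by algebra+
    thus False using \<Delta> cop[of z] by simp
  qed
  define N where "N = max (degree p) (degree q)"
  have degL_le: "degree (L a) \<le> N" for a
    unfolding L_def zero_form_def N_def
    by (intro degree_diff_le order.trans[OF degree_smult_le]) auto
  have degL_ge: "N \<le> max (degree (L a)) (degree (L b))" if "a \<noteq> b" for a b
  proof -
    define a1 a2 b1 b2 where "a1 = fst (homogeneous_coords a)" and "a2 = snd (homogeneous_coords a)"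
      and "b1 = fst (homogeneous_coords b)" and "b2 = snd (homogeneous_coords b)"
    have \<Delta>: "a1 * b2 - a2 * b1 \<noteq> 0"
      using bracket_nonzero[OF that] by (simp add: bracket_def a1_def a2_def b1_def b2_def)
    have "smult (a1 * b2 - a2 * b1) p = smult a1 (L b) - smult b1 (L a)"
         "smult (a1 * b2 - a2 * b1) q = smult a2 (L b) - smult b2 (L a)"
      by (rule poly_eqI, simp add: L_def zero_form_def a1_def a2_def b1_def b2_def algebra_simps)+
    moreover have "degree (smult c (L b) - smult d (L a)) \<le> max (degree (L a)) (degree (L b))" for c d
      by (intro degree_diff_le order.trans[OF degree_smult_le]) auto
    ultimately have "degree (smult (a1 * b2 - a2 * b1) p) \<le> max (degree (L a)) (degree (L b))"
      "degree (smult (a1 * b2 - a2 * b1) q) \<le> max (degree (L a)) (degree (L b))" by metis+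
    thus ?thesis using \<Delta> by (simp add: N_def)
  qed
  have W0: "W \<noteq> 0" and N0: "N > 0"
  proof -
    show "N > 0"
    proof (rule ccontr)
      assume "\<not> N > 0"
      then obtain c d where cd: "p = [:c:]" "q = [:d:]" by (auto simp: N_def elim!: degree_eq_zeroE)
      show False
      proof (cases "d = 0")
        case True
        thus False using nonzero[of None] cd by (simp add: zero_form_def)
      next
        case False
        thus False using nonzero[of "Some (c / d)"] cd by (simp add: zero_form_def)
      qed
    qed
    have "max (degree (L None)) (degree (L (Some 0))) \<ge> N" by (rule degL_ge) simp
    then consider "degree (L None) > 0" | "degree (L (Some 0)) > 0" using \<open>N > 0\<close> by linarith
    thus "W \<noteq> 0"
    proof cases
      case 1
      have "wronskian (L (Some 0)) (L None) \<noteq> 0" using copL[of "Some 0" None] 1 by (intro wronskian_nonzero) auto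
      thus ?thesis unfolding WL by auto
    next
      case 2
      have "wronskian (L None) (L (Some 0)) \<noteq> 0" using copL[of None "Some 0"] 2 by (intro wronskian_nonzero) auto
      thus ?thesis unfolding WL by auto
    qed
  qed
  have degW: "degree W \<le> degree (L a) + degree (L b) - 1" if "a \<noteq> b" for a b
    using degree_wronskian[of "L a" "L b"] bracket_nonzero[OF that] by (simp add: WL)
  have orderW: "order z (L a) - 1 \<le> order z W" for a z
  proof -
    obtain b where b: "a \<noteq> b" by (metis option.distinct(1))
    have "order z (L a) - 1 \<le> order z (wronskian (L a) (L b))"
      using bracket_nonzero[OF b] W0 by (intro order_wronskian) (simp add: WL)
    thus ?thesis using bracket_nonzero[OF b] by (simp add: WL order_smult)
  qed
  define S where "S a = {z. poly (L a) z = 0}" for a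
  have finS: "finite (S a)" for a unfolding S_def L_def by (rule poly_roots_finite[OF nonzero])
  have disj: "S a \<inter> S b = {}" if "a \<noteq> b" for a b using copL[OF that] by (auto simp: S_def)
  have "(\<Sum>a\<in>A. \<Sum>z\<in>S a. order z (L a) - 1) \<le> (\<Sum>a\<in>A. \<Sum>z\<in>S a. order z W)"
    by (intro sum_mono orderW)
  also have "\<dots> = (\<Sum>z\<in>(\<Union>a\<in>A. S a). order z W)"
    using A(1) finS disj by (intro sum.UNION_disjoint[symmetric]) auto
  also have "\<dots> = (\<Sum>z\<in>(\<Union>a\<in>A. S a) \<inter> {z. poly W z = 0}. order z W)"
    using A(1) finS W0 by (intro sum.mono_neutral_right) (auto simp: order_root)
  also have "\<dots> \<le> (\<Sum>z | poly W z = 0. order z W)"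
    by (intro sum_mono2 poly_roots_finite W0) auto
  also have "\<dots> \<le> degree W" by (rule sum_order_le_degree[OF W0])
  finally have total: "(\<Sum>a\<in>A. \<Sum>z\<in>S a. order z (L a) - 1) \<le> degree W" .
  have each: "real (degree (L a)) * (1 - 1 / real (r a)) \<le> real (\<Sum>z\<in>S a. order z (L a) - 1)" if "a \<in> A" for a
    unfolding S_def using ram[OF that] r[OF that] nonzero
    by (intro card_roots_mult_le_degree) (auto simp: L_def)
  have "A \<noteq> {}" using A by auto
  \<comment> \<open>the point whose form may have dropped degree\<close>
  obtain a0 where a0: "a0 \<in> A" "\<And>b. b \<in> A \<Longrightarrow> degree (L a0) \<le> degree (L b)"
    using arg_min_if_finite[OF A(1) \<open>A \<noteq> {}\<close>, of "\<lambda>a. degree (L a)"] by (metis not_le)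
  have degN: "degree (L b) = N" if "b \<in> A - {a0}" for b
    using degL_ge[of a0 b] degL_le[of b] a0(2)[of b] that by auto
  have "card (A - {a0}) > 0" using A a0(1) by simp
  then obtain b0 where b0: "b0 \<in> A - {a0}" by (metis card_gt_0_iff ex_in_conv)
  define d0 where "d0 = real (degree (L a0))"
  define T where "T = (\<Sum>a\<in>A - {a0}. 1 - 1 / real (r a))"
  have "real (\<Sum>a\<in>A. \<Sum>z\<in>S a. order z (L a) - 1) \<le> d0 + real N - 1"
  proof -
    have "degree W \<le> degree (L a0) + N - 1" using degW[of a0 b0] degN[OF b0] b0 by auto
    hence "real (degree W) \<le> d0 + real N - 1" using N0 by (simp add: d0_def of_nat_diff)
    thus ?thesis using total by (meson of_nat_le_iff order.trans)
  qed
  moreover have "(\<Sum>a\<in>A. real (degree (L a)) * (1 - 1 / real (r a))) \<le> real (\<Sum>a\<in>A. \<Sum>z\<in>S a. order z (L a) - 1)"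
    unfolding of_nat_sum[of _ A] by (intro sum_mono each)
  moreover have "(\<Sum>a\<in>A. real (degree (L a)) * (1 - 1 / real (r a))) = d0 * (1 - 1 / real (r a0)) + real N * T"
    unfolding sum.remove[OF A(1) a0(1)] T_def sum_distrib_left by (simp add: d0_def degN)
  ultimately have main: "real N * T \<le> d0 / real (r a0) + real N - 1"
    by (simp add: right_diff_distrib)
  have "d0 / real (r a0) \<le> real N / real (r a0)"
    using degL_le[of a0] by (intro divide_right_mono) (simp_all add: d0_def)
  hence "real N * T < real N * (1 + 1 / real (r a0))"
    using main by (simp add: distrib_left)
  hence "T < 1 + 1 / real (r a0)" using N0 by simp
  thus ?thesis unfolding sum.remove[OF A(1) a0(1)] T_def by simp
qed

section \<open>Coverings of the sphere by the sphere\<close>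

definition chart_at_infinity :: "complex option \<Rightarrow> complex" where
  "chart_at_infinity p = (case p of None \<Rightarrow> 0 | Some z \<Rightarrow> inverse z)"

text \<open>
  The inverse of \<^const>\<open>chart_at_infinity\<close>.
\<close>

definition point_near_infinity :: "complex \<Rightarrow> complex option" where
  "point_near_infinity w = (if w = 0 then None else Some (inverse w))"

lemma atlas_riemann_sphere:
  "atlas riemann_sphere = {(range Some, the), (- {Some 0}, chart_at_infinity)}"
  by (simp add: riemann_sphere_def chart_at_infinity_def[abs_def])

lemma topo_riemann_sphere: "topo riemann_sphere = Alexandroff_compactification euclidean"
  by (simp add: riemann_sphere_def)

lemma topspace_riemann_sphere [simp]: "topspace (topo riemann_sphere) = UNIV"
  unfolding topo_riemann_sphere by (auto simp: notin_range_Some)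

lemma inv_into_charts:
  "inv_into (range Some) the = (Some :: complex \<Rightarrow> _)"
  "inv_into (- {Some 0}) chart_at_infinity = point_near_infinity"
proof -
  show "inv_into (range Some) the = (Some :: complex \<Rightarrow> _)"
  proof
    fix z :: complex
    have "inv_into (range Some) the (the (Some z)) = Some z"
      by (rule inv_into_f_f) (auto simp: inj_on_def)
    thus "inv_into (range Some) the z = Some z" by simp
  qed
  have inj: "inj_on chart_at_infinity (- {Some 0})"
    by (auto simp: inj_on_def chart_at_infinity_def split: option.splits)
  show "inv_into (- {Some 0}) chart_at_infinity = point_near_infinity"
  proof
    fix w
    have "inv_into (- {Some 0}) chart_at_infinity (chart_at_infinity (point_near_infinity w)) = point_near_infinity w"
      by (rule inv_into_f_f[OF inj]) (simp add: point_near_infinity_def)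
    moreover have "chart_at_infinity (point_near_infinity w) = w"
      by (simp add: chart_at_infinity_def point_near_infinity_def)
    ultimately show "inv_into (- {Some 0}) chart_at_infinity w = point_near_infinity w" by simp
  qed
qed

lemma continuous_point_near_infinity:
  "continuous_map euclidean (topo riemann_sphere) point_near_infinity"
  unfolding continuous_map
proof (intro conjI allI impI)
  show "point_near_infinity ` topspace euclidean \<subseteq> topspace (topo riemann_sphere)" by simp
  fix T assume "openin (topo riemann_sphere) T"
  then consider U where "open U" "T = Some ` U"
    | K where "compact K" "T = insert None (Some ` (- K))"
    unfolding topo_riemann_sphere openin_Alexandroff_compactification
    by (auto simp: Compl_eq_Diff_UNIV)
  thus "openin euclidean {w \<in> topspace euclidean. point_near_infinity w \<in> T}"
  proof cases
    case 1
    have "{w. point_near_infinity w \<in> T} = inverse -` U \<inter> - {0}"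
      using 1(2) by (auto simp: point_near_infinity_def split: if_splits)
    moreover have "open (inverse -` U \<inter> - {0 :: complex})"
      using 1(1) by (intro continuous_open_preimage[of "- {0}" inverse U, unfolded Int_commute[of "- {0}"]] continuous_intros) auto
    ultimately show ?thesis by simp
  next
    case 2
    obtain b where b: "b > 0" "\<And>x. x \<in> K \<Longrightarrow> norm x \<le> b"
      using compact_imp_bounded[OF 2(1)] by (auto simp: bounded_pos)
    have eq: "{w. point_near_infinity w \<in> T} = (inverse -` (- K) \<inter> - {0}) \<union> ball 0 (inverse b)"
    proof (rule set_eqI)
      fix w :: complex
      have "inverse w \<notin> K" if "w \<noteq> 0" "norm w < inverse b"
      proof
        assume "inverse w \<in> K"
        hence "inverse (norm w) \<le> b" using b(2)[of "inverse w"] by (simp add: norm_inverse)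
        hence "inverse b \<le> norm w" using that(1) b(1) by (simp add: inverse_le_iff le_imp_inverse_le field_simps)
        thus False using that(2) by simp
      qed
      thus "w \<in> {w. point_near_infinity w \<in> T} \<longleftrightarrow> w \<in> (inverse -` (- K) \<inter> - {0}) \<union> ball 0 (inverse b)"
        using 2(2) b(1) by (auto simp: point_near_infinity_def)
    qed
    have "open (inverse -` (- K) \<inter> - {0 :: complex})"
      using compact_imp_closed[OF 2(1)]
      by (intro continuous_open_preimage[of "- {0}" inverse "- K", unfolded Int_commute[of "- {0}"]] continuous_intros) auto
    thus ?thesis using eq by (simp add: open_Un)
  qed
qed

lemma sphere_chart:
  assumes "(U, \<phi>) \<in> atlas riemann_sphere"
  shows "openin (topo riemann_sphere) U" "inj_on \<phi> U"
    "continuous_map euclidean (topo riemann_sphere) (inv_into U \<phi>)"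
    "inv_into U \<phi> z \<in> U" "\<phi> (inv_into U \<phi> z) = z"
proof -
  have surj: "\<phi> ` U = UNIV"
  proof (cases "U = range Some \<and> \<phi> = the")
    case True
    thus ?thesis by (auto simp: image_image)
  next
    case False
    hence e: "U = - {Some 0}" "\<phi> = chart_at_infinity" using assms by (auto simp: atlas_riemann_sphere)
    have "w = chart_at_infinity (point_near_infinity w) \<and> point_near_infinity w \<in> - {Some 0}" for w
      by (simp add: chart_at_infinity_def point_near_infinity_def)
    thus ?thesis unfolding e by blast
  qed
  thus "inv_into U \<phi> z \<in> U" "\<phi> (inv_into U \<phi> z) = z"
    by (metis UNIV_I inv_into_into, metis UNIV_I f_inv_into_f)
  have "openin (topo riemann_sphere) (range Some)"
    unfolding topo_riemann_sphere by simp
  moreover have "openin (topo riemann_sphere) (- {Some 0})"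
  proof -
    have "- {Some 0} = insert None (Some ` (topspace euclidean - {0 :: complex}))"
      by (auto simp: notin_range_Some)
    moreover have "compactin euclidean {0 :: complex}" "closedin euclidean {0 :: complex}" by auto
    ultimately show ?thesis
      unfolding topo_riemann_sphere openin_Alexandroff_compactification by blast
  qed
  ultimately show "openin (topo riemann_sphere) U" using assms by (auto simp: atlas_riemann_sphere)
  show "inj_on \<phi> U"
    using assms by (auto simp: atlas_riemann_sphere inj_on_def chart_at_infinity_def split: option.splits)
  show "continuous_map euclidean (topo riemann_sphere) (inv_into U \<phi>)"
    using assms continuous_point_near_infinity continuous_map_Some
    by (auto simp: atlas_riemann_sphere inv_into_charts topo_riemann_sphere)
qed

lemma holomorphic_linear_bound:
  assumes "f holomorphic_on S" "open S" "z0 \<in> S"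
  shows "\<exists>\<epsilon>>0. \<exists>C\<ge>0. ball z0 \<epsilon> \<subseteq> S \<and> (\<forall>z\<in>ball z0 \<epsilon>. norm (f z - f z0) \<le> C * norm (z - z0))"
proof -
  obtain D where "(f has_field_derivative D) (at z0)"
    using holomorphic_on_imp_differentiable_at[OF assms] by (auto simp: field_differentiable_def)
  hence "((\<lambda>z. norm ((f z - f z0) / (z - z0))) \<longlongrightarrow> norm D) (at z0)"
    unfolding has_field_derivative_iff by (rule tendsto_norm)
  hence "\<forall>\<^sub>F z in at z0. norm ((f z - f z0) / (z - z0)) < norm D + 1"
    by (rule order_tendstoD) simp
  then obtain d where d: "d > 0" "\<And>z. z \<noteq> z0 \<Longrightarrow> dist z z0 < d \<Longrightarrow> norm ((f z - f z0) / (z - z0)) < norm D + 1"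
    by (auto simp: eventually_at)
  obtain r where r: "r > 0" "ball z0 r \<subseteq> S" using assms(2,3) open_contains_ball_eq by metis
  have "norm (f z - f z0) \<le> (norm D + 1) * norm (z - z0)" if "z \<in> ball z0 (min d r)" for z
  proof (cases "z = z0")
    case False
    have "norm (f z - f z0) / norm (z - z0) < norm D + 1"
      using d(2)[of z] False that by (simp add: dist_commute norm_divide)
    thus ?thesis using False by (simp add: divide_less_eq)
  qed simp
  thus ?thesis using d(1) r by (intro exI[of _ "min d r"] conjI exI[of _ "norm D + 1"]) auto
qed

text \<open>
  In suitable charts \<open>\<pi>\<close> is the \<open>k\<close>-th power, so in the charts of the
  sphere the composition \<open>\<pi> \<circ> g\<close> has the form \<open>\<eta>(X ^ k)\<close>
  with \<open>X\<close> and \<open>\<eta>\<close> holomorphic and \<open>X\<close> vanishing at the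
  centre. This gives the growth condition. The function \<open>X\<close> is injective together with
  \<open>g\<close>, so \<open>X ^ k\<close> does not return to the value zero.
\<close>

lemma covering_in_charts:
  assumes Z: "riemann_surface Z" and g: "holomorphic_map riemann_sphere Z g" "inj g"
    and \<pi>: "holomorphic_map Z riemann_sphere \<pi>" "has_multiplicity Z riemann_sphere \<pi> (g p0) k"
    and charts: "(U, \<phi>) \<in> atlas riemann_sphere" "(V, \<psi>) \<in> atlas riemann_sphere" "p0 \<in> U" "\<pi> (g p0) \<in> V"
  obtains \<epsilon> G C where "\<epsilon> > 0" "G holomorphic_on ball (\<phi> p0) \<epsilon>"
    "\<And>z. z \<in> ball (\<phi> p0) \<epsilon> \<Longrightarrow> \<pi> (g (inv_into U \<phi> z)) \<in> V \<and> \<psi> (\<pi> (g (inv_into U \<phi> z))) = G z"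
    "\<And>z. z \<in> ball (\<phi> p0) \<epsilon> \<Longrightarrow> norm (G z - G (\<phi> p0)) \<le> C * norm (z - \<phi> p0) ^ k"
    "\<And>z. z \<in> ball (\<phi> p0) \<epsilon> \<Longrightarrow> z \<noteq> \<phi> p0 \<Longrightarrow> G z \<noteq> G (\<phi> p0)"
proof -
  define e where "e = inv_into U \<phi>"
  define z0 where "z0 = \<phi> p0"
  have e: "e z \<in> U" "\<phi> (e z) = z" for z unfolding e_def by (rule sphere_chart[OF charts(1)])+
  have ez0: "e z0 = p0" unfolding e_def z0_def by (rule inv_into_f_f[OF sphere_chart(2)[OF charts(1)] charts(3)])
  obtain V1 \<phi>1 U1 \<psi>1 where m: "k > 0" "holo_chart Z V1 \<phi>1" "g p0 \<in> V1" "\<phi>1 (g p0) = 0"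
    "holo_chart riemann_sphere U1 \<psi>1" "\<pi> ` V1 \<subseteq> U1" "\<psi>1 (\<pi> (g p0)) = 0"
    "\<forall>v\<in>V1. \<psi>1 (\<pi> v) = \<phi>1 v ^ k"
    using \<pi>(2) unfolding has_multiplicity_def by blast
  have cont_g: "continuous_map (topo riemann_sphere) (topo Z) g" and cont_\<pi>: "continuous_map (topo Z) (topo riemann_sphere) \<pi>"
    using g(1) \<pi>(1) unfolding holomorphic_map_def by blast+
  have cont_e: "continuous_map euclidean (topo riemann_sphere) e"
    unfolding e_def by (rule sphere_chart(3)[OF charts(1)])
  have cont_ge: "continuous_map euclidean (topo Z) (g \<circ> e)"
    by (rule continuous_map_compose[OF cont_e cont_g])
  have cont_\<pi>ge: "continuous_map euclidean (topo riemann_sphere) (\<pi> \<circ> (g \<circ> e))"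
    by (rule continuous_map_compose[OF cont_ge cont_\<pi>])
  have "g p0 \<in> topspace (topo Z)" using cont_g by (auto simp: continuous_map_def)
  then obtain W \<theta> where W: "(W, \<theta>) \<in> atlas Z" "g p0 \<in> W"
    using Z unfolding riemann_surface_def by blast
  have holoW: "holo_chart Z W \<theta>" using Z W(1) unfolding riemann_surface_def by blast
  have inj\<theta>: "inj_on \<theta> W" and opW: "openin (topo Z) W"
    and inj\<phi>1: "inj_on \<phi>1 V1" and opV1: "openin (topo Z) V1"
    using holoW m(2) unfolding holo_chart_def
    by (auto dest!: homeomorphic_imp_injective_map openin_subset simp: topspace_subtopology Int_absorb1)
  have inj\<psi>1: "inj_on \<psi>1 U1" and opU1: "openin (topo riemann_sphere) U1" and opim: "open (\<psi>1 ` U1)"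
    and hm: "homeomorphic_map (subtopology (topo riemann_sphere) U1) (top_of_set (\<psi>1 ` U1)) \<psi>1"
    using m(5) unfolding holo_chart_def by (auto dest!: homeomorphic_imp_injective_map)
  \<comment> \<open>the part of the chart on which all charts in use are defined\<close>
  define \<Omega> where "\<Omega> = {z. g (e z) \<in> V1 \<inter> W} \<inter> {z. \<pi> (g (e z)) \<in> V}"
  have "openin euclidean {z \<in> topspace euclidean. (g \<circ> e) z \<in> V1 \<inter> W}"
    by (rule openin_continuous_map_preimage[OF cont_ge openin_Int[OF opV1 opW]])
  moreover have "openin euclidean {z \<in> topspace euclidean. (\<pi> \<circ> (g \<circ> e)) z \<in> V}"
    by (rule openin_continuous_map_preimage[OF cont_\<pi>ge sphere_chart(1)[OF charts(2)]])
  ultimately have op\<Omega>: "open \<Omega>" unfolding \<Omega>_def by (auto intro: open_Int)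
  have z0\<Omega>: "z0 \<in> \<Omega>" using m(3) W(2) charts(4) by (simp add: \<Omega>_def ez0)
  define X where "X z = \<phi>1 (g (e z))" for z
  have X_hol: "X holomorphic_on \<Omega>"
  proof -
    have "(\<theta> \<circ> g \<circ> inv_into U \<phi>) holomorphic_on \<phi> ` (U \<inter> g -` W)"
      using g(1) charts(1) W(1) unfolding holomorphic_map_def by blast
    moreover have "\<Omega> \<subseteq> \<phi> ` (U \<inter> g -` W)"
    proof
      fix z assume "z \<in> \<Omega>"
      hence "e z \<in> U \<inter> g -` W" using e(1) by (simp add: \<Omega>_def)
      thus "z \<in> \<phi> ` (U \<inter> g -` W)" using e(2) by (metis imageI)
    qed
    ultimately have h1: "(\<theta> \<circ> g \<circ> e) holomorphic_on \<Omega>"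
      unfolding e_def using holomorphic_on_subset by blast
    have h2: "(\<phi>1 \<circ> inv_into W \<theta>) holomorphic_on \<theta> ` (V1 \<inter> W)"
      using m(2) W(1) unfolding holo_chart_def by blast
    have "(\<theta> \<circ> g \<circ> e) ` \<Omega> \<subseteq> \<theta> ` (V1 \<inter> W)" by (auto simp: \<Omega>_def)
    from holomorphic_on_compose_gen[OF h1 h2 this]
    show ?thesis
    proof (rule holomorphic_transform)
      fix z assume "z \<in> \<Omega>"
      hence "inv_into W \<theta> (\<theta> (g (e z))) = g (e z)" by (intro inv_into_f_f[OF inj\<theta>]) (simp add: \<Omega>_def)
      thus "((\<phi>1 \<circ> inv_into W \<theta>) \<circ> (\<theta> \<circ> g \<circ> e)) z = X z" by (simp add: X_def)
    qed
  qed
  define \<eta> where "\<eta> = \<psi> \<circ> inv_into U1 \<psi>1"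
  define T where "T = \<psi>1 ` (U1 \<inter> V)"
  have \<eta>_hol: "\<eta> holomorphic_on T"
    using m(5) charts(2) unfolding holo_chart_def \<eta>_def T_def by blast
  have T_open: "open T"
  proof -
    have "openin (subtopology (topo riemann_sphere) U1) (U1 \<inter> V)"
      using sphere_chart(1)[OF charts(2)] by (metis openin_subtopology Int_commute)
    hence "openin (top_of_set (\<psi>1 ` U1)) T"
      unfolding T_def using homeomorphic_imp_open_map[OF hm] by (simp add: open_map_def)
    thus ?thesis using opim openin_open_trans by blast
  qed
  have F_in: "\<pi> (g (e z)) \<in> U1 \<inter> V" "\<psi>1 (\<pi> (g (e z))) = X z ^ k" if "z \<in> \<Omega>" for z
    using that m(6,8) by (auto simp: \<Omega>_def X_def)
  have F_eq: "\<psi> (\<pi> (g (e z))) = \<eta> (X z ^ k)" if "z \<in> \<Omega>" for z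
  proof -
    have "inv_into U1 \<psi>1 (\<psi>1 (\<pi> (g (e z)))) = \<pi> (g (e z))"
      using F_in(1)[OF that] by (intro inv_into_f_f[OF inj\<psi>1]) simp
    thus ?thesis unfolding \<eta>_def o_def F_in(2)[OF that, symmetric] by simp
  qed
  have XT: "X z ^ k \<in> T" if "z \<in> \<Omega>" for z
    unfolding T_def F_in(2)[OF that, symmetric] using F_in(1)[OF that] by blast
  have Xz0: "X z0 = 0" using m(4) by (simp add: X_def ez0)
  have zk: "(0 :: complex) ^ k = 0" using m(1) by (rule zero_power)
  have "0 \<in> T" using XT[OF z0\<Omega>] unfolding Xz0 zk .
  obtain \<epsilon>1 C1 where 1: "\<epsilon>1 > 0" "C1 \<ge> 0" "ball z0 \<epsilon>1 \<subseteq> \<Omega>" "\<And>z. z \<in> ball z0 \<epsilon>1 \<Longrightarrow> norm (X z) \<le> C1 * norm (z - z0)"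
    using holomorphic_linear_bound[OF X_hol op\<Omega> z0\<Omega>] Xz0 by auto
  obtain \<epsilon>2 C2 where 2: "\<epsilon>2 > 0" "C2 \<ge> 0" "\<And>y. y \<in> ball 0 \<epsilon>2 \<Longrightarrow> norm (\<eta> y - \<eta> 0) \<le> C2 * norm y"
    using holomorphic_linear_bound[OF \<eta>_hol T_open \<open>0 \<in> T\<close>] by auto
  have "isCont (\<lambda>z. X z ^ k) z0"
    using holomorphic_on_imp_continuous_on[OF X_hol] op\<Omega> z0\<Omega> by (intro continuous_intros) (simp add: continuous_on_eq_continuous_at)
  then obtain \<epsilon>3 where 3: "\<epsilon>3 > 0" "(\<lambda>z. X z ^ k) ` ball z0 \<epsilon>3 \<subseteq> ball (X z0 ^ k) \<epsilon>2"
    using 2(1) unfolding continuous_at_ball by blast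
  define \<epsilon> where "\<epsilon> = min \<epsilon>1 \<epsilon>3"
  define G where "G z = \<eta> (X z ^ k)" for z
  have in\<Omega>: "z \<in> \<Omega>" if "z \<in> ball z0 \<epsilon>" for z using that 1(3) by (auto simp: \<epsilon>_def)
  show thesis
  proof (rule that[of \<epsilon> G "C2 * C1 ^ k"]; (unfold z0_def[symmetric] e_def[symmetric])?)
    show "\<epsilon> > 0" using 1(1) 3(1) by (simp add: \<epsilon>_def)
    have "(\<lambda>z. X z ^ k) holomorphic_on ball z0 \<epsilon>"
      using X_hol in\<Omega> by (intro holomorphic_intros) (meson holomorphic_on_subset subsetI)
    moreover have "(\<lambda>z. X z ^ k) ` ball z0 \<epsilon> \<subseteq> T" using XT in\<Omega> by blast
    ultimately have "(\<eta> \<circ> (\<lambda>z. X z ^ k)) holomorphic_on ball z0 \<epsilon>"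
      using \<eta>_hol by (intro holomorphic_on_compose_gen)
    thus "G holomorphic_on ball z0 \<epsilon>" by (simp add: G_def[abs_def] o_def)
    fix z assume z: "z \<in> ball z0 \<epsilon>"
    show "\<pi> (g (e z)) \<in> V \<and> \<psi> (\<pi> (g (e z))) = G z"
      using F_in(1)[OF in\<Omega>[OF z]] F_eq[OF in\<Omega>[OF z]] by (simp add: G_def)
    have "z \<in> ball z0 \<epsilon>3" using z by (simp add: \<epsilon>_def)
    hence "X z ^ k \<in> ball (X z0 ^ k) \<epsilon>2" using 3(2) by blast
    hence "X z ^ k \<in> ball 0 \<epsilon>2" unfolding Xz0 zk .
    hence "norm (G z - G z0) \<le> C2 * norm (X z) ^ k"
      using 2(3)[of "X z ^ k"] by (simp add: G_def Xz0 zk norm_power)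
    also have "\<dots> \<le> C2 * (C1 * norm (z - z0)) ^ k"
      using 1(4)[of z] z 2(2) by (intro mult_left_mono power_mono) (auto simp: \<epsilon>_def)
    finally show "norm (G z - G z0) \<le> C2 * C1 ^ k * norm (z - z0) ^ k" by (simp add: power_mult_distrib mult.assoc)
    assume "z \<noteq> z0"
    show "G z \<noteq> G z0"
    proof
      assume "G z = G z0"
      hence "\<psi> (\<pi> (g (e z))) = \<psi> (\<pi> (g (e z0)))" using F_eq[OF in\<Omega>[OF z]] F_eq[OF z0\<Omega>] by (simp add: G_def)
      hence "\<pi> (g (e z)) = \<pi> (g (e z0))"
        using sphere_chart(2)[OF charts(2)] F_in(1)[OF in\<Omega>[OF z]] F_in(1)[OF z0\<Omega>] by (auto dest: inj_onD)
      hence "X z ^ k = X z0 ^ k" using F_in(2)[OF in\<Omega>[OF z]] F_in(2)[OF z0\<Omega>] by simp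
      hence "X z = X z0" unfolding Xz0 zk by simp
      hence "g (e z) = g (e z0)"
        using in\<Omega>[OF z] z0\<Omega> inj\<phi>1 by (auto simp: X_def \<Omega>_def dest: inj_onD)
      hence "e z = e z0" using g(2) by (simp add: inj_eq)
      hence "z = z0" using e(2) by metis
      thus False using \<open>z \<noteq> z0\<close> by simp
    qed
  qed
qed

text \<open>
  Factor out the zero at the centre; the cofactor is bounded below near it.
\<close>

lemma holomorphic_power_lower_bound:
  assumes "G holomorphic_on ball \<xi> \<epsilon>" "\<epsilon> > 0" "G \<xi> = 0" "\<forall>z\<in>ball \<xi> \<epsilon> - {\<xi>}. G z \<noteq> 0"
  obtains n c r where "c > 0" "r > 0" "r \<le> \<epsilon>" "\<And>z. z \<in> ball \<xi> r \<Longrightarrow> c * norm (z - \<xi>) ^ n \<le> norm (G z)"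
proof -
  have nonconst: "\<not> G constant_on ball \<xi> \<epsilon>"
  proof
    assume "G constant_on ball \<xi> \<epsilon>"
    then obtain y where y: "\<forall>z\<in>ball \<xi> \<epsilon>. G z = y" unfolding constant_on_def by blast
    define z where "z = \<xi> + of_real (\<epsilon> / 2)"
    have z: "z \<in> ball \<xi> \<epsilon>" "z \<noteq> \<xi>" using assms(2) by (auto simp: z_def dist_norm)
    have "G z = G \<xi>" using y z(1) assms(2) by simp
    thus False using assms(3,4) z by simp
  qed
  obtain g r n where g: "0 < n" "0 < r" "ball \<xi> r \<subseteq> ball \<xi> \<epsilon>" "g holomorphic_on ball \<xi> r"
    "\<And>w. w \<in> ball \<xi> r \<Longrightarrow> G w = (w - \<xi>) ^ n * g w" "\<And>w. w \<in> ball \<xi> r \<Longrightarrow> g w \<noteq> 0"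
    by (rule holomorphic_factor_zero_nonconstant[OF assms(1) open_ball connected_ball _ assms(3) nonconst])
       (use assms(2) that in auto)
  have "isCont (\<lambda>z. norm (g z)) \<xi>"
    using holomorphic_on_imp_continuous_on[OF g(4)] g(2)
    by (intro continuous_intros) (simp add: continuous_on_eq_continuous_at)
  moreover have g0: "norm (g \<xi>) / 2 < norm (g \<xi>)" using g(6)[of \<xi>] g(2) by simp
  ultimately have "\<forall>\<^sub>F z in nhds \<xi>. norm (g \<xi>) / 2 < norm (g z)"
    by (intro order_tendstoD(1)[OF isCont_imp_tendsto_nhds[where f = "\<lambda>z. norm (g z)"]])
  then obtain d where d: "d > 0" "\<And>z. dist z \<xi> < d \<Longrightarrow> norm (g \<xi>) / 2 < norm (g z)"
    unfolding eventually_nhds_metric by blast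
  show thesis
  proof (rule that[of "norm (g \<xi>) / 2" "min \<epsilon> (min d r)" n])
    show "norm (g \<xi>) / 2 > 0" using g(6)[of \<xi>] g(2) by simp
    show "min \<epsilon> (min d r) > 0" using assms(2) d(1) g(2) by simp
    fix z assume z: "z \<in> ball \<xi> (min \<epsilon> (min d r))"
    have "norm (g \<xi>) / 2 * norm (z - \<xi>) ^ n \<le> norm (g z) * norm (z - \<xi>) ^ n"
      using d(2)[of z] z by (intro mult_right_mono) (auto simp: dist_commute)
    also have "\<dots> = norm (G z)" using g(5)[of z] z by (simp add: norm_mult norm_power)
    finally show "norm (g \<xi>) / 2 * norm (z - \<xi>) ^ n \<le> norm (G z)" .
  qed simp
qed

lemma order_ge_of_growth:
  fixes f :: "complex poly"
  assumes "f \<noteq> 0" "\<epsilon> > 0" "\<And>z. z \<in> ball z0 \<epsilon> - {z0} \<Longrightarrow> norm (poly f z) \<le> C * norm (z - z0) ^ k"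
  shows "k \<le> order z0 f"
proof (rule ccontr)
  assume "\<not> k \<le> order z0 f"
  define n where "n = order z0 f"
  obtain g where g: "f = [:-z0, 1:] ^ n * g" using order_1[of z0 f] unfolding n_def by (elim dvdE)
  have gz0: "poly g z0 \<noteq> 0"
  proof
    assume "poly g z0 = 0"
    then obtain g' where g': "g = [:-z0, 1:] * g'" unfolding poly_eq_0_iff_dvd by (elim dvdE)
    have "f = [:-z0, 1:] ^ Suc n * g'" unfolding g g' by (simp only: power_Suc mult_ac)
    hence "[:-z0, 1:] ^ Suc n dvd f" by (rule dvdI)
    thus False using order_2[OF assms(1), of z0] by (simp add: n_def)
  qed
  have nk: "n < k" using \<open>\<not> k \<le> order z0 f\<close> by (simp add: n_def)
  have "\<forall>\<^sub>F z in at z0. norm (poly g z) \<le> C * norm (z - z0) ^ (k - n)"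
    unfolding eventually_at
  proof (intro exI[of _ \<epsilon>] conjI assms(2) ballI impI)
    fix z assume z: "z \<noteq> z0 \<and> dist z z0 < \<epsilon>"
    have "norm (z - z0) ^ n * norm (poly g z) = norm (poly f z)"
      unfolding g by (simp add: poly_power norm_mult norm_power)
    also have "\<dots> \<le> C * norm (z - z0) ^ k" using z by (intro assms(3)) (simp add: dist_commute)
    also have "\<dots> = norm (z - z0) ^ n * (C * norm (z - z0) ^ (k - n))"
      using nk by (simp add: mult_ac flip: power_add)
    finally show "norm (poly g z) \<le> C * norm (z - z0) ^ (k - n)"
      using z by simp
  qed
  moreover have "((\<lambda>z. norm (poly g z)) \<longlongrightarrow> norm (poly g z0)) (at z0)"
    by (intro tendsto_norm) (metis isCont_def poly_isCont)
  moreover have "((\<lambda>z. C * norm (z - z0) ^ (k - n)) \<longlongrightarrow> C * norm (z0 - z0) ^ (k - n)) (at z0)"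
    by (intro tendsto_intros)
  ultimately have "norm (poly g z0) \<le> C * norm (z0 - z0) ^ (k - n)"
    by (intro tendsto_le[OF at_neq_bot, of "\<lambda>z. C * norm (z - z0) ^ (k - n)" _ z0 "\<lambda>z. norm (poly g z)"]) auto
  thus False using gz0 nk by (simp add: power_0_left)
qed

lemma order_ge_of_factor_growth:
  fixes f w :: "complex poly"
  assumes "f \<noteq> 0" "\<epsilon> > 0" "\<And>z. z \<in> ball z0 \<epsilon> - {z0} \<Longrightarrow> poly f z = G z * poly w z"
    and "\<And>z. z \<in> ball z0 \<epsilon> \<Longrightarrow> norm (G z) \<le> C * norm (z - z0) ^ k"
  shows "k \<le> order z0 f"
proof -
  obtain \<delta> D where \<delta>: "\<delta> > 0" "D \<ge> 0" "\<And>z. z \<in> ball z0 \<delta> \<Longrightarrow> norm (poly w z - poly w z0) \<le> D * norm (z - z0)"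
    using holomorphic_linear_bound[OF holomorphic_poly[of w UNIV] open_UNIV UNIV_I, of z0] by blast
  show ?thesis
  proof (rule order_ge_of_growth[OF assms(1), of "min \<epsilon> \<delta>" z0 "\<bar>C\<bar> * (D * \<delta> + norm (poly w z0))"])
    show "min \<epsilon> \<delta> > 0" using assms(2) \<delta>(1) by simp
    fix z assume z: "z \<in> ball z0 (min \<epsilon> \<delta>) - {z0}"
    have "norm (poly f z) = norm (G z) * norm (poly w z)" using assms(3)[of z] z by (simp add: norm_mult)
    also have "\<dots> \<le> (\<bar>C\<bar> * norm (z - z0) ^ k) * (D * \<delta> + norm (poly w z0))"
    proof (intro mult_mono)
      have "norm (G z) \<le> C * norm (z - z0) ^ k" using assms(4)[of z] z by simp
      also have "\<dots> \<le> \<bar>C\<bar> * norm (z - z0) ^ k" by (intro mult_right_mono) auto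
      finally show "norm (G z) \<le> \<bar>C\<bar> * norm (z - z0) ^ k" .
      have "norm (poly w z) \<le> norm (poly w z - poly w z0) + norm (poly w z0)"
        using norm_triangle_ineq[of "poly w z - poly w z0" "poly w z0"] by simp
      also have "norm (poly w z - poly w z0) \<le> D * norm (z - z0)" using z by (intro \<delta>(3)) simp
      also have "D * norm (z - z0) \<le> D * \<delta>"
        using z \<delta>(2) by (intro mult_left_mono) (auto simp: dist_norm norm_minus_commute)
      finally show "norm (poly w z) \<le> D * \<delta> + norm (poly w z0)" by simp
    qed auto
    finally show "norm (poly f z) \<le> \<bar>C\<bar> * (D * \<delta> + norm (poly w z0)) * norm (z - z0) ^ k"
      by (simp add: mult_ac)
  qed
qed

text \<open>
  Composed with the isomorphism \<open>g\<close> from the sphere to \<open>Z\<close>, the covering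
  becomes a map of the sphere to itself. In the finite chart it is a function \<open>h\<close> with
  isolated poles and polynomial growth at infinity, hence rational. The multiplicities of the
  covering determine how fast \<open>h\<close> approaches its value at a point, which bounds the
  orders of the zeros of the forms below.
\<close>

theorem spherical_covering_rational:
  assumes cov: "universal_covering_with_signature Z \<pi> A r"
    and iso: "isomorphic_surfaces Z riemann_sphere"
  obtains p q where "\<And>z. poly p z \<noteq> 0 \<or> poly q z \<noteq> 0" "\<And>a. zero_form a p q \<noteq> 0"
    "\<And>a z. a \<in> A \<Longrightarrow> poly (zero_form a p q) z = 0 \<Longrightarrow> r a \<le> order z (zero_form a p q)"
proof -
  obtain f g where f: "holomorphic_map Z riemann_sphere f" and g: "holomorphic_map riemann_sphere Z g"
    and fg: "\<And>y. f (g y) = y"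
    using iso unfolding isomorphic_surfaces_def by auto
  have inj_g: "inj g" using fg by (metis injI)
  have Z: "riemann_surface Z" and \<pi>: "holomorphic_map Z riemann_sphere \<pi>"
    and mult: "\<And>p. p \<in> topspace (topo Z) \<Longrightarrow>
      has_multiplicity Z riemann_sphere \<pi> p (if \<pi> p \<in> A then r (\<pi> p) else 1)"
    using cov unfolding universal_covering_with_signature_def branched_covering_def by blast+
  have g_in: "g y \<in> topspace (topo Z)" for y
    using g unfolding holomorphic_map_def continuous_map_def by auto
  define F where "F y = \<pi> (g y)" for y
  define k where "k y = (if F y \<in> A then r (F y) else 1)" for y
  have mult': "has_multiplicity Z riemann_sphere \<pi> (g y) (k y)" for y
    using mult[OF g_in[of y]] unfolding k_def F_def .
  have atl: "(range Some, the) \<in> atlas riemann_sphere" "(- {Some 0}, chart_at_infinity) \<in> atlas riemann_sphere"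
    by (simp_all add: atlas_riemann_sphere)
  have charts: "\<exists>\<epsilon>>0. \<exists>G C. G holomorphic_on ball (\<phi> p0) \<epsilon> \<and> (\<forall>z\<in>ball (\<phi> p0) \<epsilon>.
      F (inv_into U \<phi> z) \<in> V \<and> \<psi> (F (inv_into U \<phi> z)) = G z \<and>
      norm (G z - G (\<phi> p0)) \<le> C * norm (z - \<phi> p0) ^ k p0 \<and> (z \<noteq> \<phi> p0 \<longrightarrow> G z \<noteq> G (\<phi> p0)))"
    if t: "(U, \<phi>) \<in> atlas riemann_sphere" "(V, \<psi>) \<in> atlas riemann_sphere" "p0 \<in> U" "F p0 \<in> V" for U \<phi> V \<psi> p0
  proof (rule covering_in_charts[OF Z g inj_g \<pi> mult' t(1-3) t(4)[unfolded F_def]])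
    fix \<epsilon> :: real and G C
    assume "\<epsilon> > 0" "G holomorphic_on ball (\<phi> p0) \<epsilon>"
      "\<And>z. z \<in> ball (\<phi> p0) \<epsilon> \<Longrightarrow> \<pi> (g (inv_into U \<phi> z)) \<in> V \<and> \<psi> (\<pi> (g (inv_into U \<phi> z))) = G z"
      "\<And>z. z \<in> ball (\<phi> p0) \<epsilon> \<Longrightarrow> norm (G z - G (\<phi> p0)) \<le> C * norm (z - \<phi> p0) ^ k p0"
      "\<And>z. z \<in> ball (\<phi> p0) \<epsilon> \<Longrightarrow> z \<noteq> \<phi> p0 \<Longrightarrow> G z \<noteq> G (\<phi> p0)"
    thus ?thesis unfolding F_def by (intro exI[of _ \<epsilon>] conjI exI[of _ G] exI[of _ C] ballI impI) simp_all
  qed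
  define h where "h z = the (F (Some z))" for z
  define B where "B = {z. F (Some z) = None}"
  \<comment> \<open>at a finite point with a finite value\<close>
  have fin_fin: "\<exists>\<epsilon>>0. \<exists>C. ball z0 \<epsilon> \<inter> B = {} \<and> h holomorphic_on ball z0 \<epsilon> \<and>
      (\<forall>z\<in>ball z0 \<epsilon>. norm (h z - h z0) \<le> C * norm (z - z0) ^ k (Some z0)) \<and>
      (\<forall>z\<in>ball z0 \<epsilon>. z \<noteq> z0 \<longrightarrow> h z \<noteq> h z0)" if z0: "z0 \<notin> B" for z0
  proof -
    have "F (Some z0) \<in> range Some" using z0 by (auto simp: B_def)
    from charts[OF atl(1) atl(1) rangeI this, unfolded inv_into_charts option.sel]
    obtain \<epsilon> G C where G: "\<epsilon> > 0" "G holomorphic_on ball z0 \<epsilon>"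
      "\<forall>z\<in>ball z0 \<epsilon>. F (Some z) \<in> range Some \<and> the (F (Some z)) = G z \<and>
        norm (G z - G z0) \<le> C * norm (z - z0) ^ k (Some z0) \<and> (z \<noteq> z0 \<longrightarrow> G z \<noteq> G z0)"
      by (elim exE conjE)
    have hG: "h z = G z" if "z \<in> ball z0 \<epsilon>" for z using G(3) that by (simp add: h_def)
    have "h z0 = G z0" using hG G(1) by simp
    moreover have "h holomorphic_on ball z0 \<epsilon>"
      using G(2) by (rule holomorphic_transform) (simp add: hG)
    moreover have "z \<notin> B" if "z \<in> ball z0 \<epsilon>" for z
    proof
      assume "z \<in> B"
      hence "None \<in> range (Some :: complex \<Rightarrow> _)" using bspec[OF G(3) that] by (simp add: B_def)
      thus False by simp
    qed
    hence "ball z0 \<epsilon> \<inter> B = {}" by blast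
    ultimately show ?thesis using G(1,3) hG by (intro exI[of _ \<epsilon>] conjI exI[of _ C] ballI impI) simp_all
  qed
  \<comment> \<open>at a finite pole\<close>
  have fin_inf: "\<exists>\<epsilon>>0. \<exists>G C. G holomorphic_on ball z0 \<epsilon> \<and> G z0 = 0 \<and>
      (\<forall>z\<in>ball z0 \<epsilon>. z \<noteq> z0 \<longrightarrow> z \<notin> B \<and> h z \<noteq> 0 \<and> G z = inverse (h z) \<and> G z \<noteq> 0) \<and>
      (\<forall>z\<in>ball z0 \<epsilon>. norm (G z) \<le> C * norm (z - z0) ^ k (Some z0))" if z0: "z0 \<in> B" for z0
  proof -
    have "F (Some z0) \<in> - {Some 0}" using z0 by (auto simp: B_def)
    from charts[OF atl(1) atl(2) rangeI this, unfolded inv_into_charts option.sel]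
    obtain \<epsilon> G C where G: "\<epsilon> > 0" "G holomorphic_on ball z0 \<epsilon>"
      "\<forall>z\<in>ball z0 \<epsilon>. F (Some z) \<in> - {Some 0} \<and> chart_at_infinity (F (Some z)) = G z \<and>
        norm (G z - G z0) \<le> C * norm (z - z0) ^ k (Some z0) \<and> (z \<noteq> z0 \<longrightarrow> G z \<noteq> G z0)"
      by (elim exE conjE)
    have Gz0: "G z0 = 0" using bspec[OF G(3), of z0] G(1) z0 by (simp add: B_def chart_at_infinity_def)
    have "z \<notin> B \<and> h z \<noteq> 0 \<and> G z = inverse (h z) \<and> G z \<noteq> 0" if z: "z \<in> ball z0 \<epsilon>" "z \<noteq> z0" for z
    proof (cases "F (Some z)")
      case None
      hence "G z = 0" using bspec[OF G(3) z(1)] by (simp add: chart_at_infinity_def)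
      thus ?thesis using bspec[OF G(3) z(1)] z(2) Gz0 by simp
    next
      case (Some w)
      thus ?thesis using bspec[OF G(3) z(1)] by (auto simp: B_def h_def chart_at_infinity_def)
    qed
    moreover have "\<forall>z\<in>ball z0 \<epsilon>. norm (G z) \<le> C * norm (z - z0) ^ k (Some z0)" using G(3) Gz0 by simp
    ultimately show ?thesis using G(1,2) Gz0
      by (intro exI[of _ \<epsilon>] exI[of _ G] exI[of _ C] conjI ballI impI) simp_all
  qed
  \<comment> \<open>near infinity\<close>
  have none_dom: "None \<in> - {Some (0 :: complex)}" and chart_none: "chart_at_infinity None = 0"
    by (simp_all add: chart_at_infinity_def)
  have at_inf: "\<exists>R>0. \<exists>C n. \<forall>z. norm z \<ge> R \<longrightarrow> z \<notin> B \<and> norm (h z) \<le> C * norm z ^ n"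
  proof (cases "F None")
    case (Some b)
    have "F None \<in> range Some" using Some by simp
    from charts[OF atl(2) atl(1) none_dom this, unfolded inv_into_charts chart_none]
    obtain \<epsilon> G C0 where G: "\<epsilon> > 0" "G holomorphic_on ball 0 \<epsilon>"
      "\<forall>w\<in>ball 0 \<epsilon>. F (point_near_infinity w) \<in> range Some \<and> the (F (point_near_infinity w)) = G w \<and>
        norm (G w - G 0) \<le> C0 * norm (w - 0) ^ k None \<and> (w \<noteq> 0 \<longrightarrow> G w \<noteq> G 0)"
      by (elim exE conjE)
    have "0 \<in> ball 0 \<epsilon>" using G(1) by simp
    from holomorphic_linear_bound[OF G(2) open_ball this]
    obtain \<epsilon>' C where C: "\<epsilon>' > 0" "C \<ge> 0" "ball (0 :: complex) \<epsilon>' \<subseteq> ball 0 \<epsilon>"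
        "\<forall>w\<in>ball 0 \<epsilon>'. norm (G w - G 0) \<le> C * norm (w - 0)"
      by (elim exE conjE)
    have "z \<notin> B \<and> norm (h z) \<le> (C * \<epsilon>' + norm (G 0)) * norm z ^ 0" if z: "norm z \<ge> 2 / \<epsilon>'" for z
    proof -
      have "0 < 2 / \<epsilon>'" using C(1) by simp
      hence "norm z > 0" using z by linarith
      hence "z \<noteq> 0" by simp
      have "norm (inverse z) \<le> \<epsilon>' / 2"
        using le_imp_inverse_le[OF z] C(1) by (simp add: norm_inverse)
      hence w: "inverse z \<in> ball 0 \<epsilon>'" using C(1) by simp
      hence F: "F (Some z) \<in> range Some \<and> the (F (Some z)) = G (inverse z)"
        using bspec[OF G(3) subsetD[OF C(3) w]] \<open>z \<noteq> 0\<close> by (simp add: point_near_infinity_def)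
      have "norm (G (inverse z)) \<le> norm (G (inverse z) - G 0) + norm (G 0)"
        using norm_triangle_ineq[of "G (inverse z) - G 0" "G 0"] by simp
      also have "norm (G (inverse z) - G 0) \<le> C * norm (inverse z - 0)" by (rule bspec[OF C(4) w])
      also have "C * norm (inverse z - 0) \<le> C * \<epsilon>'" using w C(2) by (intro mult_left_mono) auto
      finally have "norm (G (inverse z)) \<le> C * \<epsilon>' + norm (G 0)" by simp
      thus ?thesis using F by (auto simp: B_def h_def)
    qed
    moreover have "2 / \<epsilon>' > 0" using C(1) by simp
    ultimately show ?thesis by blast
  next
    case None
    have "F None \<in> - {Some 0}" using None by simp
    from charts[OF atl(2) atl(2) none_dom this, unfolded inv_into_charts chart_none]
    obtain \<epsilon> G C0 where G: "\<epsilon> > 0" "G holomorphic_on ball 0 \<epsilon>"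
      "\<forall>w\<in>ball 0 \<epsilon>. F (point_near_infinity w) \<in> - {Some 0} \<and> chart_at_infinity (F (point_near_infinity w)) = G w \<and>
        norm (G w - G 0) \<le> C0 * norm (w - 0) ^ k None \<and> (w \<noteq> 0 \<longrightarrow> G w \<noteq> G 0)"
      by (elim exE conjE)
    have "point_near_infinity 0 = None" by (simp add: point_near_infinity_def)
    hence G0: "G 0 = 0" using bspec[OF G(3), of 0] G(1) None by (simp add: chart_at_infinity_def)
    obtain n c \<epsilon>' where c: "c > 0" "\<epsilon>' > 0" "\<epsilon>' \<le> \<epsilon>" "\<And>w. w \<in> ball 0 \<epsilon>' \<Longrightarrow> c * norm (w - 0) ^ n \<le> norm (G w)"
      by (rule holomorphic_power_lower_bound[OF G(2,1) G0]) (use G(3) G0 that in auto)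
    have "z \<notin> B \<and> norm (h z) \<le> inverse c * norm z ^ n" if z: "norm z \<ge> 2 / \<epsilon>'" for z
    proof -
      have "0 < 2 / \<epsilon>'" using c(2) by simp
      hence "norm z > 0" using z by linarith
      hence "z \<noteq> 0" by simp
      have "norm (inverse z) \<le> \<epsilon>' / 2"
        using le_imp_inverse_le[OF z] c(2) by (simp add: norm_inverse)
      hence w: "inverse z \<in> ball 0 \<epsilon>'" using c(2) by simp
      have F: "chart_at_infinity (F (Some z)) = G (inverse z)" "G (inverse z) \<noteq> 0"
        using bspec[OF G(3), of "inverse z"] w c(3) \<open>z \<noteq> 0\<close> G0 by (auto simp: point_near_infinity_def)
      then obtain y where y: "F (Some z) = Some y" "inverse y = G (inverse z)"
        by (cases "F (Some z)") (auto simp: chart_at_infinity_def)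
      have "c * inverse (norm z ^ n) \<le> inverse (norm y)"
        using c(4)[OF w] unfolding y(2)[symmetric] by (simp add: norm_inverse power_inverse)
      moreover have "norm y > 0" using F(2) y(2) by auto
      ultimately have "norm y \<le> inverse c * norm z ^ n"
        using c(1) \<open>norm z > 0\<close> by (simp add: field_simps)
      thus ?thesis using y(1) by (simp add: B_def h_def)
    qed
    moreover have "2 / \<epsilon>' > 0" using c(2) by simp
    ultimately show ?thesis by blast
  qed
  then obtain R C n where R: "R > 0" "\<And>z. norm z \<ge> R \<Longrightarrow> z \<notin> B" "\<And>z. norm z \<ge> R \<Longrightarrow> norm (h z) \<le> C * norm z ^ n"
    by blast
  have finB: "finite B"
  proof (rule ccontr)
    assume inf: "infinite B"
    have "B \<subseteq> cball 0 R" using R(2) by (metis dist_0_norm linear mem_cball subsetI)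
    then obtain z0 where z0: "z0 islimpt B"
      using inf compact_cball[of "0 :: complex" R] unfolding compact_eq_Bolzano_Weierstrass by blast
    have "\<exists>\<epsilon>>0. \<forall>z\<in>ball z0 \<epsilon>. z \<noteq> z0 \<longrightarrow> z \<notin> B"
    proof (cases "z0 \<in> B")
      case True
      from fin_inf[OF this] show ?thesis by blast
    next
      case False
      from fin_fin[OF this] show ?thesis by blast
    qed
    then obtain \<epsilon> where "\<epsilon> > 0" "\<forall>z\<in>ball z0 \<epsilon>. z \<noteq> z0 \<longrightarrow> z \<notin> B" by blast
    thus False using z0 unfolding islimpt_approachable by (metis dist_commute mem_ball)
  qed
  have h_hol: "h holomorphic_on - B"
  proof -
    have "h field_differentiable at z" if z: "z \<in> - B" for z
    proof -
      have "z \<notin> B" using z by simp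
      from fin_fin[OF this] obtain \<epsilon> where "\<epsilon> > 0" "h holomorphic_on ball z \<epsilon>" by blast
      thus ?thesis using holomorphic_on_imp_differentiable_at[OF _ open_ball] by simp
    qed
    thus ?thesis by (simp add: holomorphic_on_def field_differentiable_at_within)
  qed
  have poles: "\<exists>k. ((\<lambda>z. (z - b) ^ k * h z) \<longlongrightarrow> 0) (at b)" if b: "b \<in> B" for b
  proof -
    obtain \<epsilon> G where G: "\<epsilon> > 0" "G holomorphic_on ball b \<epsilon>" "G b = 0"
      "\<And>z. z \<in> ball b \<epsilon> \<Longrightarrow> z \<noteq> b \<Longrightarrow> h z \<noteq> 0 \<and> G z = inverse (h z) \<and> G z \<noteq> 0"
      using fin_inf[OF b] by blast
    have nz: "\<forall>z\<in>ball b \<epsilon> - {b}. G z \<noteq> 0" using G(4) by blast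
    obtain n c \<epsilon>' where c: "c > 0" "\<epsilon>' > 0" "\<epsilon>' \<le> \<epsilon>" "\<And>z. z \<in> ball b \<epsilon>' \<Longrightarrow> c * norm (z - b) ^ n \<le> norm (G z)"
      by (rule holomorphic_power_lower_bound[OF G(2,1,3) nz]) (rule that)
    have "\<forall>\<^sub>F z in at b. norm ((z - b) ^ Suc n * h z) \<le> inverse c * norm (z - b)"
      unfolding eventually_at
    proof (intro exI[of _ \<epsilon>'] conjI c(2) ballI impI)
      fix z assume z: "z \<noteq> b \<and> dist z b < \<epsilon>'"
      hence "z \<in> ball b \<epsilon>'" by (simp add: dist_commute)
      hence low: "c * norm (z - b) ^ n \<le> norm (G z)" by (rule c(4))
      have hz: "h z \<noteq> 0" "G z = inverse (h z)" using G(4)[of z] z c(3) by (auto simp: dist_commute)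
      have "c * norm (z - b) ^ n * norm (h z) \<le> norm (G z) * norm (h z)"
        using low by (rule mult_right_mono) simp
      also have "\<dots> = 1" using hz(1) unfolding hz(2) norm_inverse by simp
      finally have "c * norm (z - b) ^ n * norm (h z) \<le> 1" .
      hence "norm (z - b) ^ n * norm (h z) \<le> inverse c" using c(1) by (simp add: field_simps)
      hence "norm (z - b) * (norm (z - b) ^ n * norm (h z)) \<le> norm (z - b) * inverse c"
        by (intro mult_left_mono) auto
      thus "norm ((z - b) ^ Suc n * h z) \<le> inverse c * norm (z - b)"
        by (simp add: norm_mult norm_power mult_ac)
    qed
    moreover have "((\<lambda>z. inverse c * norm (z - b)) \<longlongrightarrow> 0) (at b)"
      by (rule tendsto_eq_intros refl | simp)+
    ultimately have "((\<lambda>z. (z - b) ^ Suc n * h z) \<longlongrightarrow> 0) (at b)"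
      by (rule Lim_null_comparison)
    thus ?thesis by blast
  qed
  have "\<exists>N L. (\<forall>z. z \<notin> B \<longrightarrow> poly L z \<noteq> 0) \<and> (\<forall>z. z \<notin> B \<longrightarrow> h z = poly N z / poly L z)"
  proof (rule rational_from_growth[OF finB h_hol poles, where R = R and C = C and n = n])
    show "norm (h z) \<le> C * norm z ^ n" if "R \<le> norm z" for z using R(3)[OF that] .
    fix N L assume "\<And>z. z \<notin> B \<Longrightarrow> poly L z \<noteq> 0" "\<And>z. z \<notin> B \<Longrightarrow> h z = poly N z / poly L z"
    thus ?thesis by (intro exI[of _ N] exI[of _ L]) simp
  qed
  then obtain N L where NL_all: "\<forall>z. z \<notin> B \<longrightarrow> poly L z \<noteq> 0" "\<forall>z. z \<notin> B \<longrightarrow> h z = poly N z / poly L z"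
    by (elim exE conjE)
  have NL: "poly L z \<noteq> 0" "h z = poly N z / poly L z" if "z \<notin> B" for z
    using NL_all that by simp_all
  have "\<exists>z. z \<notin> B" using finB infinite_UNIV_char_0[where 'a = complex] by (metis UNIV_eq_I)
  then obtain zr where zr: "zr \<notin> B" by blast
  have "L \<noteq> 0" using NL(1)[OF zr] by auto
  \<comment> \<open>reduce the fraction \<open>N / L\<close> to lowest terms\<close>
  obtain s t d where d: "d = s * L + t * N" "d \<noteq> 0" "d dvd L" "d dvd N"
    by (rule degree_minimal_Bezout[OF \<open>L \<noteq> 0\<close>])
  obtain p where p: "N = d * p" using d(4) by (elim dvdE)
  obtain q where q: "L = d * q" using d(3) by (elim dvdE)
  have "d * (s * q + t * p) = s * (d * q) + t * (d * p)" by (simp only: distrib_left mult_ac)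
  also have "\<dots> = d * 1" unfolding p[symmetric] q[symmetric] by (simp add: d(1))
  finally have bezout: "s * q + t * p = 1" using d(2) by (simp only: mult_cancel_left) simp
  have cop: "poly p z \<noteq> 0 \<or> poly q z \<noteq> 0" for z
  proof (rule ccontr)
    assume "\<not> ?thesis"
    hence "poly (s * q + t * p) z = 0" by simp
    thus False by (simp add: bezout)
  qed
  have hq: "poly q z \<noteq> 0" "h z = poly p z / poly q z" if "z \<notin> B" for z
    using NL[OF that] by (auto simp: p q)
  \<comment> \<open>a pole of the covering is a zero of the reduced denominator, since \<open>q = p / h\<close> tends to zero there\<close>
  have qB: "poly q z = 0" if z: "z \<in> B" for z
  proof (rule ccontr)
    assume nz: "poly q z \<noteq> 0"
    obtain \<epsilon> G where G: "\<epsilon> > 0" "G holomorphic_on ball z \<epsilon>" "G z = 0"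
      "\<And>y. y \<in> ball z \<epsilon> \<Longrightarrow> y \<noteq> z \<Longrightarrow> y \<notin> B \<and> h y \<noteq> 0 \<and> G y = inverse (h y)"
      using fin_inf[OF z] by blast
    have "isCont G z"
      using holomorphic_on_imp_continuous_on[OF G(2)] G(1) by (simp add: continuous_on_eq_continuous_at)
    hence "((\<lambda>y. G y * poly p y) \<longlongrightarrow> 0 * poly p z) (at z)"
      using G(3) poly_isCont[of z p] by (intro tendsto_mult) (simp_all add: isCont_def)
    moreover have "\<forall>\<^sub>F y in at z. G y * poly p y = poly q y"
      unfolding eventually_at
    proof (intro exI[of _ \<epsilon>] conjI G(1) ballI impI)
      fix y assume "y \<noteq> z \<and> dist y z < \<epsilon>"
      hence y: "y \<notin> B" "h y \<noteq> 0" "G y = inverse (h y)" using G(4)[of y] by (auto simp: dist_commute)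
      thus "G y * poly p y = poly q y" using hq[OF y(1)] by (auto simp: field_simps)
    qed
    ultimately have "((\<lambda>y. poly q y) \<longlongrightarrow> 0 * poly p z) (at z)" by (rule Lim_transform_eventually)
    moreover have "((\<lambda>y. poly q y) \<longlongrightarrow> poly q z) (at z)" by (metis isCont_def poly_isCont)
    ultimately have "poly q z = 0 * poly p z" by (intro tendsto_unique[OF at_neq_bot])
    thus False using nz by simp
  qed
  have nonzero: "zero_form a p q \<noteq> 0" for a
  proof (cases a)
    case None
    thus ?thesis using \<open>L \<noteq> 0\<close> q by (auto simp: zero_form_def)
  next
    case (Some b)
    obtain \<epsilon> where \<epsilon>: "\<epsilon> > 0" "ball zr \<epsilon> \<inter> B = {}" "\<And>z. z \<in> ball zr \<epsilon> \<Longrightarrow> z \<noteq> zr \<Longrightarrow> h z \<noteq> h zr"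
      using fin_fin[OF zr] by blast
    define z where "z = zr + of_real (\<epsilon> / 2)"
    have z: "z \<in> ball zr \<epsilon>" "z \<noteq> zr" using \<epsilon>(1) by (auto simp: z_def dist_norm)
    show ?thesis
    proof
      assume "zero_form a p q = 0"
      hence "p = smult b q" using Some by (simp add: zero_form_def)
      hence "h y = b" if "y \<notin> B" for y using hq[OF that] by simp
      moreover have "z \<notin> B" using \<epsilon>(2) z(1) by blast
      ultimately show False using \<epsilon>(3)[OF z] zr by simp
    qed
  qed
  have ram: "r a \<le> order z0 (zero_form a p q)" if a: "a \<in> A" and root: "poly (zero_form a p q) z0 = 0" for a z0
  proof (cases "z0 \<in> B")
    case True
    have "poly q z0 = 0" by (rule qB[OF True])
    hence "a = None" using root cop[of z0] by (cases a) (auto simp: zero_form_def)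
    hence form: "zero_form a p q = - q" by (simp add: zero_form_def)
    have k: "k (Some z0) = r a" using True a \<open>a = None\<close> by (simp add: k_def B_def)
    obtain \<epsilon> G C where G: "\<epsilon> > 0" "\<And>z. z \<in> ball z0 \<epsilon> \<Longrightarrow> z \<noteq> z0 \<Longrightarrow> z \<notin> B \<and> h z \<noteq> 0 \<and> G z = inverse (h z)"
      "\<And>z. z \<in> ball z0 \<epsilon> \<Longrightarrow> norm (G z) \<le> C * norm (z - z0) ^ k (Some z0)"
      using fin_inf[OF True] by blast
    show ?thesis
    proof (rule order_ge_of_factor_growth[OF nonzero G(1), where w = "- p" and G = G and C = C])
      fix z assume z: "z \<in> ball z0 \<epsilon>"
      show "norm (G z) \<le> C * norm (z - z0) ^ r a" using G(3)[OF z] unfolding k .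
    next
      fix z assume z: "z \<in> ball z0 \<epsilon> - {z0}"
      hence h: "z \<notin> B" "h z \<noteq> 0" "G z = inverse (h z)" using G(2)[of z] by auto
      have "poly p z = h z * poly q z" using hq[OF h(1)] by simp
      hence "poly q z = G z * poly p z" using h(2) by (simp add: h(3) mult.assoc[symmetric])
      thus "poly (zero_form a p q) z = G z * poly (- p) z" by (simp add: form)
    qed
  next
    case False
    have qz0: "poly q z0 \<noteq> 0" and hz0: "h z0 = poly p z0 / poly q z0" using hq[OF False] by auto
    then obtain b where b: "a = Some b" "b = h z0"
      using root by (cases a) (auto simp: zero_form_def)
    have "F (Some z0) = Some (h z0)" using False by (auto simp: B_def h_def)
    hence k: "k (Some z0) = r a" using a b by (simp add: k_def)
    obtain \<epsilon> C where G: "\<epsilon> > 0" "ball z0 \<epsilon> \<inter> B = {}"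
      "\<And>z. z \<in> ball z0 \<epsilon> \<Longrightarrow> norm (h z - h z0) \<le> C * norm (z - z0) ^ k (Some z0)"
      using fin_fin[OF False] by blast
    show ?thesis
    proof (rule order_ge_of_factor_growth[OF nonzero G(1), where w = q and G = "\<lambda>z. h z - h z0" and C = C])
      fix z assume z: "z \<in> ball z0 \<epsilon>"
      show "norm (h z - h z0) \<le> C * norm (z - z0) ^ r a" using G(3)[OF z] unfolding k .
    next
      fix z assume "z \<in> ball z0 \<epsilon> - {z0}"
      hence zB: "z \<notin> B" using G(2) by auto
      show "poly (zero_form a p q) z = (h z - h z0) * poly q z"
        using hq[OF zB] by (simp add: b zero_form_def left_diff_distrib)
    qed
  qed
  show thesis by (rule that[of p q]) (use cop nonzero ram in auto)
qed

section \<open>Algebraic functions of elliptic signature\<close>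

theorem theorem6:
  fixes P :: "complex poly fract poly"
    and A :: "complex option set"
    and r :: "complex option \<Rightarrow> nat"
    and Z :: "'z surface"
    and \<pi> :: "'z \<Rightarrow> complex option"
  assumes "algebraic_function P"
    and "has_signature P A r"
    and "card A \<ge> 2"
    and "card A = 2 \<longrightarrow> (\<forall>a \<in> A. \<forall>b \<in> A. r a = r b)"
    and elliptic: "universal_covering_with_signature Z \<pi> A r"
      "isomorphic_surfaces Z riemann_sphere"
  shows "(orders A r \<noteq> {#2, 3, 5#} \<longrightarrow> representable_in_radicals P) \<and>
         (orders A r = {#2, 3, 5#} \<longrightarrow>
            representable_by_radicals_and_equations_of_degree_at_most 5 P)"
proof -
  obtain Q B where Q: "finite B" "degree Q > 0"
    "\<And>x. x \<notin> B \<Longrightarrow> coeffs_finite_at P x"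
    "\<And>x. x \<notin> B \<Longrightarrow> fiber P x = {w. bipoly Q x w = 0}"
    "\<And>x. x \<notin> B \<Longrightarrow> poly (lead_coeff Q) x \<noteq> 0"
    "\<And>x w. x \<notin> B \<Longrightarrow> bipoly Q x w = 0 \<Longrightarrow> bipoly (pderiv Q) x w \<noteq> 0"
    by (rule generic_fiber[OF assms(1)]) (rule that)
  interpret squarefree_family Q B
    by unfold_locales (use Q in auto)
  interpret algebraic_fibers Q B P
    by unfold_locales (use Q(4) in \<open>simp add: roots_def\<close>)
  have A: "A = branching_locus P" "\<And>a. a \<in> A \<Longrightarrow> local_monodromy_order P a (r a)"
    using assms(2) unfolding has_signature_def by auto
  \<comment> \<open>membership in the branching locus gives some order above one, which by uniqueness is \<open>r a\<close>\<close>
  have r2: "r a \<ge> 2" if a: "a \<in> A" for a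
  proof -
    obtain k where "k > 1" "local_monodromy_order P a k"
      using a unfolding A(1) branching_locus_def by blast
    thus ?thesis using local_monodromy_order_unique[OF _ A(2)[OF a]] by fastforce
  qed
  \<comment> \<open>outside \<open>A\<close> the local order is one: it exists, and a larger one would put the point into the branching locus\<close>
  have order_cases: "a \<in> A \<and> k = r a \<or> k = 1" if k: "local_monodromy_order P a k" for a k
  proof (cases "a \<in> A")
    case True
    thus ?thesis using local_monodromy_order_unique[OF k A(2)] by blast
  next
    case False
    obtain k' \<rho> Y where k': "k' > 0" "local_monodromy_order P a k'" "\<rho> > 0"
      "\<And>s. norm s < \<rho> \<Longrightarrow> s \<noteq> 0 \<Longrightarrow> sphere_coordinate a (s ^ k') \<notin> B"
      "splits_over (\<lambda>s. fiber P (sphere_coordinate a (s ^ k'))) (ball 0 \<rho> - {0}) Y"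
      by (rule fiber_uniformization[of a]) (rule that)
    have "\<not> k' > 1" using False k'(2) unfolding A(1) branching_locus_def by blast
    hence "k' = 1" using k'(1) by linarith
    thus ?thesis using local_monodromy_order_unique[OF k k'(2)] by simp
  qed
  obtain p0 q0 where pq0: "\<And>z. poly p0 z \<noteq> 0 \<or> poly q0 z \<noteq> 0" "\<And>a. zero_form a p0 q0 \<noteq> 0"
    "\<And>a z. a \<in> A \<Longrightarrow> poly (zero_form a p0 q0) z = 0 \<Longrightarrow> r a \<le> order z (zero_form a p0 q0)"
    by (rule spherical_covering_rational[OF elliptic]) (rule that)
  have "finite A" using assms(3) by (metis card.infinite not_numeral_le_zero)
  have "(\<Sum>a\<in>A. 1 - 1 / real (r a)) < 2"
  proof (rule ramification_inequality[OF pq0(1,2) \<open>finite A\<close> assms(3)])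
    show "r a > 0" if "a \<in> A" for a using r2[OF that] by linarith
  qed (rule pq0(3))
  \<comment> \<open>only the icosahedral orders require \<open>m\<close> to be at least five\<close>
  have main: "representable m P" if m: "orders A r = {#2, 3, 5#} \<Longrightarrow> m \<ge> 5" for m
  proof -
    obtain p q where pq: "uniformizes m A r p q"
      using spherical_signature_uniformizable[OF assms(3,4) r2 \<open>_ < 2\<close> m] by blast
    show ?thesis
    proof (rule uniformized_imp_representable)
      show "unwinds m p q" "\<And>z. poly p z \<noteq> 0 \<or> poly q z \<noteq> 0"
        using pq unfolding uniformizes_def by blast+
      fix a k assume "local_monodromy_order P a k"
      from order_cases[OF this] show "power_up_to_scalar k (zero_form a p q)"
      proof
        assume "a \<in> A \<and> k = r a"
        thus ?thesis using pq unfolding uniformizes_def by blast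
      next
        assume "k = 1"
        thus ?thesis using power_up_to_scalar_power(2)[of 1 "zero_form a p q"] by simp
      qed
    qed (rule Q(3))
  qed
  show ?thesis
    unfolding representable_in_radicals_def representable_by_radicals_and_equations_of_degree_at_most_def
  proof (intro conjI impI)
    assume "orders A r \<noteq> {#2, 3, 5#}"
    thus "representable 0 P" by (intro main) simp
  next
    show "representable 5 P" by (rule main) simp
  qed
qed

end
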